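(* Let $(G,\rho)$ be a non-crossing framework in the plane, with $G$ $2$-connected, with a good self-stress $\omega$, let $(G,\mu)$ be its standard lifting and $(G^*,\rho^* )$ its Maxwell reciprocal. For any vertex of the lifted surface except the maximum (the peak), there is a plane through that vertex that cuts its neighborhood in the surface in the "saddle-point" way into $4$ pieces. No plane through a vertex cuts its neighborhood into more than $4$ pieces. More precisely: for every general direction in the interior of the reciprocal figure there is a unique vertex such that the plane with this normal through the vertex cuts its neighborhood in the "saddle-point" way into $4$ pieces; for planes with this normal, all other vertex neighborhoods are cut into two pieces (by the plane through the respective vertex), with the exception of the peak, whose neighborhood lies entirely below the plane. For all directions in the outer face of the reciprocal, the plane with that normal through any vertex, including the peak, cuts the neighborhood of that vertex into two pieces.
   Context: Framework: a finite simple graph $G=(V,E)$ with a map $\rho:V\to\mathbb{R}^2$, $\rho(i)=p_i$, edges drawn as straight segments; non-crossing if vertices are distinct points and two edge segments meet at most in a common endpoint (a vertex never lies in the interior of an edge). Vertices with two angles equal to $\pi$ are not allowed. Self-stress: $\omega:E\to\mathbb{R}$ with $\sum_{j:ij\in E}\omega_{ij}(p_i-p_j)=0$ for every $i\in V$. Reciprocal: $G^*$ is the dual plane graph of the drawing $(G,\rho)$ (one vertex per face, including the outer one; one edge per edge); the reciprocal is the framework on $G^*$, unique up to translation, such that for every directed edge $i\to j$ with left face $L$ and right face $R$, $\rho^*(L)-\rho^*(R)=\omega_{ij}(p_j-p_i)$. It is non-crossing if it is a non-crossing framework and its embedding is dual to that of $(G,\rho)$: face cycles become vertex cycles (cyclic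 orders of edges around vertices) and vertex cycles become face cycles, either all with the same orientation or all with reversed orientation (orientation of the outer face being considered from outside). A good self-stress is one that is non-zero on all edges and has a non-crossing reciprocal; then all edges of the boundary cycle of $(G,\rho)$ have the same sign. The standard lifting $(G,\mu)$ is the graph of the continuous function $h:\mathbb{R}^2\to\mathbb{R}$ that is affine on each face (including the outer face), identically $0$ on the outer face, and satisfies, for every directed edge $i\to j$ with left face $L$ and right face $R$, $\nabla h|_L-\nabla h|_R=c\,\omega_{ij}\,J(p_j-p_i)$, where $J$ is the counterclockwise rotation by $90^\circ$ and $c\in\{1,-1\}$ is chosen so that $c\,\omega_{ij}>0$ on boundary edges. This surface has a unique local and global maximum, attained at a vertex: the peak. The Maxwell reciprocal is the reciprocal rotated by $90^\circ$ (and suitably oriented and translated) so that the reciprocal vertex of each face $F$ is located at $\nabla h|_F\in\mathbb{R}^2$ (equivalently, it is the intersection with the plane $z=0$ of the normal to the lifted face drawn through $(0,0,1)$). Directions: a point $q\in\mathbb{R}^2$ represents the normal $(q,-1)$, i.e. planes of gradient $q$; it is a direction in the interior of the reciprocal figure, resp. in the outer face, if $q$ lies inside the boundary cycle of the Maxwell reciprocal, resp. in its (open) outer face; a direction is general if $q$ does not lie on a vertex or edge of the reciprocal. "Cuts the neighborhood of a vertex into $k$ pieces" means that a small neighborhood of the vertex in the surface, minus the plane through the vertex, has $k$ components; the saddle-point way with $4$ pieces means these are alternately above and below the plane around the vertex. *)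

theory Defs
  imports "HOL-Analysis.Analysis"
begin

text \<open>The plane is the type \<^typ>\<open>complex\<close>, so that the counterclockwise rotation by a right
  angle is multiplication by \<^term>\<open>\<i>\<close>; its inner product is the Euclidean one. Space is
  \<^typ>\<open>complex \<times> real\<close>, with the height as second component.\<close>


subsection \<open>Graphs\<close>

definition simple_graph :: "'v set \<Rightarrow> 'v set set \<Rightarrow> bool" where
  "simple_graph V E \<longleftrightarrow> finite V \<and> (\<forall>e\<in>E. e \<subseteq> V \<and> card e = 2)"

text \<open>Connectedness of the subgraph induced on \<open>W\<close>; edges leaving \<open>W\<close> are ignored.\<close>

definition graph_connected :: "'v set \<Rightarrow> 'v set set \<Rightarrow> bool" where
  "graph_connected W E \<longleftrightarrow>
     W \<noteq> {} \<and> (\<forall>u\<in>W. \<forall>v\<in>W. (u, v) \<in> {(a, b). a \<in> W \<and> b \<in> W \<and> {a, b} \<in> E}\<^sup>*)"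

definition two_connected :: "'v set \<Rightarrow> 'v set set \<Rightarrow> bool" where
  "two_connected V E \<longleftrightarrow>
     3 \<le> card V \<and> graph_connected V E \<and> (\<forall>v\<in>V. graph_connected (V - {v}) E)"


subsection \<open>Non-crossing frameworks and their combinatorial embedding\<close>

abbreviation edge_segment :: "('v \<Rightarrow> complex) \<Rightarrow> 'v set \<Rightarrow> complex set" where
  "edge_segment p e \<equiv> convex hull (p ` e)"

text \<open>The angle swept counterclockwise from \<open>a\<close> to \<open>b\<close>, in the range from \<open>0\<close> (exclusive) to
  \<open>2 * pi\<close> (inclusive). The value \<open>2 * pi\<close> for parallel vectors makes the edge at a vertex
  of degree one its own successor below.\<close>

definition ccw_angle :: "complex \<Rightarrow> complex \<Rightarrow> real" where
  "ccw_angle a b = (if Arg2pi (b / a) = 0 then 2 * pi else Arg2pi (b / a))"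

text \<open>The edge \<open>vk\<close> follows \<open>vj\<close> in the counterclockwise cyclic order of the edges at \<open>v\<close>.\<close>

definition rot_succ :: "'v set set \<Rightarrow> ('v \<Rightarrow> complex) \<Rightarrow> 'v \<Rightarrow> 'v \<Rightarrow> 'v \<Rightarrow> bool" where
  "rot_succ E p v j k \<longleftrightarrow> {v, j} \<in> E \<and> {v, k} \<in> E \<and>
     (\<forall>l. {v, l} \<in> E \<longrightarrow>
        ccw_angle (p j - p v) (p k - p v) \<le> ccw_angle (p j - p v) (p l - p v))"

text \<open>The directed edge from \<open>j\<close> to \<open>k\<close> follows the one from \<open>i\<close> to \<open>j\<close> in the cycle of the face
  to the left of both. As the face is kept on the left for every face, the outer face is
  traversed counterclockwise as seen from outside, i.e. clockwise in the plane.\<close>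

definition face_succ :: "'v set set \<Rightarrow> ('v \<Rightarrow> complex) \<Rightarrow> 'v \<Rightarrow> 'v \<Rightarrow> 'v \<Rightarrow> bool" where
  "face_succ E p i j k \<longleftrightarrow> rot_succ E p j k i"

definition two_straight_angles :: "'v set set \<Rightarrow> ('v \<Rightarrow> complex) \<Rightarrow> 'v \<Rightarrow> bool" where
  "two_straight_angles E p v \<longleftrightarrow>
     (\<exists>j j' k k'. j \<noteq> j' \<and> rot_succ E p v j k \<and> rot_succ E p v j' k' \<and>
        ccw_angle (p j - p v) (p k - p v) = pi \<and> ccw_angle (p j' - p v) (p k' - p v) = pi)"

definition noncrossing_framework :: "'v set \<Rightarrow> 'v set set \<Rightarrow> ('v \<Rightarrow> complex) \<Rightarrow> bool" where
  "noncrossing_framework V E p \<longleftrightarrow>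
     simple_graph V E \<and> inj_on p V \<and>
     (\<forall>e\<in>E. \<forall>f\<in>E. e \<noteq> f \<longrightarrow> edge_segment p e \<inter> edge_segment p f \<subseteq> p ` (e \<inter> f)) \<and>
     (\<forall>e\<in>E. \<forall>v\<in>V. v \<notin> e \<longrightarrow> p v \<notin> edge_segment p e) \<and>
     (\<forall>v\<in>V. \<not> two_straight_angles E p v)"

definition drawing :: "'v set \<Rightarrow> 'v set set \<Rightarrow> ('v \<Rightarrow> complex) \<Rightarrow> complex set" where
  "drawing V E p = p ` V \<union> (\<Union>e\<in>E. edge_segment p e)"

definition faces :: "'v set \<Rightarrow> 'v set set \<Rightarrow> ('v \<Rightarrow> complex) \<Rightarrow> complex set set" where
  "faces V E p = components (- drawing V E p)"

text \<open>\<open>F\<close> is the face to the left of the directed edge from \<open>i\<close> to \<open>j\<close>; the face to its right is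
  the one to the left of the directed edge from \<open>j\<close> to \<open>i\<close>. In a non-crossing framework any
  interior point of the edge could serve in place of the midpoint.\<close>

definition left_face ::
    "'v set \<Rightarrow> 'v set set \<Rightarrow> ('v \<Rightarrow> complex) \<Rightarrow> 'v \<Rightarrow> 'v \<Rightarrow> complex set \<Rightarrow> bool" where
  "left_face V E p i j F \<longleftrightarrow> {i, j} \<in> E \<and> F \<in> faces V E p \<and>
     (\<forall>\<^sub>F \<epsilon> in at_right 0. midpoint (p i) (p j) + \<epsilon> *\<^sub>R (\<i> * (p j - p i)) \<in> F)"

definition boundary_edge ::
    "'v set \<Rightarrow> 'v set set \<Rightarrow> ('v \<Rightarrow> complex) \<Rightarrow> 'v set \<Rightarrow> bool" where
  "boundary_edge V E p e \<longleftrightarrow> (\<exists>i j F. e = {i, j} \<and> left_face V E p i j F \<and> \<not> bounded F)"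


subsection \<open>Self-stresses and reciprocals\<close>

definition self_stress ::
    "'v set \<Rightarrow> 'v set set \<Rightarrow> ('v \<Rightarrow> complex) \<Rightarrow> ('v set \<Rightarrow> real) \<Rightarrow> bool" where
  "self_stress V E p \<omega> \<longleftrightarrow> (\<forall>i\<in>V. (\<Sum>j | {i, j} \<in> E. \<omega> {i, j} *\<^sub>R (p i - p j)) = 0)"

text \<open>The vertices of the dual graph are the faces.\<close>

definition dual_edge ::
    "'v set \<Rightarrow> 'v set set \<Rightarrow> ('v \<Rightarrow> complex) \<Rightarrow> 'v set \<Rightarrow> complex set set" where
  "dual_edge V E p e = {F. \<exists>i j. e = {i, j} \<and> left_face V E p i j F}"

abbreviation dual_edges ::
    "'v set \<Rightarrow> 'v set set \<Rightarrow> ('v \<Rightarrow> complex) \<Rightarrow> complex set set set" where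
  "dual_edges V E p \<equiv> dual_edge V E p ` E"

definition reciprocal ::
    "'v set \<Rightarrow> 'v set set \<Rightarrow> ('v \<Rightarrow> complex) \<Rightarrow> ('v set \<Rightarrow> real) \<Rightarrow> (complex set \<Rightarrow> complex) \<Rightarrow> bool"
  where
  "reciprocal V E p \<omega> r \<longleftrightarrow>
     (\<forall>i j L R. left_face V E p i j L \<and> left_face V E p j i R \<longrightarrow>
        r L - r R = \<omega> {i, j} *\<^sub>R (p j - p i))"

text \<open>In the first conjunct, \<open>F\<close> is a face with consecutive edges \<open>ij\<close>, \<open>jk\<close>, across which lie \<open>R\<close>
  and \<open>R'\<close>. In the second one, \<open>B\<close> is the face between the consecutive edges \<open>vj\<close>, \<open>vk\<close> at \<open>v\<close>,
  across which lie \<open>A\<close> and \<open>C\<close>; the duals of these two edges are \<open>AB\<close> and \<open>BC\<close>.\<close>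

definition dual_embedding_same ::
    "'v set \<Rightarrow> 'v set set \<Rightarrow> ('v \<Rightarrow> complex) \<Rightarrow> (complex set \<Rightarrow> complex) \<Rightarrow> bool" where
  "dual_embedding_same V E p r \<longleftrightarrow>
     (\<forall>i j k F R R'. face_succ E p i j k \<and> left_face V E p i j F \<and>
        left_face V E p j i R \<and> left_face V E p k j R' \<longrightarrow>
        rot_succ (dual_edges V E p) r F R R') \<and>
     (\<forall>v j k A B C. rot_succ E p v j k \<and> left_face V E p j v A \<and>
        left_face V E p v j B \<and> left_face V E p v k C \<longrightarrow>
        face_succ (dual_edges V E p) r A B C)"

definition dual_embedding_reversed ::
    "'v set \<Rightarrow> 'v set set \<Rightarrow> ('v \<Rightarrow> complex) \<Rightarrow> (complex set \<Rightarrow> complex) \<Rightarrow> bool" where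
  "dual_embedding_reversed V E p r \<longleftrightarrow>
     (\<forall>i j k F R R'. face_succ E p i j k \<and> left_face V E p i j F \<and>
        left_face V E p j i R \<and> left_face V E p k j R' \<longrightarrow>
        rot_succ (dual_edges V E p) r F R' R) \<and>
     (\<forall>v j k A B C. rot_succ E p v j k \<and> left_face V E p j v A \<and>
        left_face V E p v j B \<and> left_face V E p v k C \<longrightarrow>
        face_succ (dual_edges V E p) r C B A)"

text \<open>Dual edges are two-element sets of faces, so parallel edges of the dual would be identified.
  Injectivity excludes them: drawn as straight segments they would overlap.\<close>

definition noncrossing_reciprocal ::
    "'v set \<Rightarrow> 'v set set \<Rightarrow> ('v \<Rightarrow> complex) \<Rightarrow> ('v set \<Rightarrow> real) \<Rightarrow> (complex set \<Rightarrow> complex) \<Rightarrow> bool"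
  where
  "noncrossing_reciprocal V E p \<omega> r \<longleftrightarrow>
     reciprocal V E p \<omega> r \<and>
     inj_on (dual_edge V E p) E \<and>
     noncrossing_framework (faces V E p) (dual_edges V E p) r \<and>
     (dual_embedding_same V E p r \<or> dual_embedding_reversed V E p r)"

definition good_self_stress ::
    "'v set \<Rightarrow> 'v set set \<Rightarrow> ('v \<Rightarrow> complex) \<Rightarrow> ('v set \<Rightarrow> real) \<Rightarrow> bool" where
  "good_self_stress V E p \<omega> \<longleftrightarrow>
     self_stress V E p \<omega> \<and> (\<forall>e\<in>E. \<omega> e \<noteq> 0) \<and> (\<exists>r. noncrossing_reciprocal V E p \<omega> r)"


subsection \<open>The standard lifting and the Maxwell reciprocal\<close>

definition affine_with_gradient :: "(complex \<Rightarrow> real) \<Rightarrow> complex set \<Rightarrow> complex \<Rightarrow> bool" where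
  "affine_with_gradient h F g \<longleftrightarrow> (\<exists>a. \<forall>x\<in>F. h x = g \<bullet> x + a)"

definition standard_lifting ::
    "'v set \<Rightarrow> 'v set set \<Rightarrow> ('v \<Rightarrow> complex) \<Rightarrow> ('v set \<Rightarrow> real) \<Rightarrow> (complex \<Rightarrow> real) \<Rightarrow> bool" where
  "standard_lifting V E p \<omega> h \<longleftrightarrow>
     continuous_on UNIV h \<and>
     (\<forall>F\<in>faces V E p. \<exists>g. affine_with_gradient h F g) \<and>
     (\<forall>F\<in>faces V E p. \<not> bounded F \<longrightarrow> (\<forall>x\<in>F. h x = 0)) \<and>
     (\<exists>c\<in>{1, -1}.
        (\<forall>e\<in>E. boundary_edge V E p e \<longrightarrow> c * \<omega> e > 0) \<and>
        (\<forall>i j L R gL gR.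
           left_face V E p i j L \<and> left_face V E p j i R \<and>
           affine_with_gradient h L gL \<and> affine_with_gradient h R gR \<longrightarrow>
           gL - gR = (c * \<omega> {i, j}) *\<^sub>R (\<i> * (p j - p i))))"

definition maxwell_reciprocal ::
    "'v set \<Rightarrow> 'v set set \<Rightarrow> ('v \<Rightarrow> complex) \<Rightarrow> (complex \<Rightarrow> real) \<Rightarrow> (complex set \<Rightarrow> complex) \<Rightarrow> bool"
  where
  "maxwell_reciprocal V E p h m \<longleftrightarrow> (\<forall>F\<in>faces V E p. affine_with_gradient h F (m F))"

definition is_peak :: "'v set \<Rightarrow> ('v \<Rightarrow> complex) \<Rightarrow> (complex \<Rightarrow> real) \<Rightarrow> 'v \<Rightarrow> bool" where
  "is_peak V p h v \<longleftrightarrow> v \<in> V \<and> (\<forall>x. h x \<le> h (p v))"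

definition reciprocal_drawing ::
    "'v set \<Rightarrow> 'v set set \<Rightarrow> ('v \<Rightarrow> complex) \<Rightarrow> (complex set \<Rightarrow> complex) \<Rightarrow> complex set" where
  "reciprocal_drawing V E p m = drawing (faces V E p) (dual_edges V E p) m"

definition outer_directions :: "complex set \<Rightarrow> complex set" where
  "outer_directions D = outside D"

text \<open>The boundary cycle of a drawing \<open>D\<close> is the frontier of its outer face.\<close>

definition interior_directions :: "complex set \<Rightarrow> complex set" where
  "interior_directions D = inside (frontier (outside D))"

abbreviation general_direction :: "complex set \<Rightarrow> complex \<Rightarrow> bool" where
  "general_direction D q \<equiv> q \<notin> D"


subsection \<open>Cutting the neighborhood of a point of the surface by a plane\<close>

definition surface :: "(complex \<Rightarrow> real) \<Rightarrow> (complex \<times> real) set" where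
  "surface h = range (\<lambda>x. (x, h x))"

definition plane_through :: "complex \<times> real \<Rightarrow> complex \<times> real \<Rightarrow> (complex \<times> real) set" where
  "plane_through n P = {X. n \<bullet> (X - P) = 0}"

text \<open>The open half-spaces above and below the plane with normal \<open>(q, -1)\<close> through \<open>P\<close>.\<close>

definition above_plane :: "complex \<Rightarrow> complex \<times> real \<Rightarrow> (complex \<times> real) set" where
  "above_plane q P = {X. snd X > snd P + q \<bullet> (fst X - fst P)}"

definition below_plane :: "complex \<Rightarrow> complex \<times> real \<Rightarrow> (complex \<times> real) set" where
  "below_plane q P = {X. snd X < snd P + q \<bullet> (fst X - fst P)}"

text \<open>The pieces into which the plane with normal \<open>n\<close> through the surface point over \<open>x\<close> cuts the
  neighborhood of radius \<open>r\<close> of that point in the surface.\<close>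

definition pieces ::
    "(complex \<Rightarrow> real) \<Rightarrow> complex \<Rightarrow> complex \<times> real \<Rightarrow> real \<Rightarrow> (complex \<times> real) set set" where
  "pieces h x n r = components (surface h \<inter> ball (x, h x) r - plane_through n (x, h x))"

definition cuts_into :: "(complex \<Rightarrow> real) \<Rightarrow> complex \<Rightarrow> complex \<times> real \<Rightarrow> nat \<Rightarrow> bool" where
  "cuts_into h x n k \<longleftrightarrow>
     (\<forall>\<^sub>F r in at_right 0. finite (pieces h x n r) \<and> card (pieces h x n r) = k)"

text \<open>The cyclic order of the pieces around the vertex is read off from the angles \<open>t\<^sub>0 < t\<^sub>1 < t\<^sub>2 < t\<^sub>3\<close> of
  one point in each piece.\<close>

definition cuts_saddle :: "(complex \<Rightarrow> real) \<Rightarrow> complex \<Rightarrow> complex \<Rightarrow> bool" where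
  "cuts_saddle h x q \<longleftrightarrow>
     (\<forall>\<^sub>F r in at_right 0. \<exists>C\<^sub>0 C\<^sub>1 C\<^sub>2 C\<^sub>3.
        distinct [C\<^sub>0, C\<^sub>1, C\<^sub>2, C\<^sub>3] \<and>
        pieces h x (q, -1) r = {C\<^sub>0, C\<^sub>1, C\<^sub>2, C\<^sub>3} \<and>
        C\<^sub>0 \<subseteq> above_plane q (x, h x) \<and> C\<^sub>1 \<subseteq> below_plane q (x, h x) \<and>
        C\<^sub>2 \<subseteq> above_plane q (x, h x) \<and> C\<^sub>3 \<subseteq> below_plane q (x, h x) \<and>
        (\<exists>s t\<^sub>0 t\<^sub>1 t\<^sub>2 t\<^sub>3.
           s > 0 \<and> t\<^sub>0 < t\<^sub>1 \<and> t\<^sub>1 < t\<^sub>2 \<and> t\<^sub>2 < t\<^sub>3 \<and> t\<^sub>3 < t\<^sub>0 + 2 * pi \<and>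
           (x + s *\<^sub>R cis t\<^sub>0, h (x + s *\<^sub>R cis t\<^sub>0)) \<in> C\<^sub>0 \<and>
           (x + s *\<^sub>R cis t\<^sub>1, h (x + s *\<^sub>R cis t\<^sub>1)) \<in> C\<^sub>1 \<and>
           (x + s *\<^sub>R cis t\<^sub>2, h (x + s *\<^sub>R cis t\<^sub>2)) \<in> C\<^sub>2 \<and>
           (x + s *\<^sub>R cis t\<^sub>3, h (x + s *\<^sub>R cis t\<^sub>3)) \<in> C\<^sub>3))"

definition lies_below :: "(complex \<Rightarrow> real) \<Rightarrow> complex \<Rightarrow> complex \<Rightarrow> bool" where
  "lies_below h x q \<longleftrightarrow>
     (\<forall>\<^sub>F r in at_right 0. surface h \<inter> ball (x, h x) r - {(x, h x)} \<subseteq> below_plane q (x, h x))"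

end

theory Submission
  imports Defs
begin

text \<open>
Fix a gradient \<open>q\<close> off the drawing of the Maxwell reciprocal. Near a vertex \<open>v\<close> the lifted surface
is a cone; let \<open>f \<theta>\<close> be its height in the direction \<open>\<theta>\<close>, measured from the plane of gradient \<open>q\<close> through
the apex. On the sector of a face with gradient \<open>g\<close> one has \<open>f \<theta> = \<bar>g - q\<bar> cos (\<theta> - arg (g - q))\<close>. While \<open>\<theta>\<close>
makes one turn, \<open>g\<close> runs through the corners of the reciprocal polygon of \<open>v\<close>, and following
\<open>arg (g - q)\<close> along the sides of the polygon shows that \<open>f\<close> has exactly \<open>2 - 2 w\<close> zeros, all of them sign
changes, where \<open>w\<close> is the winding number of the polygon about \<open>q\<close> (\<open>polygon_index_zeros\<close>, \<open>vertex_cone\<close>).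
This number is called the index of \<open>v\<close>. Index \<open>1\<close> means that the plane touches the surface at \<open>v\<close>
from one side only, index \<open>0\<close> that it cuts the neighborhood of \<open>v\<close> into two pieces, and index \<open>-1\<close> that
it cuts like a saddle into four.

The indices are determined by looking at how they change, without the Jordan curve theorem. Crossing
the reciprocal edge dual to \<open>vw\<close> changes the index of \<open>v\<close> by one, that of \<open>w\<close> by one in the opposite
direction, and no other index (\<open>index_jump\<close>). Because the two embeddings are dual, all sides of the
reciprocal polygon of \<open>v\<close> have one and the same face of the reciprocal drawing on one fixed side; it
is called the dual face of \<open>v\<close>. Since \<open>G - v\<close> is connected, the index of \<open>v\<close> takes one value on
the dual faces of all other vertices, and it differs from it by the orientation \<open>\<plusminus>1\<close> of the duality on the dual
face of \<open>v\<close> itself (\<open>index_off_own_face\<close>). So different vertices have different dual faces, and every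
face is a dual face because every face lies beside some edge. All indices vanish on the unbounded
face; if \<open>v0\<close> is its vertex, then on the dual face of any other vertex \<open>v1\<close> the index of \<open>v1\<close> is the
orientation, that of \<open>v0\<close> is its negative, and all other indices are \<open>0\<close> (\<open>index_distribution\<close>).

The orientation is \<open>-1\<close>: otherwise every vertex other than \<open>v0\<close> would have index \<open>1\<close> for some \<open>q\<close>. This
fails for a vertex that is extreme in some direction, since the surface contains a horizontal
half-plane ending there, and a plane cannot touch it from one side
(\<open>extreme_vertex_index\<close>). Hence saddles occur exactly at \<open>v1\<close>, and only \<open>v0\<close> can have index \<open>1\<close>. The peak
is \<open>v0\<close>: for small \<open>q\<close> the maximum of \<open>h x - q \<bullet> x\<close> is attained at a vertex, which has index \<open>1\<close>, and \<open>q\<close>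
can be tilted in favour of the peak (\<open>peak_unique\<close>).

For planes of special gradient, five or more pieces around a vertex would give, after a small
general perturbation of the gradient in one of two opposite directions, at least five sign changes of
\<open>f\<close>, more than the four that the index permits (\<open>at_most_four_pieces\<close>).
\<close>

section \<open>Straight-line plane drawings: edges, vertices and faces\<close>

locale plane_framework =
  fixes V :: "'v set" and E :: "'v set set" and p :: "'v \<Rightarrow> complex"
  assumes noncrossing: "noncrossing_framework V E p"
begin

abbreviation D :: "complex set" where "D \<equiv> drawing V E p"

lemma finite_V: "finite V"
  using noncrossing by (simp add: noncrossing_framework_def simple_graph_def)

lemma inj_p: "\<lbrakk>u \<in> V; v \<in> V; p u = p v\<rbrakk> \<Longrightarrow> u = v"
  using noncrossing by (simp add: noncrossing_framework_def inj_on_def)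

lemma vertex_off_edge: "\<lbrakk>e \<in> E; v \<in> V; v \<notin> e\<rbrakk> \<Longrightarrow> p v \<notin> edge_segment p e"
  using noncrossing by (simp add: noncrossing_framework_def)

lemma edges_share_ends:
  "\<lbrakk>e \<in> E; f \<in> E; e \<noteq> f; x \<in> edge_segment p e; x \<in> edge_segment p f\<rbrakk> \<Longrightarrow> x \<in> p ` (e \<inter> f)"
  using noncrossing unfolding noncrossing_framework_def by blast

lemma edge_ends: assumes "{i, j} \<in> E" shows "i \<in> V" "j \<in> V" "i \<noteq> j" "p i \<noteq> p j"
proof -
  have *: "{i, j} \<subseteq> V" "card {i, j} = 2"
    using assms noncrossing by (auto simp: noncrossing_framework_def simple_graph_def)
  then show "i \<in> V" "j \<in> V" by auto
  show "i \<noteq> j" using * by auto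
  then show "p i \<noteq> p j"
    using * noncrossing by (auto simp: noncrossing_framework_def inj_on_def)
qed

lemma edge_obtain: assumes "e \<in> E" obtains i j where "e = {i, j}"
proof -
  have "card e = 2" using assms noncrossing by (simp add: noncrossing_framework_def simple_graph_def)
  then show ?thesis using that by (auto simp: card_2_iff)
qed

lemma finite_E: "finite E"
proof (rule finite_subset)
  show "E \<subseteq> Pow V" using noncrossing by (auto simp: noncrossing_framework_def simple_graph_def)
qed (simp add: finite_V)

lemma finite_neighbours: "finite {j. {i, j} \<in> E}"
  by (rule finite_subset[OF _ finite_V]) (use edge_ends in auto)

lemma edge_segment_eq: "edge_segment p {i, j} = closed_segment (p i) (p j)"
  by (simp add: segment_convex_hull)

lemma compact_edge: "e \<in> E \<Longrightarrow> compact (edge_segment p e)"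
  using edge_obtain[of e] edge_segment_eq by (metis compact_segment)

lemma compact_D: "compact D"
  unfolding drawing_def using finite_V finite_E compact_edge
  by (intro compact_Un compact_UN finite_imp_compact[OF finite_imageI]) auto

text \<open>Used to choose points and gradients in general position: a nonempty open set is not negligible,
  so it contains a point off the drawing.\<close>

lemma negligible_D: "negligible D"
proof -
  have "negligible (edge_segment p e)" if eE: "e \<in> E" for e
  proof -
    obtain i j where e: "e = {i, j}" using edge_obtain[OF eE] .
    have ne: "p j - p i \<noteq> 0" using edge_ends[of i j] eE e by auto
    have "closed_segment (p i) (p j) \<subseteq> {x. (\<i> * (p j - p i)) \<bullet> x = (\<i> * (p j - p i)) \<bullet> p i}"
      proof
      fix x assume "x \<in> closed_segment (p i) (p j)"
      then obtain u where "x = (1 - u) *\<^sub>R p i + u *\<^sub>R p j" unfolding in_segment by auto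
      then show "x \<in> {x. (\<i> * (p j - p i)) \<bullet> x = (\<i> * (p j - p i)) \<bullet> p i}"
        by (simp add: inner_complex_def) (simp add: algebra_simps)
    qed
    then show ?thesis unfolding e edge_segment_eq
      using ne by (intro negligible_subset[OF negligible_hyperplane]) auto
  qed
  then have "negligible (\<Union>e\<in>E. edge_segment p e)"
    using finite_E by (intro negligible_Union) auto
  then show ?thesis unfolding drawing_def using finite_V by (simp add: negligible_finite)
qed

lemma closed_D: "closed D" by (rule compact_imp_closed[OF compact_D])

lemma open_face: "F \<in> faces V E p \<Longrightarrow> open F"
  unfolding faces_def using closed_D by (metis open_Compl open_components)

lemma face_disjoint: "F \<in> faces V E p \<Longrightarrow> F \<inter> D = {}"
  unfolding faces_def using in_components_subset by fastforce

lemma face_nonempty: "F \<in> faces V E p \<Longrightarrow> F \<noteq> {}"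
  unfolding faces_def by (rule in_components_nonempty)

lemma face_eq: "\<lbrakk>F \<in> faces V E p; F' \<in> faces V E p; x \<in> F; x \<in> F'\<rbrakk> \<Longrightarrow> F = F'"
  unfolding faces_def by (metis components_eq disjoint_iff)

lemma point_in_face: assumes "x \<notin> D" obtains F where "F \<in> faces V E p" "x \<in> F"
  using assms Union_components[of "- D"] unfolding faces_def by blast

lemma connected_in_face:
  assumes "connected T" "T \<inter> D = {}" "F \<in> faces V E p" "x \<in> T" "x \<in> F" shows "T \<subseteq> F"
  using assms components_maximal[of F "- D" T] unfolding faces_def by blast

text \<open>If two edges at \<open>i\<close> pointed in the same direction, the end of the shorter one would lie on the
  longer one.\<close>

lemma edges_meet: 
  assumes "{i, j} \<in> E" "{i, k} \<in> E" "j \<noteq> k" "0 < t" 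
  shows "p k - p i \<noteq> of_real t * (p j - p i)"
proof
  assume eq: "p k - p i = of_real t * (p j - p i)"
  have jk: "j \<in> V" "k \<in> V" "j \<noteq> i" "k \<noteq> i" using edge_ends[OF assms(1)] edge_ends[OF assms(2)] by auto
  show False
  proof (cases "t \<le> 1")
    case True
    have "p k \<in> closed_segment (p i) (p j)"
      unfolding in_segment using True assms(4) eq 
      by (intro exI[of _ t]) (auto simp: algebra_simps scaleR_conv_of_real)
    moreover have "k \<notin> {i, j}" using jk assms by auto
    ultimately show False using assms jk vertex_off_edge unfolding edge_segment_eq[symmetric] by blast
  next
    case False
    have "p j - p i = of_real (1/t) * (p k - p i)" using eq False by auto
    then have "p j \<in> closed_segment (p i) (p k)"
      unfolding in_segment using False assms(4) 
      by (intro exI[of _ "1/t"]) (auto simp: algebra_simps scaleR_conv_of_real)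
    moreover have "j \<notin> {i, k}" using jk assms by auto
    ultimately show False using assms jk vertex_off_edge unfolding edge_segment_eq[symmetric] by blast
  qed
qed

text \<open>The part of the drawing that stays away from the vertex \<open>i\<close>: it is compact, so it has a positive
  distance from \<open>p i\<close> and from initial segments of the edges at \<open>i\<close>.\<close>

definition away_from :: "'v \<Rightarrow> complex set" where
  "away_from i = p ` (V - {i}) \<union> (\<Union>e\<in>{e \<in> E. i \<notin> e}. edge_segment p e)"

lemma compact_away_from: "compact (away_from i)"
  unfolding away_from_def using finite_V finite_E compact_edge
  by (intro compact_Un compact_UN finite_imp_compact[OF finite_imageI]) auto

lemma drawing_cases:
  assumes "x \<in> D" "i \<in> V"
  obtains "x = p i" | "x \<in> away_from i" | j t where "{i, j} \<in> E" "0 < t" "t \<le> 1" "x = p i + of_real t * (p j - p i)"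
proof -
  consider "x \<in> p ` V" | e where "e \<in> E" "x \<in> edge_segment p e" "i \<notin> e" 
    | e where "e \<in> E" "x \<in> edge_segment p e" "i \<in> e"
    using assms unfolding drawing_def by blast
  then show ?thesis
  proof cases
    case 1 then show ?thesis using that unfolding away_from_def by blast
  next
    case 2 then show ?thesis using that unfolding away_from_def by blast
  next
    case 3
    obtain a b where "e = {a, b}" using edge_obtain[OF 3(1)] .
    then obtain j where j: "e = {i, j}" using 3(3) by auto
    then obtain t where t: "0 \<le> t" "t \<le> 1" "x = (1 - t) *\<^sub>R p i + t *\<^sub>R p j"
      using 3(2) unfolding j edge_segment_eq in_segment by auto
    have x: "x = p i + of_real t * (p j - p i)" using t by (simp add: algebra_simps scaleR_conv_of_real)
    show ?thesis 
    proof (cases "t = 0")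
      case True then show ?thesis using that x by auto
    next
      case False then show ?thesis using that(3)[of j t] x t j 3 by auto
    qed
  qed
qed

text \<open>Close to a vertex the drawing consists of the rays along the edges at that vertex.\<close>

lemma star_neighbourhood:
  assumes "i \<in> V"
  obtains \<rho> where "\<rho> > 0" "\<And>z. \<lbrakk>norm z < \<rho>; z \<noteq> 0; p i + z \<in> D\<rbrakk> \<Longrightarrow> \<exists>j t. {i, j} \<in> E \<and> 0 < t \<and> z = of_real t * (p j - p i)"
proof -
  have "p i \<notin> away_from i"
    using assms vertex_off_edge by (auto simp: away_from_def dest: inj_p)
  then obtain \<rho> where \<rho>: "\<rho> > 0" "\<And>y. y \<in> away_from i \<Longrightarrow> \<rho> \<le> dist (p i) y"
    using separate_point_closed[of "away_from i" "p i"] compact_away_from compact_imp_closed by blast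
  show ?thesis
  proof (rule that[OF \<rho>(1)])
    fix z assume z: "norm z < \<rho>" "z \<noteq> 0" "p i + z \<in> D"
    have "p i + z \<notin> away_from i" using \<rho>(2)[of "p i + z"] z by (auto simp: dist_norm)
    show "\<exists>j t. {i, j} \<in> E \<and> 0 < t \<and> z = of_real t * (p j - p i)"
    proof (cases rule: drawing_cases[OF z(3) assms])
      case 1 then show ?thesis using z by simp
    next
      case 2 then show ?thesis using \<open>p i + z \<notin> away_from i\<close> by simp
    next
      case (3 j t) then show ?thesis by auto
    qed
  qed
qed

text \<open>A thin wedge on either side of an edge, with apex at one end and reaching past the midpoint,
  misses the drawing. The part of the drawing away from the apex has positive distance from the initial
  \<open>3/5\<close> of the edge, and the other edges at the apex leave at a positive angle. As the wedge
  contains points next to the midpoint and points next to the apex, it links the face beside the edge to the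
  sectors around the vertex.\<close>

lemma wedge_avoids:
  assumes "{i, j} \<in> E"
  obtains \<kappa> where "\<kappa> > 0" "\<And>z. \<lbrakk>0 < Re z; Re z < 3/5; Im z \<noteq> 0; \<bar>Im z\<bar> < \<kappa> * Re z\<rbrakk> \<Longrightarrow> p i + z * (p j - p i) \<notin> D"
proof -
  define d where "d = p j - p i"
  have d0: "d \<noteq> 0" and iV: "i \<in> V" using edge_ends[OF assms] by (auto simp: d_def)
  define T where "T = closed_segment (p i) (p i + of_real (3/5) * d)"
  have T_sub: "T \<subseteq> closed_segment (p i) (p j)" "p j \<notin> T"
  proof -
    have Tin: "\<exists>s. 0 \<le> s \<and> s \<le> 3/5 \<and> x = p i + of_real s * d" if "x \<in> T" for x
    proof -
      obtain u where u: "0 \<le> u" "u \<le> 1" "x = (1 - u) *\<^sub>R p i + u *\<^sub>R (p i + of_real (3/5) * d)" using \<open>x \<in> T\<close> unfolding T_def in_segment by blast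
      then have "x = p i + of_real (3/5*u) * d" by (simp add: algebra_simps scaleR_conv_of_real)
      then show ?thesis using u by (intro exI[of _ "3/5*u"]) auto
    qed
    show "T \<subseteq> closed_segment (p i) (p j)"
    proof
      fix x assume "x \<in> T"
      then obtain s where "0 \<le> s" "s \<le> 3/5" "x = p i + of_real s * d" using Tin by blast
      then show "x \<in> closed_segment (p i) (p j)" unfolding in_segment d_def
        by (intro exI[of _ s]) (auto simp: algebra_simps scaleR_conv_of_real)
    qed
    show "p j \<notin> T" 
    proof
      assume "p j \<in> T"
      then obtain s where s: "s \<le> 3/5" "p j = p i + of_real s * d" using Tin by blast
      then have "d = of_real s * d" unfolding d_def by (metis add_diff_cancel_left')
      then have "(1 - of_real s) * d = 0" by (simp add: algebra_simps)
      then have "s = 1" using d0 by simp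
      then show False using s by simp
    qed
  qed
  have "T \<inter> away_from i = {}"
  proof -
    have "x \<notin> p ` (V - {i})" if "x \<in> T" for x
    proof
      assume "x \<in> p ` (V - {i})"
      then obtain v where v: "v \<in> V" "v \<noteq> i" "x = p v" by auto
      then have "v \<noteq> j" using that T_sub by auto
      then show False using v that T_sub vertex_off_edge[OF assms v(1)] unfolding edge_segment_eq by blast
    qed
    moreover have "x \<notin> edge_segment p e" if "x \<in> T" "e \<in> E" "i \<notin> e" for x e
    proof
      assume "x \<in> edge_segment p e"
      moreover have "x \<in> edge_segment p {i, j}" using that T_sub edge_segment_eq by auto
      moreover have "e \<noteq> {i, j}" using that by auto
      ultimately have "x \<in> p ` (e \<inter> {i, j})" using edges_share_ends that assms by blast
      then show False using that T_sub by auto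
    qed
    ultimately show ?thesis unfolding away_from_def by blast
  qed
  then obtain \<delta> where \<delta>: "\<delta> > 0" "\<And>x y. \<lbrakk>x \<in> T; y \<in> away_from i\<rbrakk> \<Longrightarrow> \<delta> \<le> dist x y"
    using separate_compact_closed[of T "away_from i"] compact_away_from compact_imp_closed T_def by (metis compact_segment)
  define \<zeta> where "\<zeta> k = (p k - p i) / d" for k
  have ev: "\<forall>\<^sub>F \<kappa> in at_right 0. \<forall>k\<in>{k. {i, k} \<in> E} - {j}. Re (\<zeta> k) > 0 \<longrightarrow> \<kappa> * Re (\<zeta> k) < \<bar>Im (\<zeta> k)\<bar>"
  proof (intro eventually_ball_finite ballI)
    show "finite ({k. {i, k} \<in> E} - {j})" using finite_neighbours by simp
    fix k assume k: "k \<in> {k. {i, k} \<in> E} - {j}"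
    show "\<forall>\<^sub>F \<kappa> in at_right 0. Re (\<zeta> k) > 0 \<longrightarrow> \<kappa> * Re (\<zeta> k) < \<bar>Im (\<zeta> k)\<bar>"
    proof (cases "Re (\<zeta> k) > 0")
      case True
      have "Im (\<zeta> k) \<noteq> 0"
      proof
        assume "Im (\<zeta> k) = 0"
        define t where "t = Re (\<zeta> k)"
        have t: "\<zeta> k = of_real t" by (simp add: complex_eq_iff t_def \<open>Im (\<zeta> k) = 0\<close>)
        have "p k - p i = \<zeta> k * d" using d0 by (simp add: \<zeta>_def)
        then have "p k - p i = of_real t * d" by (simp only: t)
        then show False using edges_meet[of i j k t] k assms True unfolding d_def t_def by blast
      qed
      then have "\<bar>Im (\<zeta> k)\<bar> / Re (\<zeta> k) > 0" using True by simp
      then have "\<forall>\<^sub>F \<kappa> in at_right 0. \<kappa> < \<bar>Im (\<zeta> k)\<bar> / Re (\<zeta> k)" by (rule eventually_at_rightI[rotated]) auto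
      then show ?thesis by eventually_elim (use True in \<open>simp add: field_simps\<close>)
    qed auto
  qed
  have "\<forall>\<^sub>F \<kappa> in at_right 0. \<kappa> < \<delta> / norm d" using \<delta>(1) d0 by (intro eventually_at_rightI[of 0 "\<delta> / norm d"]) auto
  with ev have "\<forall>\<^sub>F \<kappa> in at_right 0. 0 < \<kappa> \<and> \<kappa> < \<delta> / norm d \<and> (\<forall>k\<in>{k. {i, k} \<in> E} - {j}. Re (\<zeta> k) > 0 \<longrightarrow> \<kappa> * Re (\<zeta> k) < \<bar>Im (\<zeta> k)\<bar>)"
    using eventually_at_right_less[of "0::real"] by eventually_elim auto
  then obtain \<kappa> where \<kappa>: "0 < \<kappa>" "\<kappa> < \<delta> / norm d" "\<And>k. \<lbrakk>{i, k} \<in> E; k \<noteq> j; Re (\<zeta> k) > 0\<rbrakk> \<Longrightarrow> \<kappa> * Re (\<zeta> k) < \<bar>Im (\<zeta> k)\<bar>"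
    using eventually_happens'[of "at_right (0::real)"] by (force simp: trivial_limit_at_right_real)
  show ?thesis
  proof (rule that[OF \<kappa>(1)])
    fix z assume z: "0 < Re z" "Re z < 3/5" "Im z \<noteq> 0" "\<bar>Im z\<bar> < \<kappa> * Re z"
    show "p i + z * (p j - p i) \<notin> D"
    proof
      assume "p i + z * (p j - p i) \<in> D"
      then have "p i + z * d \<in> D" by (simp add: d_def)
      then consider "p i + z * d = p i" | "p i + z * d \<in> away_from i" 
         | k t where "{i, k} \<in> E" "0 < t" "t \<le> 1" "p i + z * d = p i + of_real t * (p k - p i)"
        using drawing_cases[of "p i + z * d" i] iV by metis
      then show False
      proof cases
        case 1 then show False using z d0 by auto
      next
        case 2
        have "p i + of_real (Re z) * d \<in> T" unfolding T_def in_segment using z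
          by (intro exI[of _ "Re z * 5/3"]) (auto simp: algebra_simps scaleR_conv_of_real)
        from \<delta>(2)[OF this 2] have "\<delta> \<le> norm (of_real (Re z) * d - z * d)" by (simp add: dist_norm)
        also have "of_real (Re z) * d - z * d = - (of_real (Im z) * \<i> * d)" by (simp add: complex_eq_iff algebra_simps)
        also have "norm \<dots> = \<bar>Im z\<bar> * norm d" by (simp add: norm_mult)
        also have "\<dots> \<le> \<kappa> * norm d"
        proof -
          have "\<kappa> * Re z \<le> \<kappa> * 1" using z \<kappa>(1) by (intro mult_left_mono) auto
          then show ?thesis using z by (intro mult_right_mono) auto
        qed
        also have "\<dots> < \<delta>" using \<kappa>(2) d0 by (simp add: field_simps)
        finally show False by simp
      next
        case 3
        have zk: "z = of_real t * \<zeta> k" using 3 d0 by (simp add: \<zeta>_def field_simps)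
        show False
        proof (cases "k = j")
          case True
          then have "\<zeta> k = 1" using d0 by (simp add: \<zeta>_def d_def)
          then show False using zk z by simp
        next
          case False
          have "Re (\<zeta> k) > 0" using zk z 3 by (simp add: zero_less_mult_iff)
          with \<kappa>(3)[OF 3(1) False] have "t * (\<kappa> * Re (\<zeta> k)) < t * \<bar>Im (\<zeta> k)\<bar>" using 3 by simp
          then show False using z zk 3 by (simp add: abs_mult algebra_simps)
        qed
      qed
    qed
  qed
qed

end

section \<open>Faces beside an edge and around a vertex\<close>

lemma Arg2pi_cis: assumes "0 < r" "0 \<le> x" "x < 2*pi" shows "Arg2pi (of_real r * cis x) = x"
  by (rule Arg2pi_unique[of r]) (use assms in \<open>auto simp: cis_conv_exp\<close>)

text \<open>The convention that parallel vectors are a full turn apart makes the angle \<open>2 * pi\<close> the one that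
  corresponds to a positive real quotient.\<close>

lemma ccw_angle_eqI:
  assumes "0 < r" "0 < x" "x \<le> 2 * pi" "b / a = of_real r * cis x"
  shows "ccw_angle a b = x"
proof (cases "x = 2 * pi")
  case True
  then show ?thesis using Arg2pi_cis[of r 0] assms by (simp add: ccw_angle_def)
next
  case False
  then show ?thesis using Arg2pi_cis[of r x] assms by (simp add: ccw_angle_def)
qed

lemma ccw_angle_polar:
  assumes "a \<noteq> 0" "b \<noteq> 0"
  shows "0 < ccw_angle a b" "ccw_angle a b \<le> 2 * pi" "b = of_real (norm b / norm a) * cis (ccw_angle a b) * a"
proof -
  show "0 < ccw_angle a b" "ccw_angle a b \<le> 2 * pi"
    using Arg2pi_ge_0[of "b/a"] Arg2pi_lt_2pi[of "b/a"] by (auto simp: ccw_angle_def)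
  have "b / a = of_real (norm (b / a)) * cis (Arg2pi (b / a))"
    using Arg2pi_eq[of "b/a"] by (simp add: cis_conv_exp mult.commute)
  also have "cis (Arg2pi (b / a)) = cis (ccw_angle a b)"
    by (simp add: ccw_angle_def)
  finally show "b = of_real (norm b / norm a) * cis (ccw_angle a b) * a"
    using assms by (simp add: norm_divide field_simps)
qed

context plane_framework begin

text \<open>The face beside an edge, as a function; well-defined on edges by \<open>ex1_left_face\<close>.\<close>

definition left :: "'v \<Rightarrow> 'v \<Rightarrow> complex set" where
  "left i j = (THE F. left_face V E p i j F)"

text \<open>In coordinates in which the edge runs from \<open>0\<close> to \<open>1\<close>, the points beside the midpoint are
  \<open>1/2 + \<epsilon> \<i>\<close>.\<close>

lemma left_face_iff:
  "left_face V E p i j F \<longleftrightarrow> {i, j} \<in> E \<and> F \<in> faces V E p \<and>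
     (\<forall>\<^sub>F \<epsilon> in at_right 0. p i + Complex (1/2) \<epsilon> * (p j - p i) \<in> F)"
proof -
  have "midpoint (p i) (p j) + \<epsilon> *\<^sub>R (\<i> * (p j - p i)) = p i + Complex (1/2) \<epsilon> * (p j - p i)" for \<epsilon>
    by (simp add: midpoint_def complex_eq_iff field_simps)
  then show ?thesis by (simp add: left_face_def)
qed

lemma right_face_iff:
  "left_face V E p j i F \<longleftrightarrow> {i, j} \<in> E \<and> F \<in> faces V E p \<and>
     (\<forall>\<^sub>F \<epsilon> in at_right 0. p i + Complex (1/2) (- \<epsilon>) * (p j - p i) \<in> F)"
proof -
  have "p j + Complex (1/2) \<epsilon> * (p i - p j) = p i + Complex (1/2) (- \<epsilon>) * (p j - p i)" for \<epsilon>
    by (simp add: complex_eq_iff field_simps)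
  then show ?thesis by (simp add: left_face_iff insert_commute)
qed

text \<open>Each of the two wedges beside an edge is convex and misses the drawing, so it lies in one face; the
  sign \<open>s\<close> selects the side.\<close>

lemma side_wedge:
  assumes "{i, j} \<in> E" "s = 1 \<or> s = -1"
  obtains \<kappa> F where "\<kappa> > 0" "F \<in> faces V E p"
    "\<And>z. \<lbrakk>0 < Re z; Re z < 3/5; 0 < s * Im z; s * Im z < \<kappa> * Re z\<rbrakk> \<Longrightarrow> p i + z * (p j - p i) \<in> F"
proof -
  obtain \<kappa> where \<kappa>: "\<kappa> > 0" "\<And>z. \<lbrakk>0 < Re z; Re z < 3/5; Im z \<noteq> 0; \<bar>Im z\<bar> < \<kappa> * Re z\<rbrakk> \<Longrightarrow> p i + z * (p j - p i) \<notin> D"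
    using wedge_avoids[OF assms(1)] by blast
  define W where "W = {z. 0 < Re z} \<inter> {z. Re z < 3/5} \<inter> {z. 0 < s * Im z} \<inter> {z. s * Im z < \<kappa> * Re z}"
  define T where "T = (\<lambda>z. p i + z * (p j - p i)) ` W"
  have 4: "{z. s * Im z < \<kappa> * Re z} = {z. Complex (-\<kappa>) s \<bullet> z < 0}" by (auto simp: inner_complex_def)
  have 3: "{z. 0 < s * Im z} = {z. Complex 0 s \<bullet> z > 0}" by (auto simp: inner_complex_def)
  have 1: "{z. 0 < Re z} = {z. 1 \<bullet> z > 0}" "{z. Re z < 3/5} = {z. 1 \<bullet> z < 3/5}" by (auto simp: inner_complex_def)
  have "convex W" unfolding W_def 1 3 4
    by (intro convex_Int convex_halfspace_lt convex_halfspace_gt)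
  then have "connected T" unfolding T_def
    by (intro connected_continuous_image continuous_intros convex_connected)
  moreover have "T \<inter> D = {}" using \<kappa>(2) assms(2) unfolding T_def W_def by auto
  moreover have "Complex (1/2) (s * \<kappa> / 4) \<in> W" using \<kappa>(1) assms(2) by (auto simp: W_def)
  then have x: "p i + Complex (1/2) (s * \<kappa> / 4) * (p j - p i) \<in> T" unfolding T_def by blast
  ultimately obtain F where F: "F \<in> faces V E p" "p i + Complex (1/2) (s * \<kappa> / 4) * (p j - p i) \<in> F" 
    using point_in_face by blast
  have "T \<subseteq> F" by (rule connected_in_face[OF \<open>connected T\<close> \<open>T \<inter> D = {}\<close> F(1) x F(2)])
  then show ?thesis using that[OF \<kappa>(1) F(1)] unfolding T_def W_def by blast
qed

lemma ex1_left_face: assumes "{i, j} \<in> E" shows "\<exists>!F. left_face V E p i j F"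
proof -
  obtain \<kappa> F where F: "\<kappa> > 0" "F \<in> faces V E p"
    "\<And>z. \<lbrakk>0 < Re z; Re z < 3/5; 0 < 1 * Im z; 1 * Im z < \<kappa> * Re z\<rbrakk> \<Longrightarrow> p i + z * (p j - p i) \<in> F"
    using side_wedge[OF assms, of 1] by blast
  have "\<forall>\<^sub>F \<epsilon> in at_right 0. p i + Complex (1/2) \<epsilon> * (p j - p i) \<in> F"
    by (rule eventually_at_rightI[of 0 "\<kappa>/2"]) (use F in auto)
  then have "left_face V E p i j F" using F assms by (simp add: left_face_iff)
  moreover have "F' = F" if F': "left_face V E p i j F'" for F'
  proof -
    have "\<forall>\<^sub>F \<epsilon> in at_right (0::real). p i + Complex (1/2) \<epsilon> * (p j - p i) \<in> F \<and> p i + Complex (1/2) \<epsilon> * (p j - p i) \<in> F'"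
      using calculation F' by (auto simp: left_face_iff intro: eventually_conj)
    then obtain \<epsilon> where "p i + Complex (1/2) \<epsilon> * (p j - p i) \<in> F" "p i + Complex (1/2) \<epsilon> * (p j - p i) \<in> F'"
      using eventually_happens'[of "at_right (0::real)"] by (force simp: trivial_limit_at_right_real)
    then show ?thesis using face_eq F(2) F' by (auto simp: left_face_iff)
  qed
  ultimately show ?thesis by blast
qed

lemma left_face_left: "{i, j} \<in> E \<Longrightarrow> left_face V E p i j (left i j)"
  unfolding left_def by (rule theI'[OF ex1_left_face])

lemma left_face_left': "{i, j} \<in> E \<Longrightarrow> left_face V E p j i (left j i)"
  using left_face_left[of j i] by (simp add: insert_commute)

lemma left_eq: "left_face V E p i j F \<Longrightarrow> left i j = F"
  using ex1_left_face left_face_left by (metis left_face_def)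

lemma left_in_faces: "{i, j} \<in> E \<Longrightarrow> left i j \<in> faces V E p"
  using left_face_left by (simp add: left_face_def)

lemma wedge_left:
  assumes "{i, j} \<in> E"
  obtains \<kappa> where "\<kappa> > 0" "\<And>z. \<lbrakk>0 < Re z; Re z < 3/5; 0 < Im z; Im z < \<kappa> * Re z\<rbrakk> \<Longrightarrow> p i + z * (p j - p i) \<in> left i j"
proof -
  obtain \<kappa> F where F: "\<kappa> > 0" "F \<in> faces V E p"
    "\<And>z. \<lbrakk>0 < Re z; Re z < 3/5; 0 < 1 * Im z; 1 * Im z < \<kappa> * Re z\<rbrakk> \<Longrightarrow> p i + z * (p j - p i) \<in> F"
    using side_wedge[OF assms, of 1] by blast
  have "\<forall>\<^sub>F \<epsilon> in at_right 0. p i + Complex (1/2) \<epsilon> * (p j - p i) \<in> F"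
    by (rule eventually_at_rightI[of 0 "\<kappa>/2"]) (use F in auto)
  then have "left i j = F" using F assms by (intro left_eq) (simp add: left_face_iff)
  then show ?thesis using that F by simp
qed

lemma wedge_right:
  assumes "{i, j} \<in> E"
  obtains \<kappa> where "\<kappa> > 0" "\<And>z. \<lbrakk>0 < Re z; Re z < 3/5; Im z < 0; - Im z < \<kappa> * Re z\<rbrakk> \<Longrightarrow> p i + z * (p j - p i) \<in> left j i"
proof -
  obtain \<kappa> F where F: "\<kappa> > 0" "F \<in> faces V E p"
    "\<And>z. \<lbrakk>0 < Re z; Re z < 3/5; 0 < -1 * Im z; -1 * Im z < \<kappa> * Re z\<rbrakk> \<Longrightarrow> p i + z * (p j - p i) \<in> F"
    using side_wedge[OF assms, of "-1"] by blast
  have "\<forall>\<^sub>F \<epsilon> in at_right 0. p i + Complex (1/2) (-\<epsilon>) * (p j - p i) \<in> F"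
    by (rule eventually_at_rightI[of 0 "\<kappa>/2"]) (use F in auto)
  then have "left j i = F" using F assms by (intro left_eq) (simp add: right_face_iff)
  then show ?thesis using that F by simp
qed

text \<open>Any interior point of an edge has the same two faces beside it as the midpoint. The wedge from \<open>i\<close>
  covers the first \<open>3/5\<close> of the edge and the wedge from \<open>j\<close> the remaining part.\<close>

lemma edge_point_sides:
  assumes "{i, j} \<in> E" "0 < s" "s < 1"
  obtains \<delta> where "\<delta> > 0"
    "\<And>w. \<lbrakk>norm w < \<delta>; 0 < Im w\<rbrakk> \<Longrightarrow> p i + (of_real s + w) * (p j - p i) \<in> left i j"
    "\<And>w. \<lbrakk>norm w < \<delta>; Im w < 0\<rbrakk> \<Longrightarrow> p i + (of_real s + w) * (p j - p i) \<in> left j i"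
proof -
  have *: "\<exists>\<delta>>0. \<forall>w. norm w < \<delta> \<longrightarrow> (0 < Im w \<longrightarrow> p i + (of_real s + w) * (p j - p i) \<in> left i j)
     \<and> (Im w < 0 \<longrightarrow> p i + (of_real s + w) * (p j - p i) \<in> left j i)"
    if e: "{i, j} \<in> E" and s: "0 < s" "s < 3/5" for i j s
  proof -
    obtain \<kappa> where \<kappa>: "\<kappa> > 0" "\<And>z. \<lbrakk>0 < Re z; Re z < 3/5; 0 < Im z; Im z < \<kappa> * Re z\<rbrakk> \<Longrightarrow> p i + z * (p j - p i) \<in> left i j"
      using wedge_left[OF e] by blast
    obtain \<kappa>' where \<kappa>': "\<kappa>' > 0" "\<And>z. \<lbrakk>0 < Re z; Re z < 3/5; Im z < 0; - Im z < \<kappa>' * Re z\<rbrakk> \<Longrightarrow> p i + z * (p j - p i) \<in> left j i"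
      using wedge_right[OF e] by blast
    define \<delta> where "\<delta> = Min {s/2, 3/5 - s, \<kappa> * (s/2), \<kappa>' * (s/2)}"
    have \<delta>: "\<delta> > 0" using s \<kappa>(1) \<kappa>'(1) unfolding \<delta>_def by simp
    have "\<forall>b\<in>{s/2, 3/5 - s, \<kappa> * (s/2), \<kappa>' * (s/2)}. \<delta> \<le> b" unfolding \<delta>_def by (intro ballI Min_le) auto
    then have \<delta>': "\<delta> \<le> s/2" "\<delta> \<le> 3/5 - s" "\<delta> \<le> \<kappa> * (s/2)" "\<delta> \<le> \<kappa>' * (s/2)" by blast+
    note \<delta> = \<delta> \<delta>'
    show ?thesis
    proof (intro exI conjI allI impI)
      fix w :: complex assume w: "norm w < \<delta>"
      have w2: "\<bar>Re w\<bar> < \<delta>" "\<bar>Im w\<bar> < \<delta>" using w abs_Re_le_cmod[of w] abs_Im_le_cmod[of w] by auto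
      have "s/2 < s + Re w" using w2 \<delta> by linarith
      then have "\<kappa> * (s/2) < \<kappa> * (s + Re w)" "\<kappa>' * (s/2) < \<kappa>' * (s + Re w)" using \<kappa>(1) \<kappa>'(1) by auto
      then have b: "\<bar>Im w\<bar> < \<kappa> * (s + Re w)" "\<bar>Im w\<bar> < \<kappa>' * (s + Re w)" using w2 \<delta> by auto
      show "p i + (of_real s + w) * (p j - p i) \<in> left i j" if "0 < Im w"
        by (rule \<kappa>(2)) (use w2 \<delta> b that s in auto)
      show "p i + (of_real s + w) * (p j - p i) \<in> left j i" if "Im w < 0"
        by (rule \<kappa>'(2)) (use w2 \<delta> b that s in auto)
    qed (rule \<delta>)
  qed
  show ?thesis
  proof (cases "s < 3/5")
    case True with * assms that show ?thesis by blast
  next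
    case False
    have "{j, i} \<in> E" using assms by (simp add: insert_commute)
    from *[OF this, of "1 - s"] False assms
    obtain \<delta> where \<delta>: "\<delta> > 0" "\<And>w. norm w < \<delta> \<Longrightarrow> 0 < Im w \<Longrightarrow> p j + (of_real (1-s) + w) * (p i - p j) \<in> left j i"
       "\<And>w. norm w < \<delta> \<Longrightarrow> Im w < 0 \<Longrightarrow> p j + (of_real (1-s) + w) * (p i - p j) \<in> left i j" by auto
    have eq: "p i + (of_real s + w) * (p j - p i) = p j + (of_real (1-s) + (- w)) * (p i - p j)" for w
      by (simp add: algebra_simps)
    show ?thesis by (rule that[OF \<delta>(1)]; subst eq; rule \<delta>) auto
  qed
qed

text \<open>Two faces are always joined by a chain of faces adjacent along edges: the complement of the finite
  vertex set is connected, and a path in it changes faces only by crossing edges at interior points. So a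
  set of faces that is closed under crossing edges contains every face as soon as it contains one.\<close>

lemma faces_crossing_induct:
  assumes "F0 \<in> faces V E p" "F0 \<in> S" "F \<in> faces V E p"
    and cross: "\<And>i j. {i, j} \<in> E \<Longrightarrow> left i j \<in> S \<Longrightarrow> left j i \<in> S"
  shows "F \<in> S"
proof -
  obtain a b where a: "a \<in> F0" and b: "b \<in> F" using face_nonempty[OF assms(1)] face_nonempty[OF assms(3)] by blast
  have V_D: "p ` V \<subseteq> D" by (auto simp: drawing_def)
  define Q where "Q x \<longleftrightarrow> (\<forall>G\<in>faces V E p. x \<in> G \<longrightarrow> G \<in> S)" for x
  have "Q b"
  proof (rule connected_induction[of "- p ` V" "\<lambda>x. x \<notin> D" Q a b])
    show "connected (- p ` V)"
      by (intro path_connected_imp_connected path_connected_complement_countable)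
        (auto simp: finite_V countable_finite)
    show "\<exists>z. z \<in> T \<and> z \<notin> D" if T: "openin (top_of_set (- p ` V)) T" "x \<in> T" for T x
    proof -
      have "open T" using T openin_open_trans[of "- p ` V" T] finite_V
        by (metis finite_imageI finite_imp_closed open_Compl openin_open_eq)
      then have "\<not> negligible T" using open_not_negligible T by blast
      then show ?thesis using negligible_D negligible_subset by blast
    qed
    show "\<exists>T. openin (top_of_set (- p ` V)) T \<and> x \<in> T \<and> (\<forall>y\<in>T. \<forall>z\<in>T. y \<notin> D \<and> z \<notin> D \<and> Q y \<longrightarrow> Q z)"
      if x: "x \<in> - p ` V" for x
    proof -
      have "\<exists>\<delta>>0. \<forall>y\<in>ball x \<delta>. \<forall>z\<in>ball x \<delta>. y \<notin> D \<and> z \<notin> D \<and> Q y \<longrightarrow> Q z"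
      proof (cases "x \<in> D")
        case False
        then obtain G where G: "G \<in> faces V E p" "x \<in> G" by (rule point_in_face)
        then obtain \<delta> where "\<delta> > 0" "ball x \<delta> \<subseteq> G" using open_face open_contains_ball by blast
        then show ?thesis using G face_eq unfolding Q_def by (metis subsetD)
      next
        case True
        then obtain e where e: "e \<in> E" "x \<in> edge_segment p e" using x unfolding drawing_def by blast
        obtain i j where ij: "e = {i, j}" by (rule edge_obtain[OF e(1)])
        then obtain s where s: "0 \<le> s" "s \<le> 1" "x = (1 - s) *\<^sub>R p i + s *\<^sub>R p j"
          using e unfolding ij edge_segment_eq in_segment by auto
        have ends: "i \<in> V" "j \<in> V" "p i \<noteq> p j" using edge_ends e ij by auto
        have "s \<noteq> 0" "s \<noteq> 1" using s x ends by auto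
        then have s01: "0 < s" "s < 1" using s by auto
        have xs: "x = p i + of_real s * (p j - p i)" using s by (simp add: algebra_simps scaleR_conv_of_real)
        have ijE: "{i, j} \<in> E" using e ij by simp
        obtain \<delta> where \<delta>: "\<delta> > 0"
          "\<And>w. \<lbrakk>norm w < \<delta>; 0 < Im w\<rbrakk> \<Longrightarrow> p i + (of_real s + w) * (p j - p i) \<in> left i j"
          "\<And>w. \<lbrakk>norm w < \<delta>; Im w < 0\<rbrakk> \<Longrightarrow> p i + (of_real s + w) * (p j - p i) \<in> left j i"
          using edge_point_sides[OF ijE s01] by blast
        define \<eta> where "\<eta> = min \<delta> (min s (1 - s)) * norm (p j - p i)"
        have \<eta>: "\<eta> > 0" using \<delta>(1) s01 ends by (simp add: \<eta>_def)
        have sides: "y \<in> left i j \<or> y \<in> left j i" if y: "y \<in> ball x \<eta>" "y \<notin> D" for y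
        proof -
          define w where "w = (y - x) / (p j - p i)"
          have yw: "y = p i + (of_real s + w) * (p j - p i)" using ends xs by (simp add: w_def field_simps)
          have "norm (y - x) < min \<delta> (min s (1 - s)) * norm (p j - p i)" using y unfolding \<eta>_def
            by (simp only: mem_ball dist_norm norm_minus_commute)
          then have "norm w < min \<delta> (min s (1 - s))" using ends unfolding w_def norm_divide
            by (subst pos_divide_less_eq) auto
          then have nw: "norm w < \<delta>" "norm w < s" "norm w < 1 - s" by auto
          have "Im w \<noteq> 0"
          proof
            assume "Im w = 0"
            then obtain t where t: "w = of_real t" by (metis complex_is_Real_iff Reals_cases)
            have "y \<in> closed_segment (p i) (p j)" unfolding in_segment
              by (rule exI[of _ "s + t"]) (use nw t yw in \<open>auto simp: algebra_simps scaleR_conv_of_real\<close>)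
            then show False using y(2) ijE edge_segment_eq unfolding drawing_def by blast
          qed
          then show ?thesis using \<delta>(2)[OF nw(1)] \<delta>(3)[OF nw(1)] unfolding yw by (cases "Im w > 0") auto
        qed
        have LR: "left i j \<in> faces V E p" "left j i \<in> faces V E p"
          using left_in_faces ijE by (auto simp: insert_commute)
        have "left i j \<in> S \<longleftrightarrow> left j i \<in> S" using cross[of i j] cross[of j i] ijE by (simp only: insert_commute) blast
        then have "Q y \<longrightarrow> Q z" if "y \<in> ball x \<eta>" "z \<in> ball x \<eta>" "y \<notin> D" "z \<notin> D" for y z
          using sides[OF that(1,3)] sides[OF that(2,4)] LR face_eq unfolding Q_def by metis
        then show ?thesis using \<eta> by blast
      qed
      then obtain \<delta> where "\<delta> > 0" "\<forall>y\<in>ball x \<delta>. \<forall>z\<in>ball x \<delta>. y \<notin> D \<and> z \<notin> D \<and> Q y \<longrightarrow> Q z" by blast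
      then show ?thesis using x by (intro exI[of _ "- p ` V \<inter> ball x \<delta>"]) (auto intro: openin_open_Int)
    qed
    show "a \<in> - p ` V" "b \<in> - p ` V" "a \<notin> D" "b \<notin> D"
      using a b face_disjoint[OF assms(1)] face_disjoint[OF assms(3)] V_D by blast+
    show "Q a" using a face_eq[OF assms(1)] assms(2) unfolding Q_def by metis
  qed
  then show ?thesis using b assms(3) unfolding Q_def by blast
qed

text \<open>The wedges beside an edge in polar coordinates, with \<open>\<kappa>\<close> as the tangent of the angle.\<close>

lemma polar_wedge:
  assumes "{i, j} \<in> E"
  obtains \<eta> where "\<eta> > 0"
    "\<And>s \<theta>. \<lbrakk>0 < s; s < 1/2; 0 < \<theta>; \<theta> < \<eta>\<rbrakk> \<Longrightarrow> p i + of_real s * cis \<theta> * (p j - p i) \<in> left i j"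
    "\<And>s \<theta>. \<lbrakk>0 < s; s < 1/2; 0 < \<theta>; \<theta> < \<eta>\<rbrakk> \<Longrightarrow> p i + of_real s * cis (- \<theta>) * (p j - p i) \<in> left j i"
proof -
  obtain \<kappa> where \<kappa>: "\<kappa> > 0" "\<And>z. \<lbrakk>0 < Re z; Re z < 3/5; 0 < Im z; Im z < \<kappa> * Re z\<rbrakk> \<Longrightarrow> p i + z * (p j - p i) \<in> left i j"
    using wedge_left[OF assms] by blast
  obtain \<kappa>' where \<kappa>': "\<kappa>' > 0" "\<And>z. \<lbrakk>0 < Re z; Re z < 3/5; Im z < 0; - Im z < \<kappa>' * Re z\<rbrakk> \<Longrightarrow> p i + z * (p j - p i) \<in> left j i"
    using wedge_right[OF assms] by blast
  define k where "k = min \<kappa> \<kappa>'"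
  have k: "k > 0" "k \<le> \<kappa>" "k \<le> \<kappa>'" using \<kappa>(1) \<kappa>'(1) by (auto simp: k_def)
  have trig: "0 < cos \<theta> \<and> 0 < sin \<theta> \<and> sin \<theta> < \<kappa> * cos \<theta> \<and> sin \<theta> < \<kappa>' * cos \<theta> \<and> cos \<theta> \<le> 1" if "0 < \<theta>" "\<theta> < arctan k" for \<theta>
  proof -
    have "arctan k < pi/2" using arctan_ubound by auto
    then have c: "0 < cos \<theta>" "0 < sin \<theta>" using that by (auto intro: cos_gt_zero sin_gt_zero)
    have "tan \<theta> < tan (arctan k)" using that \<open>arctan k < pi/2\<close> by (intro tan_monotone) auto
    then have "tan \<theta> < k" by (simp only: tan_arctan)
    then have "sin \<theta> < k * cos \<theta>" using c by (simp add: tan_def divide_less_eq)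
    moreover have "k * cos \<theta> \<le> \<kappa> * cos \<theta>" "k * cos \<theta> \<le> \<kappa>' * cos \<theta>" using k c by (auto intro: mult_right_mono)
    ultimately show ?thesis using c by (auto intro: less_le_trans)
  qed
  show ?thesis
  proof (rule that[of "arctan k"])
    fix s \<theta> :: real assume s: "0 < s" "s < 1/2" and \<theta>: "0 < \<theta>" "\<theta> < arctan k"
    note t = trig[OF \<theta>]
    have b: "s * cos \<theta> \<le> s * 1" "s * sin \<theta> < s * (\<kappa> * cos \<theta>)" "s * sin \<theta> < s * (\<kappa>' * cos \<theta>)" using s t by (auto intro: mult_left_mono)
    have b': "s * cos \<theta> < 3/5" using b s by linarith
    show "p i + of_real s * cis \<theta> * (p j - p i) \<in> left i j"
      by (rule \<kappa>(2)) (use b b' t s in \<open>auto simp: algebra_simps\<close>)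
    show "p i + of_real s * cis (-\<theta>) * (p j - p i) \<in> left j i"
      by (rule \<kappa>'(2)) (use b b' t s in \<open>auto simp: algebra_simps\<close>)
  qed (use k in \<open>simp add: zero_less_arctan_iff\<close>)
qed

text \<open>No edge enters the sector between two consecutive edges at a vertex, so near the vertex this
  sector lies in one face. Its two ends overlap the wedges beside the two edges, which identifies that face
  as the one to the left of the first edge and to the right of the second.\<close>

lemma rot_succ_sector:
  assumes "rot_succ E p v j k"
  obtains \<sigma> where "\<sigma> > 0" "left v j = left k v"
    "\<And>s \<theta>. \<lbrakk>0 < s; s < \<sigma>; 0 < \<theta>; \<theta> < ccw_angle (p j - p v) (p k - p v)\<rbrakk>
        \<Longrightarrow> p v + of_real s * cis \<theta> * (p j - p v) \<in> left v j"
proof -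
  define a where "a = p j - p v"
  define b where "b = p k - p v"
  define \<beta> where "\<beta> = ccw_angle a b"
  have e: "{v, j} \<in> E" "{v, k} \<in> E"
    and min: "\<And>l. {v, l} \<in> E \<Longrightarrow> \<beta> \<le> ccw_angle a (p l - p v)"
    using assms by (auto simp: rot_succ_def a_def b_def \<beta>_def)
  have a0: "a \<noteq> 0" and b0: "b \<noteq> 0" and vV: "v \<in> V"
    using edge_ends[OF e(1)] edge_ends[OF e(2)] by (simp_all add: a_def b_def)
  note pol = ccw_angle_polar[OF a0 b0, folded \<beta>_def]
  obtain \<rho> where \<rho>: "\<rho> > 0" "\<And>z. \<lbrakk>norm z < \<rho>; z \<noteq> 0; p v + z \<in> D\<rbrakk> \<Longrightarrow> \<exists>j t. {v, j} \<in> E \<and> 0 < t \<and> z = of_real t * (p j - p v)"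
    using star_neighbourhood[OF vV] by blast
  define \<sigma> where "\<sigma> = \<rho> / norm a"
  have \<sigma>: "\<sigma> > 0" using \<rho>(1) a0 by (simp add: \<sigma>_def)
  define T where "T = (\<lambda>(s, \<theta>). p v + of_real s * cis \<theta> * a) ` ({0<..<\<sigma>} \<times> {0<..<\<beta>})"
  have T_I: "p v + of_real s * cis \<theta> * a \<in> T" if "0 < s" "s < \<sigma>" "0 < \<theta>" "\<theta> < \<beta>" for s \<theta>
    unfolding T_def by (rule image_eqI[of _ _ "(s, \<theta>)"]) (use that in auto)
  have "connected T" unfolding T_def case_prod_beta
    by (intro connected_continuous_image continuous_intros connected_Times) auto
  have TD: "T \<inter> D = {}"
  proof -
    have False if s: "0 < s" "s < \<sigma>" "0 < \<theta>" "\<theta> < \<beta>" and d: "p v + of_real s * cis \<theta> * a \<in> D" for s \<theta>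
    proof -
      have "norm (of_real s * cis \<theta> * a) < \<rho>" using s a0 by (simp add: norm_mult \<sigma>_def field_simps)
      moreover have "of_real s * cis \<theta> * a \<noteq> 0" using s a0 by simp
      ultimately obtain l t where l: "{v, l} \<in> E" "0 < t" "of_real s * cis \<theta> * a = of_real t * (p l - p v)"
        using \<rho>(2) d by blast
      have "(p l - p v) / a = of_real (s / t) * cis \<theta>" using l a0 by (simp add: field_simps)
      then have "ccw_angle a (p l - p v) = \<theta>" using s l pol(2) by (intro ccw_angle_eqI[of "s/t"]) auto
      then show False using min[OF l(1)] s by simp
    qed
    note no = this
    show ?thesis
    proof (rule equals0I)
      fix x assume x: "x \<in> T \<inter> D"
      then obtain y where y: "y \<in> {0<..<\<sigma>} \<times> {0<..<\<beta>}" "x = (\<lambda>(s, \<theta>). p v + of_real s * cis \<theta> * a) y"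
        unfolding T_def by (elim IntE imageE)
      show False using no[of "fst y" "snd y"] x y by (simp add: case_prod_beta mem_Times_iff)
    qed
  qed
  obtain \<eta> where \<eta>: "\<eta> > 0" 
    "\<And>s \<theta>. \<lbrakk>0 < s; s < 1/2; 0 < \<theta>; \<theta> < \<eta>\<rbrakk> \<Longrightarrow> p v + of_real s * cis \<theta> * a \<in> left v j"
    "\<And>s \<theta>. \<lbrakk>0 < s; s < 1/2; 0 < \<theta>; \<theta> < \<eta>\<rbrakk> \<Longrightarrow> p v + of_real s * cis (- \<theta>) * a \<in> left j v"
    by (rule polar_wedge[OF e(1), folded a_def], rule that)
  have half_min: "0 < min a b / 2" "min a b / 2 < a" "min a b / 2 < b" if "0 < a" "0 < b" for a b :: real
    using that by (auto simp: min_def)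
  define s1 where "s1 = min \<sigma> (1/2) / 2"
  define t1 where "t1 = min \<eta> \<beta> / 2"
  have 1: "0 < s1" "s1 < \<sigma>" "s1 < 1/2" "0 < t1" "t1 < \<eta>" "t1 < \<beta>" using \<sigma> \<eta>(1) pol(1) by (auto simp: s1_def t1_def)
  have x1: "p v + of_real s1 * cis t1 * a \<in> T" by (rule T_I) (use 1 in auto)
  have "p v + of_real s1 * cis t1 * a \<in> left v j" using \<eta>(2) 1 by blast
  then have Tl: "T \<subseteq> left v j" using connected_in_face[OF \<open>connected T\<close> TD left_in_faces[OF e(1)] x1] by blast
  obtain \<eta>' where \<eta>': "\<eta>' > 0"
    "\<And>s \<theta>. \<lbrakk>0 < s; s < 1/2; 0 < \<theta>; \<theta> < \<eta>'\<rbrakk> \<Longrightarrow> p v + of_real s * cis \<theta> * b \<in> left v k"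
    "\<And>s \<theta>. \<lbrakk>0 < s; s < 1/2; 0 < \<theta>; \<theta> < \<eta>'\<rbrakk> \<Longrightarrow> p v + of_real s * cis (- \<theta>) * b \<in> left k v"
    by (rule polar_wedge[OF e(2), folded b_def], rule that)
  define r where "r = norm b / norm a"
  have r: "r > 0" "b = of_real r * cis \<beta> * a" using a0 b0 pol(3) by (auto simp: r_def)
  have \<sigma>r: "0 < \<sigma> / r" using \<sigma> r by simp
  define s2 where "s2 = min (\<sigma>/r) (1/2) / 2"
  define t2 where "t2 = min \<eta>' \<beta> / 2"
  have 2: "0 < s2" "s2 < \<sigma>/r" "s2 < 1/2" "0 < t2" "t2 < \<eta>'" "t2 < \<beta>"
    using half_min[OF \<sigma>r, of "1/2"] half_min[OF \<eta>'(1) pol(1)] unfolding s2_def t2_def by simp_all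
  have eq: "p v + of_real s2 * cis (-t2) * b = p v + of_real (s2 * r) * cis (\<beta> - t2) * a"
  proof -
    have c: "cis (\<beta> - t2) = cis (-t2) * cis \<beta>" by (simp add: cis_mult)
    show ?thesis unfolding c by (subst r(2)) simp
  qed
  have "s2 * r < \<sigma>" using 2 r by (simp add: field_simps)
  then have "p v + of_real s2 * cis (-t2) * b \<in> T" unfolding eq by (intro T_I) (use 2 r in auto)
  moreover have "p v + of_real s2 * cis (-t2) * b \<in> left k v" using \<eta>'(3) 2 by blast
  moreover have "left k v \<in> faces V E p" using left_in_faces[of k v] e(2) by (simp add: insert_commute)
  ultimately have "left v j = left k v" using Tl by (intro face_eq[OF left_in_faces[OF e(1)]]) auto
  then show ?thesis
  proof (rule that[OF \<sigma>])
    fix s \<theta> :: real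
    assume "0 < s" "s < \<sigma>" "0 < \<theta>" "\<theta> < ccw_angle (p j - p v) (p k - p v)"
    then show "p v + of_real s * cis \<theta> * (p j - p v) \<in> left v j"
      using T_I Tl unfolding a_def b_def \<beta>_def by blast
  qed
qed

text \<open>Walking along a face cycle keeps the same face on the left.\<close>

lemma face_succ_left: "face_succ E p i j k \<Longrightarrow> left i j = left j k"
  unfolding face_succ_def by (erule rot_succ_sector) simp

end

section \<open>Turning angles and zeros on the circle of directions\<close>

lemma increasing_steps_mono:
  fixes z :: "nat \<Rightarrow> real"
  assumes "\<And>i. i < k \<Longrightarrow> z i < z (Suc i)" "i \<le> j" "j \<le> k"
  shows "z i \<le> z j"
  using assms(2,3)
proof (induction j rule: dec_induct)
  case (step n)
  then show ?case using assms(1)[of n] by simp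
qed simp

lemma find_interval:
  fixes th :: "nat \<Rightarrow> real"
  assumes "0 < d" "th 0 \<le> x" "x \<le> th d"
  obtains t where "t < d" "th t \<le> x" "x \<le> th (Suc t)"
proof -
  have "0 < d \<longrightarrow> x \<le> th d \<longrightarrow> (\<exists>t<d. th t \<le> x \<and> x \<le> th (Suc t))" for d
  proof (induction d)
    case (Suc d)
    show ?case
    proof (cases "0 < d \<and> x \<le> th d")
      case True then show ?thesis using Suc less_SucI by fastforce
    next
      case False
      then have "th d \<le> x" using assms(2) by (cases "d = 0") auto
      then show ?thesis by blast
    qed
  qed simp
  then show ?thesis using assms that by blast
qed

text \<open>The number of the half-period of the cosine, between consecutive zeros, that contains \<open>x\<close>. Half-periods
  are closed on the right, so that differences count zeros in half-open intervals.\<close>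

definition half_period :: "real \<Rightarrow> int" where "half_period x = \<lceil>(x - pi / 2) / pi\<rceil>"

lemma half_period_bounds: "of_int (half_period x) * pi - pi/2 < x" "x \<le> of_int (half_period x) * pi + pi/2"
proof -
  have "of_int (half_period x) - 1 < (x - pi / 2) / pi" "(x - pi / 2) / pi \<le> of_int (half_period x)"
    unfolding half_period_def by linarith+
  then show "of_int (half_period x) * pi - pi/2 < x" "x \<le> of_int (half_period x) * pi + pi/2"
    by (simp_all add: field_simps)
qed

lemma half_period_add_pi: "half_period (x + of_int k * pi) = half_period x + k"
proof -
  have "(x + of_int k * pi - pi / 2) / pi = (x - pi / 2) / pi + of_int k" by (simp add: field_simps)
  then show ?thesis unfolding half_period_def by simp
qed

lemma cos_minus_int_pi: "cos (x - of_int k * pi) = (if even k then cos x else - cos x)"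
  using sin_npi_int[of k] cos_npi_int[of k] by (simp add: cos_diff mult.commute[of _ pi])

lemma cos_sign_half_period: "even (half_period x) \<Longrightarrow> 0 \<le> cos x" "odd (half_period x) \<Longrightarrow> cos x \<le> 0"
proof -
  have "0 \<le> cos (x - of_int (half_period x) * pi)"
    using half_period_bounds[of x] by (intro cos_ge_zero) auto
  then show "even (half_period x) \<Longrightarrow> 0 \<le> cos x" "odd (half_period x) \<Longrightarrow> cos x \<le> 0"
    by (auto simp: cos_minus_int_pi)
qed

text \<open>If the cosines of two angles less than \<open>pi\<close> apart are positive multiples of each other, no zero of
  the cosine separates the angles. This carries the count of zeros across the boundary between two sectors.\<close>

lemma half_period_le:
  assumes "\<bar>x - y\<bar> < pi" "0 < r" "0 < s" "r * cos x = s * cos y"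
  shows "half_period y \<le> half_period x"
proof (rule ccontr)
  assume "\<not> half_period y \<le> half_period x"
  then have "half_period x + 1 \<le> half_period y" by simp
  then have "of_int (half_period x + 1) * pi \<le> of_int (half_period y) * pi" by (intro mult_right_mono) (simp_all only: of_int_le_iff pi_ge_zero)
  then have y: "of_int (half_period x) * pi + pi / 2 < y" using half_period_bounds(1)[of y] by (simp add: algebra_simps)
  define k where "k = half_period x"
  have "0 \<le> cos (x - of_int k * pi)"
    using half_period_bounds[of x] by (intro cos_ge_zero) (auto simp: k_def)
  moreover have "cos (y - of_int k * pi) < 0"
  proof -
    have "0 < cos (y - of_int k * pi - pi)"
      using y half_period_bounds(2)[of x] assms(1) by (intro cos_gt_zero_pi) (auto simp: k_def)
    then show ?thesis by simp
  qed
  moreover have "r * cos (x - of_int k * pi) = s * cos (y - of_int k * pi)"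
    using assms(4) by (simp add: cos_minus_int_pi)
  ultimately show False using assms(2,3)
    by (metis mult_nonneg_nonneg mult_pos_neg less_eq_real_def not_less)
qed

lemma half_period_eq:
  assumes "\<bar>x - y\<bar> < pi" "0 < r" "0 < s" "r * cos x = s * cos y"
  shows "half_period x = half_period y"
  using half_period_le[OF assms] half_period_le[of y x s r] assms by (simp add: abs_minus_commute)

text \<open>The zeros are \<open>\<psi> + pi/2 + k pi\<close>, and the inequalities that place such a point in the interval are
  inequalities between \<open>k\<close> and the half-period numbers of the ends.\<close>

lemma card_cos_zeros:
  assumes "x \<le> y"
  shows "finite {\<theta>. x \<le> \<theta> \<and> \<theta> < y \<and> cos (\<theta> - \<psi>) = 0}"
    "int (card {\<theta>. x \<le> \<theta> \<and> \<theta> < y \<and> cos (\<theta> - \<psi>) = 0}) = half_period (y - \<psi>) - half_period (x - \<psi>)"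
proof -
  define \<phi> where "\<phi> k = \<psi> + pi/2 + of_int k * pi" for k :: int
  have in_iff: "x \<le> \<phi> k \<longleftrightarrow> half_period (x - \<psi>) \<le> k" "\<phi> k < y \<longleftrightarrow> k < half_period (y - \<psi>)" for k
  proof -
    have "x \<le> \<phi> k \<longleftrightarrow> (x - \<psi> - pi/2) / pi \<le> of_int k" by (auto simp: \<phi>_def field_simps)
    then show "x \<le> \<phi> k \<longleftrightarrow> half_period (x - \<psi>) \<le> k" unfolding half_period_def by (simp add: ceiling_le_iff)
    have "\<phi> k < y \<longleftrightarrow> of_int k < (y - \<psi> - pi/2) / pi" by (auto simp: \<phi>_def field_simps)
    then show "\<phi> k < y \<longleftrightarrow> k < half_period (y - \<psi>)" unfolding half_period_def by (simp add: less_ceiling_iff)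
  qed
  have "cos (\<theta> - \<psi>) = 0 \<longleftrightarrow> (\<exists>k. \<theta> = \<phi> k)" for \<theta>
  proof
    assume "cos (\<theta> - \<psi>) = 0"
    then obtain k where "odd k" "\<theta> - \<psi> = of_int k * (pi/2)" by (auto simp: cos_zero_iff_int)
    then show "\<exists>k. \<theta> = \<phi> k" by (auto elim!: oddE simp: \<phi>_def field_simps)
  next
    assume "\<exists>k. \<theta> = \<phi> k"
    then obtain k where k: "\<theta> - \<psi> = of_int (2 * k + 1) * (pi/2)" by (auto simp: \<phi>_def field_simps)
    show "cos (\<theta> - \<psi>) = 0" unfolding cos_zero_iff_int using k by (intro exI[of _ "2 * k + 1"]) auto
  qed
  then have eq: "{\<theta>. x \<le> \<theta> \<and> \<theta> < y \<and> cos (\<theta> - \<psi>) = 0} = \<phi> ` {half_period (x - \<psi>)..<half_period (y - \<psi>)}"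
    using in_iff by auto
  have "inj \<phi>" by (auto simp: inj_on_def \<phi>_def)
  then have "card (\<phi> ` {half_period (x - \<psi>)..<half_period (y - \<psi>)}) = nat (half_period (y - \<psi>) - half_period (x - \<psi>))"
    by (subst card_image) (auto intro: inj_on_subset)
  moreover have "half_period (x - \<psi>) \<le> half_period (y - \<psi>)" unfolding half_period_def using assms
    by (intro ceiling_mono divide_right_mono) auto
  ultimately show "finite {\<theta>. x \<le> \<theta> \<and> \<theta> < y \<and> cos (\<theta> - \<psi>) = 0}"
    "int (card {\<theta>. x \<le> \<theta> \<and> \<theta> < y \<and> cos (\<theta> - \<psi>) = 0}) = half_period (y - \<psi>) - half_period (x - \<psi>)"
    unfolding eq by auto
qed

lemma inner_polar: "(of_real r * cis \<psi>) \<bullet> cis \<theta> = r * cos (\<theta> - \<psi>)"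
  by (simp add: inner_complex_def cos_diff algebra_simps)

text \<open>Off the segment from \<open>a\<close> to \<open>b\<close> the quotient avoids the branch cut, so its argument is the angle
  under which the segment is seen from \<open>q\<close>.\<close>

lemma Arg_off_segment:
  assumes "q \<notin> closed_segment a b"
  shows "a \<noteq> q" "b \<noteq> q" "\<bar>Arg ((b - q) / (a - q))\<bar> < pi" "(b - q) / (a - q) \<notin> \<real>\<^sub>\<le>\<^sub>0"
proof -
  show a: "a \<noteq> q" and b: "b \<noteq> q" using assms by auto
  show n: "(b - q) / (a - q) \<notin> \<real>\<^sub>\<le>\<^sub>0"
  proof
    assume "(b - q) / (a - q) \<in> \<real>\<^sub>\<le>\<^sub>0"
    then obtain r where r: "(b - q) / (a - q) = of_real r" "r \<le> 0" by (auto elim!: nonpos_Reals_cases)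
    then have "b - q = of_real r * (a - q)" using a by (simp add: field_simps)
    define t where "t = 1 / (1 - r)"
    have tr: "t * r = t - 1" using r(2) by (simp add: t_def field_simps)
    have "of_real t * (b - q) = of_real (t * r) * (a - q)" by (simp add: \<open>b - q = of_real r * (a - q)\<close>)
    then have "q = (1 - t) *\<^sub>R a + t *\<^sub>R b" unfolding tr by (simp add: scaleR_conv_of_real algebra_simps)
    moreover have "0 \<le> t" "t \<le> 1" using r(2) by (auto simp: t_def field_simps)
    ultimately show False using assms unfolding in_segment by blast
  qed
  have "Arg ((b - q) / (a - q)) \<noteq> pi" 
    using n Arg_eq_pi_iff[of "(b - q) / (a - q)"] by (auto simp: complex_nonpos_Reals_iff complex_is_Real_iff)
  then show "\<bar>Arg ((b - q) / (a - q))\<bar> < pi"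
    using Arg_bounded[of "(b - q) / (a - q)"] by auto
qed

text \<open>The relation between zeros and winding number. Let \<open>\<psi> t\<close> be the argument of \<open>g t - q\<close>, continued along
  the polygon. On the sector \<open>t\<close> the function is a positive multiple of \<open>cos (\<theta> - \<psi> t)\<close>, so the
  half-period number of \<open>\<theta> - \<psi> t\<close> increases by one at every zero. It does not change when \<open>t\<close> does, because
  \<open>\<psi>\<close> then changes by less than \<open>pi\<close>. After a turn \<open>\<theta>\<close> has grown by two half-periods and \<open>\<psi>\<close> by \<open>2 w\<close> half-periods,
  where \<open>w\<close> is the winding number; the difference is the number of zeros. The parity of the half-period number is
  the sign of the function, so the zeros are sign changes.\<close>

lemma polygon_index_zeros:
  fixes f :: "real \<Rightarrow> real" and g :: "nat \<Rightarrow> complex" and th :: "nat \<Rightarrow> real"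
  assumes d: "0 < d"
    and th: "\<And>t. t < d \<Longrightarrow> th t < th (Suc t)" "th d = th 0 + 2 * pi"
    and g: "g d = g 0" "\<And>t. t < d \<Longrightarrow> q \<notin> closed_segment (g t) (g (Suc t))"
    and f: "\<And>t \<theta>. \<lbrakk>t < d; th t \<le> \<theta>; \<theta> \<le> th (Suc t)\<rbrakk> \<Longrightarrow> f \<theta> = g t \<bullet> cis \<theta>"
    and per: "f (th d) = f (th 0)"
  defines "Z \<equiv> {\<theta>. th 0 \<le> \<theta> \<and> \<theta> < th d \<and> f \<theta> = q \<bullet> cis \<theta>}"
  shows "finite Z" and "even (card Z)"
    and "real (card Z) = 2 - 2 * ((\<Sum>t<d. Arg ((g (Suc t) - q) / (g t - q))) / (2 * pi))"
    and "\<exists>m::int. \<forall>\<theta>. th 0 \<le> \<theta> \<and> \<theta> \<le> th d \<longrightarrow>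
        (even (int (card (Z \<inter> {..<\<theta>})) + m) \<longrightarrow> q \<bullet> cis \<theta> \<le> f \<theta>) \<and>
        (odd (int (card (Z \<inter> {..<\<theta>})) + m) \<longrightarrow> f \<theta> \<le> q \<bullet> cis \<theta>)"
proof -
  define w where "w t = g t - q" for t
  \<comment> \<open>the argument of \<open>w t\<close>, continued along the polygon\<close>
  define \<psi> where "\<psi> t = Arg (w 0) + (\<Sum>t<t. Arg (w (Suc t) / w t))" for t
  have w0: "w t \<noteq> 0" if "t \<le> d" for t
  proof (cases "t = d")
    case True then show ?thesis using Arg_off_segment(1)[OF g(2)[OF d]] g(1) by (simp add: w_def)
  next
    case False then show ?thesis using Arg_off_segment(1)[OF g(2)[of t]] that by (simp add: w_def)
  qed
  have pol: "w t = of_real (norm (w t)) * cis (\<psi> t)" if "t \<le> d" for t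
    using that
  proof (induction t)
    case 0 then show ?case using w0[of 0] by (simp add: \<psi>_def cis_Arg sgn_eq)
  next
    case (Suc t)
    have nz: "w t \<noteq> 0" "w (Suc t) \<noteq> 0" using w0 Suc by auto
    have "w (Suc t) = w t * (w (Suc t) / w t)" using nz by simp
    also have "w (Suc t) / w t = of_real (norm (w (Suc t) / w t)) * cis (Arg (w (Suc t) / w t))"
      using nz by (simp add: cis_Arg sgn_eq)
    also have "w t * \<dots> = of_real (norm (w t)) * cis (\<psi> t) * \<dots>" using Suc by simp
    also have "\<dots> = of_real (norm (w (Suc t))) * (cis (\<psi> t) * cis (Arg (w (Suc t) / w t)))"
      using nz by (simp add: norm_divide)
    also have "cis (\<psi> t) * cis (Arg (w (Suc t) / w t)) = cis (\<psi> (Suc t))"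
      by (simp add: \<psi>_def cis_mult add.assoc)
    finally show ?case .
  qed
  have F: "f \<theta> - q \<bullet> cis \<theta> = norm (w t) * cos (\<theta> - \<psi> t)" if "t < d" "th t \<le> \<theta>" "\<theta> \<le> th (Suc t)" for t \<theta>
  proof -
    have "f \<theta> - q \<bullet> cis \<theta> = w t \<bullet> cis \<theta>" using f[OF that] by (simp add: w_def inner_diff_left)
    also have "\<dots> = (of_real (norm (w t)) * cis (\<psi> t)) \<bullet> cis \<theta>" using pol[of t] that by simp
    finally show ?thesis by (simp only: inner_polar)
  qed
  \<comment> \<open>the last joint, \<open>Suc t = d\<close>, closes up the period\<close>
  have joint: "half_period (th (Suc t) - \<psi> t) = half_period (th (Suc t) - \<psi> (Suc t))" if t: "t < d" for t
  proof (rule half_period_eq)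
    show "\<bar>th (Suc t) - \<psi> t - (th (Suc t) - \<psi> (Suc t))\<bar> < pi"
      using Arg_off_segment(3)[OF g(2)[OF t]] by (simp add: \<psi>_def w_def)
    show "0 < norm (w t)" "0 < norm (w (Suc t))" using w0 t by auto
    have "f (th (Suc t)) - q \<bullet> cis (th (Suc t)) = norm (w (Suc t)) * cos (th (Suc t) - \<psi> (Suc t))"
    proof (cases "Suc t < d")
      case True then show ?thesis using F[of "Suc t" "th (Suc t)"] th(1)[of "Suc t"] by simp
    next
      case False
      then have td: "Suc t = d" using t by simp
      have c: "cis (th d) = cis (th 0)" using th(2) by (simp add: cis_mult[symmetric])
      have "f (th d) - q \<bullet> cis (th d) = w d \<bullet> cis (th d)"
        using f[of 0 "th 0"] th(1)[of 0] d per g(1) by (simp add: c w_def inner_diff_left)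
      also have "\<dots> = (of_real (norm (w d)) * cis (\<psi> d)) \<bullet> cis (th d)" using pol[of d] by simp
      finally show ?thesis unfolding td by (simp only: inner_polar)
    qed
    then show "norm (w t) * cos (th (Suc t) - \<psi> t) = norm (w (Suc t)) * cos (th (Suc t) - \<psi> (Suc t))"
      using F[OF t, of "th (Suc t)"] th(1)[OF t] by simp
  qed
  have th_mono: "th s \<le> th t" if "s \<le> t" "t \<le> d" for s t
    by (rule increasing_steps_mono[of d th]) (use th(1) that in auto)
  define c0 where "c0 = half_period (th 0 - \<psi> 0)"
  have count: "finite (Z \<inter> {..<\<theta>}) \<and> int (card (Z \<inter> {..<\<theta>})) = half_period (\<theta> - \<psi> t) - c0"
    if "t < d" "th t \<le> \<theta>" "\<theta> \<le> th (Suc t)" for t \<theta>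
    using that
  proof (induction t arbitrary: \<theta>)
    case 0
    have "Z \<inter> {..<\<theta>} = {x. th 0 \<le> x \<and> x < \<theta> \<and> cos (x - \<psi> 0) = 0}"
    proof -
      have "x < th d" if "x < \<theta>" for x using that 0 th_mono[of 1 d] d by simp
      moreover have "f x = q \<bullet> cis x \<longleftrightarrow> cos (x - \<psi> 0) = 0" if "th 0 \<le> x" "x < \<theta>" for x
        using F[of 0 x] that 0 w0[of 0] by (auto simp: eq_iff_diff_eq_0[of "f x"])
      ultimately show ?thesis unfolding Z_def by auto
    qed
    then show ?case using card_cos_zeros[of "th 0" \<theta> "\<psi> 0"] 0 by (simp add: c0_def)
  next
    case (Suc t)
    have IH: "finite (Z \<inter> {..<th (Suc t)})" "int (card (Z \<inter> {..<th (Suc t)})) = half_period (th (Suc t) - \<psi> t) - c0"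
      using Suc.IH[of "th (Suc t)"] Suc.prems th(1)[of t] by auto
    define B where "B = {x. th (Suc t) \<le> x \<and> x < \<theta> \<and> cos (x - \<psi> (Suc t)) = 0}"
    have eq: "Z \<inter> {..<\<theta>} = (Z \<inter> {..<th (Suc t)}) \<union> B"
    proof -
      have "x < th d" if "x < \<theta>" for x using that Suc.prems th_mono[of "Suc (Suc t)" d] by simp
      moreover have "th 0 \<le> th (Suc t)" using th_mono Suc.prems by simp
      moreover have "f x = q \<bullet> cis x \<longleftrightarrow> cos (x - \<psi> (Suc t)) = 0" if "th (Suc t) \<le> x" "x < \<theta>" for x
        using F[of "Suc t" x] that Suc.prems w0[of "Suc t"] by (auto simp: eq_iff_diff_eq_0[of "f x"])
      ultimately show ?thesis unfolding Z_def B_def using Suc.prems(2) by force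
    qed
    have B: "finite B" "int (card B) = half_period (\<theta> - \<psi> (Suc t)) - half_period (th (Suc t) - \<psi> (Suc t))"
      using card_cos_zeros[of "th (Suc t)" \<theta> "\<psi> (Suc t)"] Suc.prems unfolding B_def by auto
    have "card (Z \<inter> {..<\<theta>}) = card (Z \<inter> {..<th (Suc t)}) + card B" unfolding eq
      by (rule card_Un_disjoint[OF IH(1) B(1)]) (auto simp: B_def)
    moreover have "finite (Z \<inter> {..<\<theta>})" unfolding eq using IH(1) B(1) by simp
    ultimately show ?case using IH(2) B(2) joint[of t] Suc.prems by simp
  qed
  obtain d' where d': "d = Suc d'" using d gr0_implies_Suc by blast
  have Zd: "Z \<inter> {..<th d} = Z" by (auto simp: Z_def)
  have tot: "finite Z" "int (card Z) = half_period (th d - \<psi> d) - c0"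
    using count[of d' "th d"] joint[of d'] th(1)[of d'] Zd unfolding d' by simp_all
  show "finite Z" by (rule tot)
  have "cis (\<psi> d) = cis (\<psi> 0)"
  proof -
    have "w d = w 0" by (simp add: w_def g)
    then have "of_real (norm (w 0)) * cis (\<psi> d) = of_real (norm (w 0)) * cis (\<psi> 0)"
      using pol[OF order_refl] pol[of 0] by simp
    then show ?thesis using w0[of 0] by auto
  qed
  \<comment> \<open>\<open>n\<close> is the winding number\<close>
  then obtain n :: int where n: "\<psi> d = \<psi> 0 + 2 * pi * of_int n"
    by (metis cis.sel complex_eq_iff sin_cos_eq_iff)
  have "th d - \<psi> d = (th 0 - \<psi> 0) + of_int (2 - 2 * n) * pi" using th(2) n by (simp add: algebra_simps)
  then have "int (card Z) = 2 - 2 * n" using tot(2) by (simp only: half_period_add_pi c0_def)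
  then have "int (card Z) = 2 * (1 - n)" by simp
  then have "even (int (card Z))" by simp
  then show "even (card Z)" by simp
  have "real (card Z) = 2 - 2 * of_int n" using \<open>int (card Z) = 2 - 2 * n\<close> by linarith
  moreover have "(\<Sum>t<d. Arg ((g (Suc t) - q) / (g t - q))) = 2 * pi * of_int n"
    using n by (simp add: \<psi>_def w_def)
  ultimately show "real (card Z) = 2 - 2 * ((\<Sum>t<d. Arg ((g (Suc t) - q) / (g t - q))) / (2 * pi))"
    by simp
  show "\<exists>m::int. \<forall>\<theta>. th 0 \<le> \<theta> \<and> \<theta> \<le> th d \<longrightarrow>
        (even (int (card (Z \<inter> {..<\<theta>})) + m) \<longrightarrow> q \<bullet> cis \<theta> \<le> f \<theta>) \<and>
        (odd (int (card (Z \<inter> {..<\<theta>})) + m) \<longrightarrow> f \<theta> \<le> q \<bullet> cis \<theta>)"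
  proof (intro exI[of _ c0] allI impI)
    fix \<theta> assume \<theta>: "th 0 \<le> \<theta> \<and> \<theta> \<le> th d"
    obtain t where t: "t < d" "th t \<le> \<theta>" "\<theta> \<le> th (Suc t)"
      using find_interval[of d th \<theta>] d \<theta> by blast
    have "int (card (Z \<inter> {..<\<theta>})) + c0 = half_period (\<theta> - \<psi> t)" using count[OF t] by simp
    moreover have "0 < norm (w t)" using w0 t by simp
    ultimately show "(even (int (card (Z \<inter> {..<\<theta>})) + c0) \<longrightarrow> q \<bullet> cis \<theta> \<le> f \<theta>) \<and>
        (odd (int (card (Z \<inter> {..<\<theta>})) + c0) \<longrightarrow> f \<theta> \<le> q \<bullet> cis \<theta>)"
      using F[OF t] cos_sign_half_period[of "\<theta> - \<psi> t"] mult_nonneg_nonneg[of "norm (w t)" "cos (\<theta> - \<psi> t)"]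
        mult_nonneg_nonpos[of "norm (w t)" "cos (\<theta> - \<psi> t)"]
      by (simp del: mult_nonneg_nonneg mult_nonneg_nonpos) linarith
  qed
qed

section \<open>Cones cut by planes\<close>

lemma enumerate_increasing:
  fixes Z :: "'a::linorder set"
  assumes "finite Z"
  obtains z where "\<And>i j. \<lbrakk>i < j; j < card Z\<rbrakk> \<Longrightarrow> z i < z j" "Z = z ` {..<card Z}"
proof
  define xs where "xs = sorted_list_of_set Z"
  have xs: "set xs = Z" "length xs = card Z" "sorted_wrt (<) xs"
    using assms by (auto simp: xs_def)
  show "xs ! i < xs ! j" if "i < j" "j < card Z" for i j
    using sorted_wrt_nth_less[OF xs(3)] that xs(2) by simp
  show "Z = (!) xs ` {..<card Z}" using xs by (auto simp: set_conv_nth)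
qed

text \<open>A partition into nonempty, connected, relatively open sets is the partition into components.\<close>

lemma components_eq_family:
  assumes U: "\<And>U. U \<in> \<U> \<Longrightarrow> connected U" "\<And>U. U \<in> \<U> \<Longrightarrow> U \<noteq> {}" "\<And>U. U \<in> \<U> \<Longrightarrow> openin (top_of_set S) U"
    and disj: "\<And>U W. \<lbrakk>U \<in> \<U>; W \<in> \<U>; U \<noteq> W\<rbrakk> \<Longrightarrow> U \<inter> W = {}" and S: "S = \<Union>\<U>"
  shows "components S = \<U>"
proof -
  have comp: "C = U" if C: "C \<in> components S" and Uin: "U \<in> \<U>" and meet: "C \<inter> U \<noteq> {}" for C U
  proof -
    have UC: "U \<subseteq> C" using components_maximal[OF C U(1)[OF Uin]] S Uin meet by auto
    have "connected C" "C \<subseteq> S" using C in_components_connected in_components_subset by blast+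
    define R where "R = \<Union>(\<U> - {U})"
    have o: "openin (top_of_set S) R" unfolding R_def using U(3) by (intro openin_Union) auto
    have "openin (top_of_set C) (C \<inter> R)" "openin (top_of_set C) (C \<inter> U)"
      using o U(3)[OF Uin] \<open>C \<subseteq> S\<close> unfolding openin_open by blast+
    moreover have "C \<subseteq> (C \<inter> U) \<union> (C \<inter> R)" using \<open>C \<subseteq> S\<close> S by (auto simp: R_def)
    moreover have "(C \<inter> U) \<inter> (C \<inter> R) = {}" unfolding R_def using disj Uin by blast
    ultimately have "C \<inter> R = {}" using \<open>connected C\<close> meet unfolding connected_openin by blast
    then have "C \<subseteq> U" using \<open>C \<subseteq> S\<close> S unfolding R_def by blast
    then show ?thesis using UC by blast
  qed
  show ?thesis
  proof (intro equalityI subsetI)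
    fix C assume C: "C \<in> components S"
    then obtain x where "x \<in> C" "x \<in> S" using in_components_nonempty in_components_subset by blast
    then show "C \<in> \<U>" using comp[OF C] S by blast
  next
    fix W assume W: "W \<in> \<U>"
    then obtain x where x: "x \<in> W" "x \<in> S" using U(2) S by blast
    then obtain C where "C \<in> components S" "x \<in> C" using Union_components[of S] by blast
    then show "W \<in> components S" using comp[of C W] W x by blast
  qed
qed

text \<open>The open sector of directions between \<open>a\<close> and \<open>b\<close>, written as an image under the exponential
  function, which is an open map; angles may exceed \<open>2 * pi\<close>.\<close>

definition arc_cone :: "real \<Rightarrow> real \<Rightarrow> complex set" where
  "arc_cone a b = exp ` {z. a < Im z \<and> Im z < b}"

lemma arc_cone_iff: "z \<in> arc_cone a b \<longleftrightarrow> (\<exists>s>0. \<exists>\<theta>. a < \<theta> \<and> \<theta> < b \<and> z = of_real s * cis \<theta>)"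
proof
  assume "z \<in> arc_cone a b"
  then obtain w where "a < Im w" "Im w < b" "z = exp w" by (auto simp: arc_cone_def)
  then show "\<exists>s>0. \<exists>\<theta>. a < \<theta> \<and> \<theta> < b \<and> z = of_real s * cis \<theta>"
    by (intro exI[of _ "exp (Re w)"] conjI exI[of _ "Im w"]) (auto simp: exp_eq_polar)
next
  assume "\<exists>s>0. \<exists>\<theta>. a < \<theta> \<and> \<theta> < b \<and> z = of_real s * cis \<theta>"
  then obtain s \<theta> where "s > 0" "a < \<theta>" "\<theta> < b" "z = of_real s * cis \<theta>" by blast
  then have "z = exp (Complex (ln s) \<theta>)" by (simp add: exp_eq_polar)
  then show "z \<in> arc_cone a b" unfolding arc_cone_def using \<open>a < \<theta>\<close> \<open>\<theta> < b\<close> by force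
qed

lemma open_arc_cone: "open (arc_cone a b)"
proof -
  have "open {z. a < Im z \<and> Im z < b}"
    by (intro open_Collect_conj open_Collect_less continuous_intros)
  then have "openin (top_of_set (- {0})) (arc_cone a b)" unfolding arc_cone_def
    using covering_space_open_map[OF covering_space_exp_punctured_plane] by (auto simp: openin_open_eq)
  then show ?thesis using openin_open_trans by blast
qed

lemma connected_arc_cone: "connected (arc_cone a b)"
proof -
  have "{z. a < Im z \<and> Im z < b} = {z. \<i> \<bullet> z > a} \<inter> {z. \<i> \<bullet> z < b}" by (auto simp: inner_complex_def)
  then have "convex {z. a < Im z \<and> Im z < b}"
    by (simp only:) (intro convex_Int convex_halfspace_lt convex_halfspace_gt)
  then show ?thesis unfolding arc_cone_def
    by (intro connected_continuous_image continuous_intros convex_connected)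
qed

lemma polar_unique:
  assumes "of_real s * cis x = of_real t * cis y" "0 < s" "0 < t" "\<bar>x - y\<bar> < 2 * pi"
  shows "x = y"
proof -
  have "norm (of_real s * cis x) = norm (of_real t * cis y)" using assms by simp
  then have "s = t" using assms(2,3) unfolding norm_mult by simp
  then have "cis x = cis y" using assms by simp
  then obtain n :: int where n: "x = y + 2 * pi * of_int n"
    by (metis cis.sel complex_eq_iff sin_cos_eq_iff)
  then have "\<bar>real_of_int n\<bar> * (2 * pi) < 1 * (2 * pi)" using assms(4) by (simp add: abs_mult)
  then have "\<bar>real_of_int n\<bar> < 1" by (subst (asm) mult_less_cancel_right) simp
  then show ?thesis using n by simp
qed

lemma cis_add_2pi: "cis (\<theta> + 2 * pi) = cis \<theta>" "cis (\<theta> - 2 * pi) = cis \<theta>"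
  by (simp_all add: cis.ctr cos_diff sin_diff)

lemma polar_in_period:
  obtains s \<theta> where "0 \<le> s" "a \<le> \<theta>" "\<theta> < a + 2 * pi" "z = of_real s * cis \<theta>"
proof -
  define k where "k = \<lceil>(a - Arg z) / (2 * pi)\<rceil>"
  have k: "(a - Arg z) / (2 * pi) \<le> of_int k" "of_int k < (a - Arg z) / (2 * pi) + 1"
    unfolding k_def by linarith+
  have "cis (Arg z + 2 * pi * of_int k) = cis (Arg z)" by (simp add: cis_mult[symmetric] cis_multiple_2pi)
  then have "z = of_real (norm z) * cis (Arg z + 2 * pi * of_int k)"
    using rcis_cmod_Arg[of z] by (simp add: rcis_def)
  moreover have "a \<le> Arg z + 2 * pi * of_int k" "Arg z + 2 * pi * of_int k < a + 2 * pi"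
    using k by (simp_all add: field_simps)
  ultimately show ?thesis using that[of "norm z"] by simp
qed

text \<open>Height functions of cones above planes through the apex. Their sign depends on the direction only.\<close>

locale homogeneous =
  fixes F :: "complex \<Rightarrow> real"
  assumes homog: "0 < s \<Longrightarrow> F (of_real s * z) = s * F z"
    and cont: "continuous_on UNIV F"
begin

lemma F_zero: "F 0 = 0" using homog[of 2 0] by simp

abbreviation nonzero :: "complex set" where "nonzero \<equiv> {z. F z \<noteq> 0}"

lemma open_nonzero: "open nonzero"
  using cont by (intro open_Collect_neq continuous_intros)

lemma component_cone: "\<lbrakk>U \<in> components nonzero; z \<in> U; 0 < s\<rbrakk> \<Longrightarrow> of_real s * z \<in> U"
proof -
  assume U: "U \<in> components nonzero" and z: "z \<in> U" and s: "0 < s"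
  define T where "T = (\<lambda>s. of_real s * z) ` {0<..}"
  have "connected T" unfolding T_def
    by (intro connected_continuous_image continuous_intros) auto
  moreover have "F z \<noteq> 0" using U z in_components_subset by blast
  then have "T \<subseteq> nonzero" unfolding T_def using homog by auto
  moreover have "z \<in> T" unfolding T_def by (rule image_eqI[of _ _ 1]) auto
  ultimately have "T \<subseteq> U" using components_maximal[OF U] z by blast
  then show "of_real s * z \<in> U" unfolding T_def using s by blast
qed

text \<open>The directions of the zeros divide the plane into the sectors between consecutive ones.\<close>

lemma components_arcs:
  assumes k: "0 < k" and z: "\<And>i. i < k \<Longrightarrow> z i < z (Suc i)" "z k = z 0 + 2 * pi"
    and zero: "\<And>i. i \<le> k \<Longrightarrow> F (cis (z i)) = 0"
    and nz: "\<And>i \<theta>. \<lbrakk>i < k; z i < \<theta>; \<theta> < z (Suc i)\<rbrakk> \<Longrightarrow> F (cis \<theta>) \<noteq> 0"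
  shows "components nonzero = (\<lambda>i. arc_cone (z i) (z (Suc i))) ` {..<k}"
    "inj_on (\<lambda>i. arc_cone (z i) (z (Suc i))) {..<k}"
proof -
  define A where "A i = arc_cone (z i) (z (Suc i))" for i
  have zm: "z i \<le> z j" if "i \<le> j" "j \<le> k" for i j
    by (rule increasing_steps_mono[of k z]) (use z(1) that in auto)
  have ne: "A i \<noteq> {}" if "i < k" for i
  proof -
    have "cis ((z i + z (Suc i)) / 2) \<in> A i" unfolding A_def arc_cone_iff
      using z(1)[OF that] by (intro exI[of _ 1] conjI exI[of _ "(z i + z (Suc i)) / 2"]) auto
    then show ?thesis by blast
  qed
  have disj: "A i \<inter> A j = {}" if ij: "i < j" "j < k" for i j
  proof (rule equals0I)
    fix x assume "x \<in> A i \<inter> A j"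
    then have "x \<in> A i" "x \<in> A j" by auto
    then obtain s \<theta> t \<phi> where *: "0 < s" "0 < t" "z i < \<theta>" "\<theta> < z (Suc i)" "z j < \<phi>" "\<phi> < z (Suc j)" "x = of_real s * cis \<theta>" "x = of_real t * cis \<phi>"
      unfolding A_def by (fastforce simp: arc_cone_iff)
    have b: "z (Suc i) \<le> z j" "z 0 \<le> z i" "z (Suc j) \<le> z k" using zm ij by auto
    have "\<theta> = \<phi>" by (rule polar_unique[of s _ t]) (use * b z(2) in auto)
    then show False using b * by simp
  qed
  have disj': "A i \<inter> A j = {}" if "i < k" "j < k" "i \<noteq> j" for i j
    using disj[of i j] disj[of j i] that by (cases "i < j") auto
  have un: "nonzero = \<Union>(A ` {..<k})"
  proof (intro equalityI subsetI)
    fix w assume w: "w \<in> nonzero"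
    obtain s \<theta> where s: "0 \<le> s" "z 0 \<le> \<theta>" "\<theta> < z 0 + 2 * pi" "w = of_real s * cis \<theta>"
      using polar_in_period[of "z 0" w] by blast
    have s0: "0 < s" using s w F_zero by (cases "s = 0") auto
    then have f: "F (cis \<theta>) \<noteq> 0" using homog[of s "cis \<theta>"] w s by auto
    have "\<theta> \<le> z k" using s(3) z(2) by simp
    then obtain i where i: "i < k" "z i \<le> \<theta>" "\<theta> \<le> z (Suc i)" using find_interval[of k z \<theta>] k s(2) by blast
    have "z i \<noteq> \<theta>" "z (Suc i) \<noteq> \<theta>" using f zero[of i] zero[of "Suc i"] i by auto
    then have "w \<in> A i" unfolding A_def arc_cone_iff using i s s0 by (intro exI[of _ s] conjI exI[of _ \<theta>]) auto
    then show "w \<in> \<Union>(A ` {..<k})" using i by blast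
  next
    fix w assume "w \<in> \<Union>(A ` {..<k})"
    then obtain i where "i < k" "w \<in> A i" by blast
    then show "w \<in> nonzero" unfolding A_def arc_cone_iff using nz homog by fastforce
  qed
  have "components nonzero = A ` {..<k}"
  proof (rule components_eq_family)
    show "openin (top_of_set nonzero) U" if "U \<in> A ` {..<k}" for U
      using that open_arc_cone un unfolding A_def by (intro open_subset) auto
    show "connected U" if "U \<in> A ` {..<k}" for U using that connected_arc_cone by (auto simp: A_def)
    show "U \<noteq> {}" if "U \<in> A ` {..<k}" for U using that ne by auto
    show "U \<inter> W = {}" if UW: "U \<in> A ` {..<k}" "W \<in> A ` {..<k}" "U \<noteq> W" for U W
    proof -
      obtain i j where "i < k" "j < k" "U = A i" "W = A j" using UW by blast
      then show ?thesis using disj'[of i j] UW by auto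
    qed
  qed (rule un)
  then show "components nonzero = (\<lambda>i. arc_cone (z i) (z (Suc i))) ` {..<k}" by (simp add: A_def)
  have "inj_on A {..<k}"
  proof (rule inj_onI)
    fix i j assume "i \<in> {..<k}" "j \<in> {..<k}" "A i = A j"
    then show "i = j" using disj'[of i j] ne[of i] by auto
  qed
  then show "inj_on (\<lambda>i. arc_cone (z i) (z (Suc i))) {..<k}" by (simp add: A_def[abs_def])
qed

lemma sign_on_component:
  assumes U: "U \<in> components nonzero" and uw: "u \<in> U" "w \<in> U"
  shows "0 < F u * F w"
proof (rule ccontr)
  assume n: "\<not> 0 < F u * F w"
  have c: "connected (F ` U)"
    using U cont by (intro connected_continuous_image) (auto intro: continuous_on_subset in_components_connected)
  have "F u \<le> 0 \<and> 0 \<le> F w \<or> F w \<le> 0 \<and> 0 \<le> F u" using n by (auto simp: zero_less_mult_iff)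
  then have "0 \<in> F ` U" using uw c unfolding connected_iff_interval by blast
  then obtain y where "y \<in> U" "F y = 0" by auto
  then show False using in_components_subset[OF U] by blast
qed

end

text \<open>A point \<open>x\<close> near which the graph of \<open>h\<close> is the cone given by \<open>l\<close>.\<close>

locale cone_point =
  fixes h :: "complex \<Rightarrow> real" and x :: complex and l :: "complex \<Rightarrow> real" and \<rho> :: real
  assumes \<rho>: "0 < \<rho>"
    and local_form: "norm z < \<rho> \<Longrightarrow> h (x + z) = h x + l z"
    and l_homog: "0 < s \<Longrightarrow> l (of_real s * z) = s * l z"
    and l_cont: "continuous_on UNIV l"
begin

text \<open>Up to a factor, the signed distance of the point of the cone over \<open>z\<close> from the plane with normal \<open>n\<close>
  through the apex.\<close>

definition height :: "complex \<times> real \<Rightarrow> complex \<Rightarrow> real" where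
  "height n z = fst n \<bullet> z + snd n * l z"

lemma homogeneous_height: "homogeneous (height n)"
proof
  show "height n (of_real s * z) = s * height n z" if "0 < s" for s z
    using l_homog[OF that, of z]
    by (simp add: height_def scaleR_conv_of_real[symmetric] distrib_left)
  show "continuous_on UNIV (height n)" unfolding height_def
    by (intro continuous_intros l_cont)
qed

text \<open>The distance from the apex, in space, of the point of the cone over \<open>z\<close>.\<close>

definition graph_norm :: "complex \<Rightarrow> real" where "graph_norm z = norm (z, l z)"

lemma graph_norm_homog: "0 < s \<Longrightarrow> graph_norm (of_real s * z) = s * graph_norm z"
  unfolding graph_norm_def using norm_scaleR[of s "(z, l z)"] l_homog[of s z]
  by (simp add: scaleR_conv_of_real)

lemma norm_le_graph_norm: "norm z \<le> graph_norm z" unfolding graph_norm_def using norm_fst_le[of z "l z"] by simp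

text \<open>The part over \<open>U\<close> of the neighborhood of radius \<open>r\<close> of the apex in the surface.\<close>

definition piece :: "real \<Rightarrow> complex set \<Rightarrow> (complex \<times> real) set" where
  "piece r U = (\<lambda>z. (x + z, h x + l z)) ` (U \<inter> {z. graph_norm z < r})"

lemma surface_ball:
  assumes "0 < r" "r \<le> \<rho>"
  shows "surface h \<inter> ball (x, h x) r = piece r UNIV"
proof (intro equalityI subsetI)
  fix X assume X: "X \<in> surface h \<inter> ball (x, h x) r"
  then obtain y where y: "X = (y, h y)" by (auto simp: surface_def)
  have n: "norm (y - x, h y - h x) < r" using X y by (simp add: dist_norm norm_minus_commute[of x] norm_Pair)
     (smt (verit) power2_commute)
  then have "norm (y - x) < \<rho>" using norm_fst_le[of "y - x" "h y - h x"] assms by simp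
  then have "h y = h x + l (y - x)" using local_form[of "y - x"] by simp
  then show "X \<in> piece r UNIV" using n y unfolding piece_def graph_norm_def by (intro image_eqI[of _ _ "y - x"]) auto
next
  fix X assume "X \<in> piece r UNIV"
  then obtain z where z: "X = (x + z, h x + l z)" "graph_norm z < r" by (auto simp: piece_def)
  then have "norm z < \<rho>" using norm_le_graph_norm[of z] assms by simp
  then have "X = (x + z, h (x + z))" using z local_form by simp
  moreover have "dist (x, h x) X = graph_norm z" using z(1) by (simp add: dist_Pair_Pair graph_norm_def norm_Pair dist_norm)
  ultimately show "X \<in> surface h \<inter> ball (x, h x) r" using z by (auto simp: surface_def)
qed

lemma piece_height: "(x + z, h x + l z) \<in> plane_through n (x, h x) \<longleftrightarrow> height n z = 0"
  by (simp add: plane_through_def height_def inner_prod_def)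

text \<open>Projection to the plane identifies the pieces with the components of the set of nonzero height: such a
  component is a cone, the neighborhood is star-shaped about the apex, and so cutting the component down to
  the neighborhood keeps it connected.\<close>

lemma pieces_eq:
  assumes r: "0 < r" "r \<le> \<rho>"
  shows "pieces h x n r = piece r ` components {z. height n z \<noteq> 0}"
    "inj_on (piece r) (components {z. height n z \<noteq> 0})"
proof -
  interpret H: homogeneous "height n" by (rule homogeneous_height)
  define C where "C = components H.nonzero"
  have ne: "piece r U \<noteq> {}" if U: "U \<in> C" for U
  proof -
    obtain z where z: "z \<in> U" using in_components_nonempty U unfolding C_def by blast
    define s where "s = r / (2 * (1 + graph_norm z))"
    have g: "0 \<le> graph_norm z" by (simp add: graph_norm_def)
    have s: "0 < s" using r g by (simp add: s_def)
    have "s * graph_norm z < r" using r g by (simp add: s_def field_simps add_strict_increasing)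
    then have "of_real s * z \<in> U \<inter> {z. graph_norm z < r}"
      using H.component_cone U z s graph_norm_homog[OF s, of z] unfolding C_def by simp
    then show ?thesis unfolding piece_def by blast
  qed
  have disj: "piece r U \<inter> piece r W = {}" if "U \<in> C" "W \<in> C" "U \<noteq> W" for U W
    using components_nonoverlap[of U H.nonzero W] that unfolding piece_def C_def by auto
  have "pieces h x n r = components (piece r H.nonzero)"
    unfolding pieces_def surface_ball[OF r]
    by (rule arg_cong[of _ _ components]) (auto simp: piece_def piece_height)
  also have "\<dots> = piece r ` C"
  proof (rule components_eq_family)
    show "piece r H.nonzero = \<Union>(piece r ` C)"
    proof -
      have "piece r (\<Union>C) = \<Union>(piece r ` C)" unfolding piece_def by blast
      then show ?thesis using Union_components[of H.nonzero] by (simp add: C_def)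
    qed
    show "U \<inter> W = {}" if "U \<in> piece r ` C" "W \<in> piece r ` C" "U \<noteq> W" for U W
      using that disj by blast
    show "U \<noteq> {}" if "U \<in> piece r ` C" for U using that ne by blast
    show "connected P" if P: "P \<in> piece r ` C" for P
    proof -
      obtain U where U: "U \<in> C" "P = piece r U" using P by blast
      \<comment> \<open>shrinks a cone into the neighborhood, since \<open>graph_norm\<close> is homogeneous\<close>
      define sh where "sh z = of_real (r / (1 + graph_norm z)) * z" for z
      have g: "0 \<le> graph_norm z" for z by (simp add: graph_norm_def)
      have "U \<inter> {z. graph_norm z < r} = sh ` U"
      proof (intro equalityI subsetI)
        fix z assume z: "z \<in> U \<inter> {z. graph_norm z < r}"
        define s where "s = 1 / (r - graph_norm z)"
        have s: "0 < s" using z by (simp add: s_def)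
        have "of_real s * z \<in> U" using H.component_cone U(1) z s unfolding C_def by blast
        moreover have "r / (1 + graph_norm (of_real s * z)) = 1 / s"
        proof -
          have "1 + graph_norm (of_real s * z) = r * s" using z graph_norm_homog[OF s, of z] by (simp add: s_def field_simps)
          then show ?thesis using r by simp
        qed
        then have "z = sh (of_real s * z)" using s by (simp add: sh_def)
        ultimately show "z \<in> sh ` U" by blast
      next
        fix y assume "y \<in> sh ` U"
        then obtain z where z: "z \<in> U" "y = sh z" by blast
        have p: "0 < r / (1 + graph_norm z)" using r g[of z] by (simp add: add_pos_nonneg)
        have "graph_norm y = r * (graph_norm z / (1 + graph_norm z))" using graph_norm_homog[OF p, of z] z by (simp add: sh_def)
        also have "\<dots> < r * 1" using r g[of z] by (intro mult_strict_left_mono) (auto simp: field_simps)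
        finally have "graph_norm y < r" by simp
        then show "y \<in> U \<inter> {z. graph_norm z < r}" using H.component_cone[OF _ z(1) p] U z unfolding C_def sh_def by simp
      qed
      then have P: "P = (\<lambda>z. (x + z, h x + l z)) ` sh ` U" using U by (simp add: piece_def)
      have lc: "continuous_on T l" for T using l_cont continuous_on_subset by blast
      have "continuous_on U sh" unfolding sh_def graph_norm_def
        by (intro continuous_intros lc) (use norm_ge_zero in \<open>smt (verit)\<close>)
      then show "connected P" unfolding P using U(1) in_components_connected unfolding C_def
        by (intro connected_continuous_image continuous_intros lc) auto
    qed
    show "openin (top_of_set (piece r H.nonzero)) P" if P: "P \<in> piece r ` C" for P
    proof -
      obtain U where U: "U \<in> C" "P = piece r U" using P by blast
      have "open U" using U(1) H.open_nonzero open_components unfolding C_def by blast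
      then have "open ((\<lambda>X :: complex \<times> real. fst X - x) -` U)"
        by (intro open_vimage continuous_intros)
      moreover have "U \<subseteq> H.nonzero" using U(1) in_components_subset unfolding C_def by blast
      then have "P = piece r H.nonzero \<inter> ((\<lambda>X. fst X - x) -` U)" unfolding U piece_def by force
      ultimately show ?thesis by (auto simp: openin_open_Int)
    qed
  qed
  finally show "pieces h x n r = piece r ` components {z. height n z \<noteq> 0}" by (simp add: C_def)
  show "inj_on (piece r) (components {z. height n z \<noteq> 0})"
    using disj ne unfolding C_def by (intro inj_onI) (metis inf.idem)
qed

lemma eventually_small: "\<forall>\<^sub>F r in at_right 0. 0 < r \<and> r \<le> \<rho>"
  by (rule eventually_at_rightI[of 0 \<rho>]) (use \<rho> in auto)

lemma cuts_into_components:
  assumes "finite (components {z. height n z \<noteq> 0})"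
  shows "cuts_into h x n (card (components {z. height n z \<noteq> 0}))"
  unfolding cuts_into_def using eventually_small
  by eventually_elim (use assms in \<open>simp add: pieces_eq card_image[OF pieces_eq(2)]\<close>)

end

section \<open>Zeros, pieces and saddles\<close>

text \<open>Each sign change between consecutive sample points forces a zero of its own between them.\<close>

lemma card_sign_changes:
  fixes g :: "real \<Rightarrow> real" and u :: "nat \<Rightarrow> real"
  assumes "continuous_on UNIV g" and u: "\<And>i. i < N \<Longrightarrow> u i < u (Suc i)"
    and fin: "finite {\<theta>. u 0 \<le> \<theta> \<and> \<theta> < u N \<and> g \<theta> = 0}"
  shows "card {i. i < N \<and> g (u i) * g (u (Suc i)) < 0} \<le> card {\<theta>. u 0 \<le> \<theta> \<and> \<theta> < u N \<and> g \<theta> = 0}"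
proof -
  define A where "A = {i. i < N \<and> g (u i) * g (u (Suc i)) < 0}"
  have mono: "u i \<le> u j" if "i \<le> j" "j \<le> N" for i j
    by (rule increasing_steps_mono[of N u]) (use u that in auto)
  have "\<exists>y. u i < y \<and> y < u (Suc i) \<and> g y = 0" if i: "i \<in> A" for i
  proof -
    have lt: "u i < u (Suc i)" using u i by (simp add: A_def)
    have s: "g (u i) < 0 \<and> 0 < g (u (Suc i)) \<or> 0 < g (u i) \<and> g (u (Suc i)) < 0"
      using i by (auto simp: A_def mult_less_0_iff)
    have c: "continuous_on {u i..u (Suc i)} g" using assms(1) continuous_on_subset by blast
    obtain y where y: "u i \<le> y" "y \<le> u (Suc i)" "g y = 0"
    proof (cases "g (u i) < 0")
      case True
      then show ?thesis using IVT'[of g "u i" 0 "u (Suc i)"] s lt c that by auto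
    next
      case False
      then show ?thesis using IVT2'[of g "u (Suc i)" 0 "u i"] s lt c that by auto
    qed
    moreover have "y \<noteq> u i" "y \<noteq> u (Suc i)" using y(3) s by auto
    ultimately show ?thesis by (intro exI[of _ y]) auto
  qed
  then obtain y where y: "\<And>i. i \<in> A \<Longrightarrow> u i < y i \<and> y i < u (Suc i) \<and> g (y i) = 0" by metis
  have "y i < y j" if "i \<in> A" "j \<in> A" "i < j" for i j
    using y[OF that(1)] y[OF that(2)] mono[of "Suc i" j] that by (simp add: A_def)
  then have "inj_on y A" by (intro inj_onI) (metis less_irrefl linorder_neqE_nat)
  moreover have "y ` A \<subseteq> {\<theta>. u 0 \<le> \<theta> \<and> \<theta> < u N \<and> g \<theta> = 0}"
  proof
    fix b assume "b \<in> y ` A"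
    then obtain i where i: "i \<in> A" "b = y i" by auto
    then have "u 0 \<le> u i" "u (Suc i) \<le> u N" using mono by (auto simp: A_def)
    then show "b \<in> {\<theta>. u 0 \<le> \<theta> \<and> \<theta> < u N \<and> g \<theta> = 0}" using y[OF i(1)] i by auto
  qed
  ultimately show ?thesis unfolding A_def[symmetric] using card_inj_on_le fin by blast
qed

context cone_point begin

definition zeros :: "complex \<Rightarrow> real \<Rightarrow> real set" where
  "zeros q a = {\<theta>. a \<le> \<theta> \<and> \<theta> < a + 2 * pi \<and> l (cis \<theta>) = q \<bullet> cis \<theta>}"

text \<open>The sign at \<open>\<theta>\<close> is governed by the parity of the number of zeros before \<open>\<theta>\<close>. Sign changes are
  expressed without derivatives because \<open>l\<close> is only piecewise smooth on the circle.\<close>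

definition alternating :: "complex \<Rightarrow> real \<Rightarrow> bool" where
  "alternating q a \<longleftrightarrow> finite (zeros q a) \<and> even (card (zeros q a)) \<and>
     (\<exists>m::int. \<forall>\<theta>. a \<le> \<theta> \<and> \<theta> \<le> a + 2 * pi \<longrightarrow>
        (even (int (card (zeros q a \<inter> {..<\<theta>})) + m) \<longrightarrow> q \<bullet> cis \<theta> \<le> l (cis \<theta>)) \<and>
        (odd (int (card (zeros q a \<inter> {..<\<theta>})) + m) \<longrightarrow> l (cis \<theta>) \<le> q \<bullet> cis \<theta>))"

lemma height_zero_iff: "height (q, -1) z = 0 \<longleftrightarrow> l z = q \<bullet> z"
  by (auto simp: height_def)

text \<open>The zeros of one period in increasing order, closed up by repeating the first one a period later.\<close>

lemma enumerate_zeros: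
  assumes fin: "finite (zeros q a)" and k: "k = card (zeros q a)" "0 < k"
  obtains z where "\<And>i. i < k \<Longrightarrow> z i < z (Suc i)" "z k = z 0 + 2 * pi"
    "\<And>i. i \<le> k \<Longrightarrow> height (q, -1) (cis (z i)) = 0"
    "\<And>i \<theta>. \<lbrakk>i < k; z i < \<theta>; \<theta> < z (Suc i)\<rbrakk> \<Longrightarrow> height (q, -1) (cis \<theta>) \<noteq> 0"
    "zeros q a = z ` {..<k}" "inj_on z {..<k}" "a \<le> z 0" "z (k - 1) < a + 2 * pi"
proof -
  obtain y where y: "\<And>i j. \<lbrakk>i < j; j < k\<rbrakk> \<Longrightarrow> y i < y j" "zeros q a = y ` {..<k}"
    using enumerate_increasing[OF fin] k by metis
  define z where "z i = (if i < k then y i else y 0 + 2 * pi)" for i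
  have mem: "y i \<in> zeros q a" if "i < k" for i using y(2) that by auto
  have 1: "z i < z (Suc i)" if "i < k" for i
  proof (cases "Suc i < k")
    case True then show ?thesis using y(1) by (simp add: z_def)
  next
    case False
    then show ?thesis using mem[of i] mem[of 0] that k by (auto simp: z_def zeros_def)
  qed
  have 2: "z k = z 0 + 2 * pi" using k by (simp add: z_def)
  have 3: "height (q, -1) (cis (z i)) = 0" if "i \<le> k" for i
    using mem[of i] mem[of 0] k by (auto simp: z_def height_zero_iff zeros_def cis_add_2pi)
  have mono: "y i \<le> y j" if "i \<le> j" "j < k" for i j using y(1)[of i j] that by (cases "i = j") auto
  have 4: "height (q, -1) (cis \<theta>) \<noteq> 0" if i: "i < k" "z i < \<theta>" "\<theta> < z (Suc i)" for i \<theta>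
  proof
    assume "height (q, -1) (cis \<theta>) = 0"
    then have e: "l (cis \<theta>) = q \<bullet> cis \<theta>" by (simp add: height_zero_iff)
    show False
    proof (cases "\<theta> < a + 2 * pi")
      case True
      have "a \<le> \<theta>" using mem[OF i(1)] i by (simp add: z_def zeros_def)
      then have "\<theta> \<in> zeros q a" using e True by (simp add: zeros_def)
      then obtain j where j: "j < k" "\<theta> = y j" using y(2) by auto
      have "i < j" using mono[of j i] j i by (force simp: z_def)
      then have "Suc i < k" "z (Suc i) \<le> y j" using mono[of "Suc i" j] j by (auto simp: z_def)
      then show False using j i by simp
    next
      case False
      have "z (Suc i) \<le> y 0 + 2 * pi" using i mem[of "Suc i"] mem[of 0] k by (auto simp: z_def zeros_def)
      then have b: "\<theta> - 2 * pi < y 0" using i by simp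
      then have "\<theta> - 2 * pi \<in> zeros q a" using e False mem[of 0] k by (auto simp: zeros_def cis_add_2pi)
      then obtain j where j: "j < k" "\<theta> - 2 * pi = y j" using y(2) by auto
      then show False using b mono[of 0 j] by simp
    qed
  qed
  have 5: "zeros q a = z ` {..<k}" unfolding y(2) by (rule image_cong) (auto simp: z_def)
  have 6: "inj_on z {..<k}"
  proof (rule inj_onI)
    fix i j assume "i \<in> {..<k}" "j \<in> {..<k}" "z i = z j"
    then show "i = j" using y(1)[of i j] y(1)[of j i] by (cases i j rule: linorder_cases) (auto simp: z_def)
  qed
  show ?thesis
    by (rule that[OF 1 2 3 4 5 6]) (use k mem[of 0] mem[of "k - 1"] in \<open>auto simp: z_def zeros_def\<close>)
qed

lemma cuts_into_zeros:
  assumes "finite (zeros q a)" "0 < card (zeros q a)"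
  shows "cuts_into h x (q, -1) (card (zeros q a))"
proof -
  interpret H: homogeneous "height (q, -1)" by (rule homogeneous_height)
  define k where "k = card (zeros q a)"
  obtain z where z: "\<And>i. i < k \<Longrightarrow> z i < z (Suc i)" "z k = z 0 + 2 * pi"
    "\<And>i. i \<le> k \<Longrightarrow> height (q, -1) (cis (z i)) = 0"
    "\<And>i \<theta>. \<lbrakk>i < k; z i < \<theta>; \<theta> < z (Suc i)\<rbrakk> \<Longrightarrow> height (q, -1) (cis \<theta>) \<noteq> 0"
    "zeros q a = z ` {..<k}" "inj_on z {..<k}" "a \<le> z 0" "z (k - 1) < a + 2 * pi"
    using enumerate_zeros[OF assms(1) k_def] assms(2) unfolding k_def by metis
  have k0: "0 < k" using assms by (simp add: k_def)
  have c: "components H.nonzero = (\<lambda>i. arc_cone (z i) (z (Suc i))) ` {..<k}" "inj_on (\<lambda>i. arc_cone (z i) (z (Suc i))) {..<k}"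
    by (rule H.components_arcs[OF k0 z(1,2,3)], assumption+, rule z(4), assumption+)+
  have "card (components H.nonzero) = k" unfolding c(1) using card_image[OF c(2)] by simp
  moreover have "finite (components H.nonzero)" unfolding c(1) by simp
  ultimately show ?thesis using cuts_into_components[of "(q, -1)"] by (simp add: k_def)
qed

text \<open>The four pieces lie over the sectors between consecutive zeros. One sample direction per sector
  determines the sign on the whole sector, and a common radius makes all samples fall into the
  neighborhood.\<close>

lemma saddle_from_arcs:
  assumes z: "\<And>i::nat. i < 4 \<Longrightarrow> z i < z (Suc i)" "z 4 = z 0 + 2 * pi"
    "\<And>i. i \<le> 4 \<Longrightarrow> height (q, -1) (cis (z i)) = 0"
    "\<And>i \<theta>. \<lbrakk>i < 4; z i < \<theta>; \<theta> < z (Suc i)\<rbrakk> \<Longrightarrow> height (q, -1) (cis \<theta>) \<noteq> 0"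
    and t: "\<And>i. i < 4 \<Longrightarrow> z i < t i \<and> t i < z (Suc i)"
    and sgn: "\<And>i. i < 4 \<Longrightarrow> if even i then height (q, -1) (cis (t i)) < 0 else 0 < height (q, -1) (cis (t i))"
  shows "cuts_saddle h x q"
proof -
  interpret H: homogeneous "height (q, -1)" by (rule homogeneous_height)
  define A where "A i = arc_cone (z i) (z (Suc i))" for i
  have k0: "(0::nat) < 4" by simp
  have comp: "components H.nonzero = A ` {..<4}" "inj_on A {..<4}"
    unfolding A_def[abs_def] by (rule H.components_arcs[OF k0 z(1,2,3)], assumption+, rule z(4), assumption+)+
  have tA: "of_real s * cis (t i) \<in> A i" if "0 < s" "i < 4" for i s
    unfolding A_def arc_cone_iff using t[OF that(2)] that(1) by blast
  have tA1: "cis (t i) \<in> A i" if "i < 4" for i using tA[of 1 i] that by simp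
  have AC: "A i \<in> components H.nonzero" if "i < 4" for i using comp(1) that by auto
  have below: "piece r (A i) \<subseteq> below_plane q (x, h x)" if "i < 4" "odd i" for i r
  proof -
    have "q \<bullet> w > l w" if "w \<in> A i" for w
      using H.sign_on_component[OF AC[OF \<open>i < 4\<close>] tA1[OF \<open>i < 4\<close>] that] sgn[OF \<open>i < 4\<close>] \<open>odd i\<close>
      by (auto simp: zero_less_mult_iff height_def)
    then show ?thesis by (auto simp: piece_def below_plane_def)
  qed
  have above: "piece r (A i) \<subseteq> above_plane q (x, h x)" if "i < 4" "even i" for i r
  proof -
    have "q \<bullet> w < l w" if "w \<in> A i" for w
      using H.sign_on_component[OF AC[OF \<open>i < 4\<close>] tA1[OF \<open>i < 4\<close>] that] sgn[OF \<open>i < 4\<close>] \<open>even i\<close>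
      by (auto simp: zero_less_mult_iff height_def)
    then show ?thesis by (auto simp: piece_def above_plane_def)
  qed
  have set4: "{..<4::nat} = {0, 1, 2, 3}" by auto
  show ?thesis unfolding cuts_saddle_def using eventually_small
  proof eventually_elim
    case r: (elim r)
    have P: "pieces h x (q, -1) r = {piece r (A 0), piece r (A 1), piece r (A 2), piece r (A 3)}"
      unfolding pieces_eq(1)[OF conjunct1[OF r] conjunct2[OF r]] comp(1) set4 by simp
    have "inj_on (piece r \<circ> A) {..<4}"
      using comp(2) pieces_eq(2)[OF conjunct1[OF r] conjunct2[OF r], of "(q, -1)"] unfolding comp(1)
      by (intro comp_inj_on) auto
    then have dist: "distinct [piece r (A 0), piece r (A 1), piece r (A 2), piece r (A 3)]"
      unfolding inj_on_def set4 by simp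
    define s where "s = r / (2 * (1 + (\<Sum>i<4. graph_norm (cis (t i)))))"
    have g: "0 \<le> graph_norm (cis (t i))" for i by (simp add: graph_norm_def)
    then have S: "0 \<le> (\<Sum>i<4. graph_norm (cis (t i)))" by (intro sum_nonneg) auto
    then have s0: "0 < s" using r by (simp add: s_def add_pos_nonneg)
    have in_piece: "(x + s *\<^sub>R cis (t i), h (x + s *\<^sub>R cis (t i))) \<in> piece r (A i)" if i: "i < 4" for i
    proof -
      have "graph_norm (cis (t i)) \<le> (\<Sum>i<4. graph_norm (cis (t i)))" using i g by (intro member_le_sum) auto
      then have "s * graph_norm (cis (t i)) \<le> s * (\<Sum>i<4. graph_norm (cis (t i)))" using s0 by (intro mult_left_mono) auto
      also have "\<dots> < r" using r S unfolding s_def by (simp add: field_simps add_pos_nonneg)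
      finally have "graph_norm (of_real s * cis (t i)) < r" using graph_norm_homog[OF s0] by simp
      moreover from this have "norm (of_real s * cis (t i)) < \<rho>" using norm_le_graph_norm[of "of_real s * cis (t i)"] r by simp
      ultimately show ?thesis unfolding piece_def scaleR_conv_of_real using tA[OF s0 i] local_form by auto
    qed
    have lt: "t 0 < t 1" "t 1 < t 2" "t 2 < t 3" "t 3 < t 0 + 2 * pi"
      using t[of 0] t[of 1] t[of 2] t[of 3] z(2) by (auto simp: numeral_eq_Suc)
    have pts: "\<exists>s t\<^sub>0 t\<^sub>1 t\<^sub>2 t\<^sub>3.
           s > 0 \<and> t\<^sub>0 < t\<^sub>1 \<and> t\<^sub>1 < t\<^sub>2 \<and> t\<^sub>2 < t\<^sub>3 \<and> t\<^sub>3 < t\<^sub>0 + 2 * pi \<and>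
           (x + s *\<^sub>R cis t\<^sub>0, h (x + s *\<^sub>R cis t\<^sub>0)) \<in> piece r (A 0) \<and>
           (x + s *\<^sub>R cis t\<^sub>1, h (x + s *\<^sub>R cis t\<^sub>1)) \<in> piece r (A 1) \<and>
           (x + s *\<^sub>R cis t\<^sub>2, h (x + s *\<^sub>R cis t\<^sub>2)) \<in> piece r (A 2) \<and>
           (x + s *\<^sub>R cis t\<^sub>3, h (x + s *\<^sub>R cis t\<^sub>3)) \<in> piece r (A 3)"
      by (rule exI[of _ s], rule exI[of _ "t 0"], rule exI[of _ "t 1"], rule exI[of _ "t 2"], rule exI[of _ "t 3"])
        (use lt s0 in_piece in auto)
    show ?case
      by (rule exI[of _ "piece r (A 0)"], rule exI[of _ "piece r (A 1)"], rule exI[of _ "piece r (A 2)"],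
          rule exI[of _ "piece r (A 3)"]) (intro conjI dist P above below pts; simp)
  qed
qed

lemma card_zeros_below:
  assumes "zeros q a = z ` {..<k}" "inj_on z {..<k}" "\<And>i. i < k \<Longrightarrow> z i < z (Suc i)"
    "j < k" "z j < \<theta>" "\<theta> < z (Suc j)"
  shows "card (zeros q a \<inter> {..<\<theta>}) = Suc j"
proof -
  have mono: "z i \<le> z i'" if "i \<le> i'" "i' \<le> k" for i i'
    by (rule increasing_steps_mono[of k z]) (use assms(3) that in auto)
  have "zeros q a \<inter> {..<\<theta>} = z ` {..j}"
  proof (intro equalityI subsetI)
    fix y assume "y \<in> zeros q a \<inter> {..<\<theta>}"
    then obtain i where i: "i < k" "y = z i" "z i < \<theta>" using assms(1) by auto
    then have "i \<le> j" using mono[of "Suc j" i] assms by (cases "i \<le> j") auto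
    then show "y \<in> z ` {..j}" using i by blast
  next
    fix y assume "y \<in> z ` {..j}"
    then obtain i where i: "i \<le> j" "y = z i" by auto
    then have "z i \<le> z j" "i < k" using mono assms by auto
    then show "y \<in> zeros q a \<inter> {..<\<theta>}" using i assms by auto
  qed
  moreover have "inj_on z {..j}" using assms by (intro inj_on_subset[OF assms(2)]) auto
  ultimately show ?thesis by (simp add: card_image)
qed

text \<open>By alternation, consecutive sectors have opposite signs. If the first sector is below the plane,
  the enumeration is shifted by one zero.\<close>

lemma alternating_saddle:
  assumes "alternating q a" "card (zeros q a) = 4"
  shows "cuts_saddle h x q"
proof -
  define F where "F \<theta> = height (q, -1) (cis \<theta>)" for \<theta>
  have per: "F (\<theta> + 2 * pi) = F \<theta>" for \<theta> by (simp add: F_def cis_add_2pi)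
  have fin: "finite (zeros q a)" using assms by (simp add: alternating_def)
  obtain z where z: "\<And>i. i < 4 \<Longrightarrow> z i < z (Suc i)" "z 4 = z 0 + 2 * pi"
    "\<And>i. i \<le> 4 \<Longrightarrow> height (q, -1) (cis (z i)) = 0"
    "\<And>i \<theta>. \<lbrakk>i < 4; z i < \<theta>; \<theta> < z (Suc i)\<rbrakk> \<Longrightarrow> height (q, -1) (cis \<theta>) \<noteq> 0"
    "zeros q a = z ` {..<4}" "inj_on z {..<4}" "a \<le> z 0" "z (4 - 1) < a + 2 * pi"
    using enumerate_zeros[OF fin, of 4] assms(2) by (metis zero_less_numeral)
  obtain m :: int where m: "\<And>\<theta>. \<lbrakk>a \<le> \<theta>; \<theta> \<le> a + 2 * pi\<rbrakk> \<Longrightarrow>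
        (even (int (card (zeros q a \<inter> {..<\<theta>})) + m) \<longrightarrow> F \<theta> \<le> 0) \<and>
        (odd (int (card (zeros q a \<inter> {..<\<theta>})) + m) \<longrightarrow> 0 \<le> F \<theta>)"
    using assms(1) unfolding alternating_def F_def height_def by auto
  \<comment> \<open>sample directions between consecutive zeros; the last one must stay in the period that starts at \<open>a\<close>\<close>
  define t where "t i = (z i + min (z (Suc i)) (a + 2 * pi)) / 2" for i
  have up: "z i \<le> z 3" and lo: "z 0 \<le> z i" if "i < 4" for i
    by (rule increasing_steps_mono[of 4 z], use z(1) that in auto)+
  have t: "z i < t i \<and> t i < z (Suc i) \<and> a \<le> t i \<and> t i \<le> a + 2 * pi" if "i < 4" for i
    using up[OF that] lo[OF that] z(1)[OF that] z(7,8) unfolding t_def by (auto simp: min_def field_simps)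
  have sg: "(even (int (Suc i) + m) \<longrightarrow> F (t i) < 0) \<and> (odd (int (Suc i) + m) \<longrightarrow> 0 < F (t i))" if i: "i < 4" for i
    using m[of "t i"] card_zeros_below[OF z(5,6,1) i, of "t i"] t[OF i] z(4)[OF i, of "t i"] unfolding F_def
    by (auto simp: less_le)
  show ?thesis
  proof (cases "odd m")
    case True
    show ?thesis
    proof (rule saddle_from_arcs[of z q t])
      show "if even i then height (q, - 1) (cis (t i)) < 0 else 0 < height (q, - 1) (cis (t i))" if "i < 4" for i
        using sg[OF that] True by (auto simp: F_def)
    qed (use z t in auto)
  next
    case False
    define z' where "z' i = (if i < 4 then z (Suc i) else z 1 + 2 * pi)" for i
    define t' where "t' i = (if i < 3 then t (Suc i) else t 0 + 2 * pi)" for i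
    show ?thesis
    proof (rule saddle_from_arcs[of z' q t'])
      show "z' i < z' (Suc i)" if "i < 4" for i
        using z(1)[of "Suc i"] z(1)[of 0] z(2) that by (cases "i = 3") (auto simp: z'_def numeral_eq_Suc)
      show "z' 4 = z' 0 + 2 * pi" by (simp add: z'_def)
      show "height (q, -1) (cis (z' i)) = 0" if "i \<le> 4" for i
        using z(3)[of "Suc i"] z(3)[of 1] that by (auto simp: z'_def cis_add_2pi)
      show "height (q, -1) (cis \<theta>) \<noteq> 0" if "i < 4" "z' i < \<theta>" "\<theta> < z' (Suc i)" for i \<theta>
      proof (cases "i = 3")
        case True
        then have "z 0 < \<theta> - 2 * pi" "\<theta> - 2 * pi < z (Suc 0)" using that z(2) by (auto simp: z'_def numeral_eq_Suc)
        then show ?thesis using z(4)[of 0 "\<theta> - 2 * pi"] by (simp add: cis_add_2pi)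
      next
        case False
        then show ?thesis using z(4)[of "Suc i" \<theta>] that by (auto simp: z'_def)
      qed
      show "z' i < t' i \<and> t' i < z' (Suc i)" if "i < 4" for i
        using t[of "Suc i"] t[of 0] z(2) that by (cases "i = 3") (auto simp: z'_def t'_def numeral_eq_Suc)
      show "if even i then height (q, - 1) (cis (t' i)) < 0 else 0 < height (q, - 1) (cis (t' i))" if "i < 4" for i
        using sg[of "Suc i"] sg[of 0] that False by (cases "i = 3") (auto simp: F_def t'_def cis_add_2pi)
    qed
  qed
qed

text \<open>If the cone stays weakly below the plane, a zero would be a sign change with a strictly positive
  side. As the number of zeros in a period is even, a zero is accompanied by a second one, and the sectors after
  the first and after the second have opposite signs.\<close>

lemma alternating_touches_no_plane:
  assumes "alternating q a" "\<And>\<theta>. l (cis \<theta>) \<le> q \<bullet> cis \<theta>"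
  shows "zeros q a = {}"
proof (rule ccontr)
  assume ne: "zeros q a \<noteq> {}"
  define k where "k = card (zeros q a)"
  have fin: "finite (zeros q a)" using assms by (simp add: alternating_def)
  then have k0: "0 < k" using ne by (simp add: k_def card_gt_0_iff)
  obtain z where z: "\<And>i. i < k \<Longrightarrow> z i < z (Suc i)" "z k = z 0 + 2 * pi"
    "\<And>i. i \<le> k \<Longrightarrow> height (q, -1) (cis (z i)) = 0"
    "\<And>i \<theta>. \<lbrakk>i < k; z i < \<theta>; \<theta> < z (Suc i)\<rbrakk> \<Longrightarrow> height (q, -1) (cis \<theta>) \<noteq> 0"
    "zeros q a = z ` {..<k}" "inj_on z {..<k}" "a \<le> z 0" "z (k - 1) < a + 2 * pi"
    using enumerate_zeros[OF fin k_def k0] by metis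
  obtain m :: int where m: "\<And>\<theta>. \<lbrakk>a \<le> \<theta>; \<theta> \<le> a + 2 * pi\<rbrakk> \<Longrightarrow>
        (even (int (card (zeros q a \<inter> {..<\<theta>})) + m) \<longrightarrow> q \<bullet> cis \<theta> \<le> l (cis \<theta>))"
    using assms(1) unfolding alternating_def by auto
  have odd: "odd (int (card (zeros q a \<inter> {..<\<theta>})) + m)" 
    if "a \<le> \<theta>" "\<theta> \<le> a + 2 * pi" "height (q, -1) (cis \<theta>) \<noteq> 0" for \<theta>
    using m[of \<theta>] assms(2)[of \<theta>] that by (auto simp: height_zero_iff)
  have "even k" using assms(1) by (simp add: k_def alternating_def)
  then have k2: "1 < k" using k0 by (cases "k = 1") auto
  define t where "t i = (z i + min (z (Suc i)) (a + 2 * pi)) / 2" for i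
  have ev: "a \<le> z i" "z i < a + 2 * pi" if "i < k" for i
    using z(5) that by (auto simp: zeros_def)
  have t: "z i < t i \<and> t i < z (Suc i) \<and> a \<le> t i \<and> t i \<le> a + 2 * pi" if "i < k" for i
    using ev[OF that] z(1)[OF that] unfolding t_def by (auto simp: min_def field_simps)
  have "odd (int (Suc i) + m)" if "i < k" for i
    using odd[of "t i"] card_zeros_below[OF z(5,6,1) that, of "t i"] t[OF that] z(4)[OF that, of "t i"] by auto
  from this[of 0] this[of 1] k2 show False by auto
qed

text \<open>Suppose that there are five components. Pick a direction \<open>X i\<close> in each, in cyclic order, and a zero \<open>w i\<close>
  between any two neighbors; the heights at the \<open>X i\<close> are nonzero. A vertical plane is ruled out because its height is a
  cosine with only two zeros in a period. Otherwise change the gradient by \<open>e\<close> or by \<open>-e\<close>, with \<open>e\<close> small and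
  general. This keeps the signs at the \<open>X i\<close> and gives opposite signs at each \<open>w i\<close> for the two
  choices. Hence each of the ten steps \<open>X i\<close> to \<open>w i\<close> to \<open>X (i + 1)\<close> is a sign change for one of the
  two choices, and one choice has at least five sign changes, hence five zeros.\<close>

lemma at_most_four_pieces:
  assumes B: "negligible B" and four: "\<And>q a. q \<notin> B \<Longrightarrow> finite (zeros q a) \<and> card (zeros q a) \<le> 4"
    and n: "n \<noteq> 0"
  shows "\<exists>k\<le>4. cuts_into h x n k"
proof -
  interpret H: homogeneous "height n" by (rule homogeneous_height)
  have "finite (components H.nonzero) \<and> card (components H.nonzero) \<le> 4"
  proof (rule ccontr)
    assume many: "\<not> (finite (components H.nonzero) \<and> card (components H.nonzero) \<le> 4)"
    then have "\<exists>\<C>\<subseteq>components H.nonzero. card \<C> = 5 \<and> finite \<C>"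
    proof (cases "finite (components H.nonzero)")
      case True
      with many have "5 \<le> card (components H.nonzero)" by simp
      then show ?thesis using obtain_subset_with_card_n[of 5 "components H.nonzero"] by metis
    next
      case False
      then show ?thesis using infinite_arbitrarily_large[of "components H.nonzero" 5] by metis
    qed
    then obtain \<C> where C: "\<C> \<subseteq> components H.nonzero" "card \<C> = 5" "finite \<C>" by blast
    have "\<exists>\<theta>. 0 \<le> \<theta> \<and> \<theta> < 2 * pi \<and> cis \<theta> \<in> U" if U: "U \<in> \<C>" for U
    proof -
      have UC: "U \<in> components H.nonzero" using U C by blast
      then obtain z where z: "z \<in> U" using in_components_nonempty by blast
      obtain s \<theta> where s: "0 \<le> s" "0 \<le> \<theta>" "\<theta> < 0 + 2 * pi" "z = of_real s * cis \<theta>"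
        using polar_in_period[of 0 z] by blast
      have "z \<noteq> 0" using z in_components_subset[OF UC] H.F_zero by auto
      then have s0: "0 < s" using s by (cases "s = 0") auto
      then have "of_real (1 / s) * z \<in> U" by (intro H.component_cone[OF UC z]) simp
      then show ?thesis using s s0 by (intro exI[of _ \<theta>]) auto
    qed
    then obtain ang where ang: "\<And>U. U \<in> \<C> \<Longrightarrow> 0 \<le> ang U \<and> ang U < 2 * pi \<and> cis (ang U) \<in> U" by metis
    have same: "U = W" if "U \<in> \<C>" "W \<in> \<C>" "u \<in> U" "u \<in> W" for U W u
      using components_nonoverlap[of U H.nonzero W] that C by blast
    have "inj_on ang \<C>" by (rule inj_onI) (metis ang same)
    then have c5: "card (ang ` \<C>) = 5" using C by (simp add: card_image)
    obtain y where y: "\<And>i j. \<lbrakk>i < j; j < 5\<rbrakk> \<Longrightarrow> y i < y j" "ang ` \<C> = y ` {..<5::nat}"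
      using enumerate_increasing[of "ang ` \<C>"] C(3) unfolding c5 by blast
    define X where "X i = (if i < 5 then y i else y 0 + 2 * pi)" for i :: nat
    have yU: "\<exists>U\<in>\<C>. y i = ang U" if "i < 5" for i using y(2) that by auto
    have yb: "0 \<le> y i" "y i < 2 * pi" if "i < 5" for i using yU[OF that] ang by auto
    have X1: "X i < X (Suc i)" if "i < 5" for i
      using y(1)[of i "Suc i"] yb[of i] yb[of 0] that by (auto simp: X_def)
    define F where "F \<theta> = height n (cis \<theta>)" for \<theta>
    have Fc: "continuous_on S F" for S unfolding F_def
      by (intro continuous_on_compose2[OF H.cont] continuous_intros) auto
    have gap: "\<exists>w. X i < w \<and> w < X (Suc i) \<and> F w = 0" if i: "i < 5" for i
    proof (rule ccontr)
      assume no: "\<not> ?thesis"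
      obtain U where U: "U \<in> \<C>" "y i = ang U" using yU[OF i] by blast
      define j where "j = (if i < 4 then Suc i else 0)"
      have j: "j < 5" "j \<noteq> i" "cis (X (Suc i)) = cis (y j)"
        using i by (auto simp: j_def X_def cis_add_2pi)
      obtain W where W: "W \<in> \<C>" "y j = ang W" using yU[OF j(1)] by blast
      have XU: "cis (X i) \<in> U" "cis (X (Suc i)) \<in> W" using U W ang i j by (auto simp: X_def)
      then have nzend: "F (X i) \<noteq> 0" "F (X (Suc i)) \<noteq> 0" using U W C in_components_subset unfolding F_def by blast+
      have nz: "F w \<noteq> 0" if "X i \<le> w" "w \<le> X (Suc i)" for w
        using no nzend that by (cases "w = X i \<or> w = X (Suc i)") auto
      define T where "T = cis ` {X i..X (Suc i)}"
      have "connected T" unfolding T_def by (intro connected_continuous_image continuous_intros) auto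
      moreover have "T \<subseteq> H.nonzero" using nz unfolding T_def F_def by auto
      moreover have Tend: "cis (X i) \<in> T" "cis (X (Suc i)) \<in> T" unfolding T_def using X1[OF i] by auto
      ultimately have "T \<subseteq> U" using components_maximal[of U H.nonzero T] U C XU by blast
      then have "U = W" using same U W XU Tend by blast
      then have "y i = y j" using U W by simp
      then show False using y(1)[of i j] y(1)[of j i] i j by (cases i j rule: linorder_cases) auto
    qed
    then obtain w where w: "\<And>i. i < 5 \<Longrightarrow> X i < w i \<and> w i < X (Suc i) \<and> F (w i) = 0" by metis
    have Fnz: "F (X i) \<noteq> 0" if "i \<le> 5" for i
    proof -
      have "F (y j) \<noteq> 0" if "j < 5" for j
        using yU[OF that] ang C in_components_subset unfolding F_def by fastforce
      moreover have "F (X i) = F (y (if i < 5 then i else 0))" by (auto simp: X_def F_def cis_add_2pi)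
      ultimately show ?thesis by simp
    qed
    have X5: "X 5 = X 0 + 2 * pi" by (simp add: X_def)
    have Xmono: "X i \<le> X j" if "i \<le> j" "j \<le> 5" for i j
      by (rule increasing_steps_mono[of 5 X]) (use X1 that in auto)
    have wX: "X 0 \<le> w i \<and> w i < X 0 + 2 * pi" if "i < 5" for i
      using w[OF that] Xmono[of 0 i] Xmono[of "Suc i" 5] that X5 by auto
    show False
    proof (cases "snd n = 0")
      case True
      then have n0: "fst n \<noteq> 0" using n by (auto simp: prod_eq_iff)
      define \<psi> where "\<psi> = Arg (fst n)"
      have "F \<theta> = norm (fst n) * cos (\<theta> - \<psi>)" for \<theta>
        using inner_polar[of "norm (fst n)" \<psi> \<theta>] rcis_cmod_Arg[of "fst n"]
        by (simp add: F_def height_def True \<psi>_def rcis_def)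
      then have sub: "w ` {..<5} \<subseteq> {\<theta>. X 0 \<le> \<theta> \<and> \<theta> < X 0 + 2 * pi \<and> cos (\<theta> - \<psi>) = 0}"
        using w wX n0 by auto
      have "w i < w j" if "i < j" "j < 5" for i j
        using w[of i] w[of j] Xmono[of "Suc i" j] that by auto
      then have "inj_on w {..<5}" by (intro inj_onI) (metis lessThan_iff less_irrefl linorder_neqE_nat)
      then have "card (w ` {..<5}) = 5" by (simp add: card_image)
      moreover have "card (w ` {..<5}) \<le> 2"
      proof -
        have "X 0 + 2 * pi - \<psi> = X 0 - \<psi> + of_int 2 * pi" by simp
        then have "int (card {\<theta>. X 0 \<le> \<theta> \<and> \<theta> < X 0 + 2 * pi \<and> cos (\<theta> - \<psi>) = 0}) = 2"
          using card_cos_zeros(2)[of "X 0" "X 0 + 2 * pi" \<psi>] by (simp only: half_period_add_pi) simp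
        then show ?thesis using card_mono[OF card_cos_zeros(1) sub] by simp
      qed
      ultimately show False by simp
    next
      case False
      define b where "b = snd n"
      \<comment> \<open>the gradient of the plane with normal \<open>n\<close>\<close>
      define q where "q = (- 1 / b) *\<^sub>R fst n"
      define G where "G e \<theta> = l (cis \<theta>) - (q + e) \<bullet> cis \<theta>" for e \<theta>
      have G0: "F \<theta> = b * G 0 \<theta>" for \<theta>
        using False by (simp add: F_def height_def G_def q_def b_def algebra_simps)
      have Ge: "G e \<theta> = G 0 \<theta> - e \<bullet> cis \<theta>" for e \<theta> by (simp add: G_def inner_add_left)
      define \<delta> where "\<delta> = Min ((\<lambda>i. \<bar>G 0 (X i)\<bar>) ` {..5})"
      have "G 0 (X i) \<noteq> 0" if "i \<le> 5" for i using Fnz[OF that] G0[of "X i"] by auto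
      then have \<delta>: "0 < \<delta>" unfolding \<delta>_def by (subst Min_gr_iff) auto
      have \<delta>': "\<delta> \<le> \<bar>G 0 (X i)\<bar>" if "i \<le> 5" for i unfolding \<delta>_def using that by (intro Min_le) auto
      have neg1: "negligible ((\<lambda>z. 2 * q - z) ` B)"
        by (rule negligible_differentiable_image_negligible[OF order_refl B])
          (intro differentiable_on_diff differentiable_on_const differentiable_on_ident)
      have "negligible (\<Union>i<5. {z. cis (w i) \<bullet> z = cis (w i) \<bullet> q})"
        by (intro negligible_Union) (auto intro: negligible_hyperplane)
      then have bad: "negligible (B \<union> (\<lambda>z. 2 * q - z) ` B \<union> (\<Union>i<5. {z. cis (w i) \<bullet> z = cis (w i) \<bullet> q}))"
        using B neg1 by simp
      have "\<not> negligible (ball q \<delta>)" using \<delta> open_not_negligible[of "ball q \<delta>"] by auto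
      then have "\<not> ball q \<delta> \<subseteq> B \<union> (\<lambda>z. 2 * q - z) ` B \<union> (\<Union>i<5. {z. cis (w i) \<bullet> z = cis (w i) \<bullet> q})"
        using negligible_subset[OF bad] by auto
      then obtain q' where q'': "q' \<in> ball q \<delta>"
        "q' \<notin> B \<union> (\<lambda>z. 2 * q - z) ` B \<union> (\<Union>i<5. {z. cis (w i) \<bullet> z = cis (w i) \<bullet> q})"
        unfolding subset_iff by blast
      have q': "q' \<in> ball q \<delta>" "q' \<notin> B" "q' \<notin> (\<lambda>z. 2 * q - z) ` B"
        "\<And>i. i < 5 \<Longrightarrow> cis (w i) \<bullet> q' \<noteq> cis (w i) \<bullet> q"
        using q'' by (simp_all only: Un_iff UN_iff de_Morgan_disj mem_Collect_eq lessThan_iff) auto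
      define e where "e = q' - q"
      have e: "norm e < \<delta>" "q + e \<notin> B" "q + (- e) \<notin> B" "\<And>i. i < 5 \<Longrightarrow> e \<bullet> cis (w i) \<noteq> 0"
      proof -
        show "norm e < \<delta>" using q'(1) by (simp add: e_def dist_norm norm_minus_commute)
        show "q + e \<notin> B" using q'(2) by (simp add: e_def)
        show "q + (- e) \<notin> B"
        proof
          assume "q + (- e) \<in> B"
          then have "2 * q - (q + (- e)) \<in> (\<lambda>z. 2 * q - z) ` B" by blast
          then show False using q'(3) by (simp add: e_def)
        qed
        show "e \<bullet> cis (w i) \<noteq> 0" if "i < 5" for i
          using q'(4)[OF that] by (simp add: e_def inner_diff_left inner_commute[of _ "cis (w i)"] inner_diff_right)
      qed
      define u where "u i = (if even i then X (i div 2) else w (i div 2))" for i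
      have u1: "u i < u (Suc i)" if "i < 10" for i
      proof (cases "even i")
        case True then show ?thesis using w[of "i div 2"] that by (auto simp: u_def elim!: evenE)
      next
        case False then show ?thesis using w[of "i div 2"] that by (auto simp: u_def elim!: oddE)
      qed
      have uend: "u 0 = X 0" "u 10 = X 0 + 2 * pi" by (simp_all add: u_def X5)
      have few: "card {i. i < 10 \<and> G e' (u i) * G e' (u (Suc i)) < 0} \<le> 4" if e': "q + e' \<notin> B" for e'
      proof -
        have Z: "{\<theta>. u 0 \<le> \<theta> \<and> \<theta> < u 10 \<and> G e' \<theta> = 0} = zeros (q + e') (X 0)"
          unfolding zeros_def uend by (auto simp: G_def)
        have "continuous_on UNIV (G e')" unfolding G_def
          by (intro continuous_intros continuous_on_compose2[OF l_cont]) auto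
        from card_sign_changes[of "G e'" 10 u, OF this u1]
        show ?thesis unfolding Z using four[OF e', of "X 0"] by auto
      qed
      have Xw: "G e (X i) * G e (w j) < 0 \<or> G (- e) (X i) * G (- e) (w j) < 0" if "i \<le> 5" "j < 5" for i j
      proof -
        have "\<bar>e \<bullet> cis (X i)\<bar> < \<bar>G 0 (X i)\<bar>"
          using Cauchy_Schwarz_ineq2[of e "cis (X i)"] e(1) \<delta>'[OF that(1)] by simp
        then have "0 < G e (X i) \<and> 0 < G (- e) (X i) \<or> G e (X i) < 0 \<and> G (- e) (X i) < 0"
          by (simp add: Ge[of e] Ge[of "- e"]) linarith
        moreover have "G 0 (w j) = 0" using w[OF that(2)] G0[of "w j"] False by (simp add: b_def)
        then have "G e (w j) = - (e \<bullet> cis (w j))" "G (- e) (w j) = e \<bullet> cis (w j)"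
          by (simp_all add: Ge[of e] Ge[of "- e"])
        ultimately show ?thesis using e(4)[OF that(2)]
          by (cases "0 < e \<bullet> cis (w j)") (auto simp: mult_less_0_iff zero_less_mult_iff)
      qed
      have "{..<10} \<subseteq> {i. i < 10 \<and> G e (u i) * G e (u (Suc i)) < 0} \<union> {i. i < 10 \<and> G (- e) (u i) * G (- e) (u (Suc i)) < 0}"
      proof
        fix i :: nat assume "i \<in> {..<10}"
        then have i: "i < 10" by simp
        have "G e (u i) * G e (u (Suc i)) < 0 \<or> G (- e) (u i) * G (- e) (u (Suc i)) < 0"
        proof (cases "even i")
          case True then show ?thesis using Xw[of "i div 2" "i div 2"] i by (auto simp: u_def elim!: evenE)
        next
          case False then show ?thesis using Xw[of "Suc (i div 2)" "i div 2"] i by (auto simp: u_def mult.commute elim!: oddE)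
        qed
        then show "i \<in> {i. i < 10 \<and> G e (u i) * G e (u (Suc i)) < 0} \<union> {i. i < 10 \<and> G (- e) (u i) * G (- e) (u (Suc i)) < 0}"
          using i by blast
      qed
      then have "card {..<10::nat} \<le> card ({i. i < 10 \<and> G e (u i) * G e (u (Suc i)) < 0} \<union> {i. i < 10 \<and> G (- e) (u i) * G (- e) (u (Suc i)) < 0})"
        by (intro card_mono) auto
      also have "\<dots> \<le> 4 + 4"
        by (rule order_trans[OF card_Un_le add_mono[OF few[OF e(2)] few[OF e(3)]]])
      finally show False by simp
    qed
  qed
  then show ?thesis using cuts_into_components by blast
qed

text \<open>Independently of where the period begins, the zeros correspond to the unit vectors of height zero.\<close>

lemma card_zeros_shift:
  assumes "finite (zeros q a)"
  shows "finite (zeros q b)" "card (zeros q b) = card (zeros q a)"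
proof -
  have im: "cis ` zeros q c = {u. norm u = 1 \<and> l u = q \<bullet> u}" for c
  proof (intro equalityI subsetI)
    fix u assume u: "u \<in> {u. norm u = 1 \<and> l u = q \<bullet> u}"
    obtain s \<eta> where s: "0 \<le> s" "c \<le> \<eta>" "\<eta> < c + 2 * pi" "u = of_real s * cis \<eta>"
      using polar_in_period[of c u] by blast
    have "s = 1" using s(1) u arg_cong[OF s(4), of norm] unfolding norm_mult by simp
    then show "u \<in> cis ` zeros q c" using s u by (auto simp: zeros_def)
  qed (auto simp: zeros_def)
  have inj: "inj_on cis (zeros q c)" for c
  proof (rule inj_onI)
    fix y z assume "y \<in> zeros q c" "z \<in> zeros q c" "cis y = cis z"
    then show "y = z" using polar_unique[of 1 y 1 z] by (auto simp: zeros_def)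
  qed
  show "finite (zeros q b)"
    using finite_imageD[OF _ inj[of b]] finite_imageI[OF assms, of cis] im[of a] im[of b] by simp
  show "card (zeros q b) = card (zeros q a)"
    using card_image[OF inj[of a]] card_image[OF inj[of b]] im[of a] im[of b] by simp
qed

lemma lies_below_if:
  assumes "\<And>\<theta>. l (cis \<theta>) < q \<bullet> cis \<theta>"
  shows "lies_below h x q"
  unfolding lies_below_def using eventually_small
proof eventually_elim
  fix r :: real assume r: "0 < r \<and> r \<le> \<rho>"
  have "l z < q \<bullet> z" if "z \<noteq> 0" for z
  proof -
    have "z = of_real (norm z) * cis (Arg z)" using rcis_cmod_Arg[of z] by (simp add: rcis_def)
    then have "l z = norm z * l (cis (Arg z))" "q \<bullet> z = norm z * (q \<bullet> cis (Arg z))"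
      using l_homog[of "norm z" "cis (Arg z)"] that
      by (simp, metis inner_scaleR_right scaleR_conv_of_real)
    then show ?thesis using assms[of "Arg z"] that by simp
  qed
  note below = this
  have "l 0 = 0" using local_form[of 0] \<rho> by simp
  show "surface h \<inter> ball (x, h x) r - {(x, h x)} \<subseteq> below_plane q (x, h x)"
    unfolding surface_ball[OF conjunct1[OF r] conjunct2[OF r]]
  proof
    fix X assume X: "X \<in> piece r UNIV - {(x, h x)}"
    then obtain z where z: "X = (x + z, h x + l z)" unfolding piece_def by blast
    have "X \<noteq> (x, h x)" using X by blast
    then have "z \<noteq> 0" using \<open>l 0 = 0\<close> z by auto
    then show "X \<in> below_plane q (x, h x)" using below z by (simp add: below_plane_def)
  qed
qed

lemma no_zeros: assumes "zeros q a = {}" shows "l (cis y) \<noteq> q \<bullet> cis y"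
proof
  assume e: "l (cis y) = q \<bullet> cis y"
  obtain s \<eta> where s: "0 \<le> s" "a \<le> \<eta>" "\<eta> < a + 2 * pi" "cis y = of_real s * cis \<eta>"
    using polar_in_period[of a "cis y"] by blast
  have "s = 1" using s(1) arg_cong[OF s(4), of norm] unfolding norm_mult by simp
  then have "\<eta> \<in> zeros q a" using s e by (simp add: zeros_def)
  then show False using assms by blast
qed

lemma sign_constant_without_zeros:
  assumes "zeros q a = {}" "l (cis \<theta>) < q \<bullet> cis \<theta>"
  shows "l (cis \<phi>) < q \<bullet> cis \<phi>"
proof (rule ccontr)
  assume n: "\<not> ?thesis"
  have "connected (range (\<lambda>y. l (cis y) - q \<bullet> cis y))"
    by (intro connected_continuous_image continuous_intros continuous_on_compose2[OF l_cont]) auto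
  moreover have "l (cis \<theta>) - q \<bullet> cis \<theta> \<le> 0" "0 \<le> l (cis \<phi>) - q \<bullet> cis \<phi>" using assms n by auto
  ultimately have "0 \<in> range (\<lambda>y. l (cis y) - q \<bullet> cis y)" unfolding connected_iff_interval by blast
  then obtain y where "l (cis y) - q \<bullet> cis y = 0" by auto
  then show False using no_zeros[OF assms(1), of y] by simp
qed

lemma saddle_not_two: "cuts_saddle h x q \<Longrightarrow> \<not> cuts_into h x (q, -1) 2"
proof
  assume s: "cuts_saddle h x q" and c: "cuts_into h x (q, -1) 2"
  have "\<forall>\<^sub>F r in at_right (0::real). False"
    using s[unfolded cuts_saddle_def] c[unfolded cuts_into_def]
  proof eventually_elim
    case (elim r)
    show False
    proof (use elim(1) in \<open>elim exE conjE\<close>)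
      fix C\<^sub>0 C\<^sub>1 C\<^sub>2 C\<^sub>3
      assume "distinct [C\<^sub>0, C\<^sub>1, C\<^sub>2, C\<^sub>3]" "pieces h x (q, -1) r = {C\<^sub>0, C\<^sub>1, C\<^sub>2, C\<^sub>3}"
      then show False using elim(2) by simp
    qed
  qed
  then show False by (simp add: trivial_limit_at_right_real)
qed

lemma saddle_not_below: "cuts_saddle h x q \<Longrightarrow> \<not> lies_below h x q"
proof
  assume s: "cuts_saddle h x q" and c: "lies_below h x q"
  have "\<forall>\<^sub>F r in at_right (0::real). False"
    using s[unfolded cuts_saddle_def] c[unfolded lies_below_def]
  proof eventually_elim
    case (elim r)
    obtain C\<^sub>0 where C: "C\<^sub>0 \<in> pieces h x (q, -1) r" "C\<^sub>0 \<subseteq> above_plane q (x, h x)"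
    proof (use elim(1) in \<open>elim exE conjE\<close>)
      fix C\<^sub>0 C\<^sub>1 C\<^sub>2 C\<^sub>3
      assume "pieces h x (q, -1) r = {C\<^sub>0, C\<^sub>1, C\<^sub>2, C\<^sub>3}" "C\<^sub>0 \<subseteq> above_plane q (x, h x)"
      then show thesis using that by blast
    qed
    then obtain X where X: "X \<in> C\<^sub>0" using in_components_nonempty unfolding pieces_def by blast
    have "X \<in> surface h \<inter> ball (x, h x) r - plane_through (q, -1) (x, h x)"
      using in_components_subset[of C\<^sub>0] C X unfolding pieces_def by blast
    moreover have "(x, h x) \<in> plane_through (q, -1) (x, h x)" by (simp add: plane_through_def)
    ultimately have "X \<in> below_plane q (x, h x)" using elim(2) by blast
    then show False using C X by (auto simp: above_plane_def below_plane_def)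
  qed
  then show False by (simp add: trivial_limit_at_right_real)
qed

end

section \<open>The lifted surface near a vertex\<close>

context plane_framework begin

text \<open>The neighbors of a vertex by increasing angle. The list is closed up by the first neighbor, one
  turn later, so that every sector is given by two consecutive entries; consecutive entries are
  successors in the rotation system.\<close>

lemma neighbours_in_order:
  assumes v: "{v, j0} \<in> E"
  obtains d J th where "0 < d" "bij_betw J {..<d} {j. {v, j} \<in> E}" "J d = J 0"
    "\<And>t. t < d \<Longrightarrow> th t < th (Suc t)" "th d = th 0 + 2 * pi"
    "\<And>t. t \<le> d \<Longrightarrow> p (J t) - p v = of_real (norm (p (J t) - p v)) * cis (th t)"
    "\<And>t. t < d \<Longrightarrow> rot_succ E p v (J t) (J (Suc t))"
    "\<And>t. t < d \<Longrightarrow> ccw_angle (p (J t) - p v) (p (J (Suc t)) - p v) = th (Suc t) - th t"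
proof -
  define N where "N = {j. {v, j} \<in> E}"
  define ang where "ang j = Arg2pi (p j - p v)" for j
  have ne: "p j - p v \<noteq> 0" if "j \<in> N" for j using edge_ends[of v j] that by (auto simp: N_def)
  have pol: "p j - p v = of_real (norm (p j - p v)) * cis (ang j)" for j
    using Arg2pi_eq[of "p j - p v"] by (simp add: ang_def cis_conv_exp)
  have b: "0 \<le> ang j" "ang j < 2 * pi" for j unfolding ang_def using Arg2pi_ge_0 Arg2pi_lt_2pi by auto
  have inj: "inj_on ang N"
  proof (rule inj_onI, rule ccontr)
    fix j k assume jk: "j \<in> N" "k \<in> N" "ang j = ang k" "j \<noteq> k"
    have "p k - p v = of_real (norm (p k - p v) / norm (p j - p v)) * (p j - p v)"
      by (subst (1 4) pol) (use ne jk in simp)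
    moreover have "0 < norm (p k - p v) / norm (p j - p v)" using ne jk by simp
    ultimately show False using edges_meet[of v j k "norm (p k - p v) / norm (p j - p v)"] jk unfolding N_def by blast
  qed
  define d where "d = card N"
  have fin: "finite N" unfolding N_def by (rule finite_neighbours)
  have d0: "0 < d" using fin v by (auto simp: d_def card_gt_0_iff N_def)
  have cd: "card (ang ` N) = d" using card_image[OF inj] by (simp add: d_def)
  obtain y where y: "\<And>i j. \<lbrakk>i < j; j < d\<rbrakk> \<Longrightarrow> y i < y j" "ang ` N = y ` {..<d}"
    by (rule enumerate_increasing[OF finite_imageI[OF fin], of ang, unfolded cd], rule that)
  define J where "J t = inv_into N ang (y (if t < d then t else 0))" for t
  define th where "th t = (if t < d then y t else y 0 + 2 * pi)" for t
  have yN: "y t \<in> ang ` N" if "t < d" for t using y(2) that by auto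
  have JN: "J t \<in> N" "ang (J t) = y (if t < d then t else 0)" for t
    using yN[of t] yN[of 0] d0 unfolding J_def
    by (auto intro: inv_into_into f_inv_into_f split: if_splits)
  have yb: "0 \<le> y t" "y t < 2 * pi" if "t < d" for t
    using b[of "J t"] JN(2)[of t] that by simp_all
  have 1: "bij_betw J {..<d} N"
  proof (rule bij_betw_imageI)
    show "inj_on J {..<d}"
    proof (rule inj_onI)
      fix s t assume st: "s \<in> {..<d}" "t \<in> {..<d}" "J s = J t"
      then have "y s = y t" using JN(2)[of s] JN(2)[of t] by simp
      then show "s = t" using y(1)[of s t] y(1)[of t s] st by (cases s t rule: linorder_cases) auto
    qed
    show "J ` {..<d} = N"
    proof (intro equalityI subsetI)
      fix j assume j: "j \<in> N"
      then obtain t where t: "t < d" "ang j = y t" using y(2) by (metis imageE imageI lessThan_iff)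
      then have "ang (J t) = ang j" using JN(2)[of t] by simp
      then have "J t = j" using inj_onD[OF inj] JN(1) j by blast
      then show "j \<in> J ` {..<d}" using t by blast
    qed (use JN in auto)
  qed
  have 2: "J d = J 0" using d0 by (simp add: J_def)
  have 3: "th t < th (Suc t)" if "t < d" for t
    using y(1)[of t "Suc t"] yb[of t] yb[of 0] that d0 by (auto simp: th_def)
  have 4: "th d = th 0 + 2 * pi" using d0 by (simp add: th_def)
  have 5: "p (J t) - p v = of_real (norm (p (J t) - p v)) * cis (th t)" for t
    using pol[of "J t"] JN(2)[of t] by (auto simp: th_def cis.ctr)
  have mono: "y s \<le> y t" if "s \<le> t" "t < d" for s t using y(1)[of s t] that by (cases "s = t") auto
  have ratio: "ccw_angle (p (J t) - p v) (p (J s) - p v) = x"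
    if "th s = th t + x \<or> th s + 2 * pi = th t + x" "0 < x" "x \<le> 2 * pi" for s t x
  proof -
    define A where "A = norm (p (J t) - p v)"
    define B where "B = norm (p (J s) - p v)"
    have AB: "0 < A" "0 < B" using ne JN(1) unfolding A_def B_def by auto
    have c: "cis (th s) = cis x * cis (th t)"
      using that(1)
    proof
      assume "th s = th t + x" then show ?thesis by (simp add: cis_mult add.commute)
    next
      assume "th s + 2 * pi = th t + x"
      then have "cis x * cis (th t) = cis (th s + 2 * pi)" by (simp add: cis_mult add.commute)
      then show ?thesis by (simp add: cis.ctr)
    qed
    have "(p (J s) - p v) / (p (J t) - p v) = (of_real B * cis (th s)) / (of_real A * cis (th t))"
      using 5[of s] 5[of t] unfolding A_def B_def by simp
    also have "\<dots> = of_real (B / A) * cis x" unfolding c using AB by simp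
    finally show ?thesis using AB that by (intro ccw_angle_eqI[of "B/A"]) auto
  qed
  have gap: "th (Suc t) - th t \<le> 2 * pi" if "t < d" for t
  proof -
    have "th (Suc t) \<le> y 0 + 2 * pi" using yb[of "Suc t"] yb[of 0] d0 by (auto simp: th_def)
    moreover have "y 0 \<le> th t" using mono[of 0 t] that by (simp add: th_def)
    ultimately show ?thesis by simp
  qed
  have 6: "ccw_angle (p (J t) - p v) (p (J (Suc t)) - p v) = th (Suc t) - th t" if "t < d" for t
    using ratio[of "Suc t" t "th (Suc t) - th t"] 3[OF that] gap[OF that] by simp
  have 7: "rot_succ E p v (J t) (J (Suc t))" if t: "t < d" for t
    unfolding rot_succ_def
  proof (intro conjI allI impI)
    show "{v, J t} \<in> E" "{v, J (Suc t)} \<in> E" using JN(1) by (auto simp: N_def)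
    fix k assume "{v, k} \<in> E"
    then have "k \<in> J ` {..<d}" using 1 by (auto simp: N_def bij_betw_def)
    then obtain s where s: "s < d" "k = J s" by auto
    show "ccw_angle (p (J t) - p v) (p (J (Suc t)) - p v) \<le> ccw_angle (p (J t) - p v) (p k - p v)"
    proof (cases "t < s")
      case True
      then have "th t < th s" "th s \<le> th t + 2 * pi" "th (Suc t) \<le> th s"
        using y(1)[of t s] yb[of s] yb[of t] mono[of "Suc t" s] s by (auto simp: th_def)
      then show ?thesis using ratio[of s t "th s - th t"] 6[OF t] s by simp
    next
      case False
      then have "th s \<le> th t" "th t < th s + 2 * pi" "th (Suc t) \<le> th s + 2 * pi"
        using mono[of s t] yb[of t] yb[of s] yb[of "Suc t"] mono[of 0 s] s t by (auto simp: th_def)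
      then show ?thesis using ratio[of s t "th s + 2 * pi - th t"] 6[OF t] s by simp
    qed
  qed
  show ?thesis by (rule that[OF d0 1[unfolded N_def] 2 3 4 5 7 6])
qed

end

text \<open>A continuous function that is affine on the faces of a drawing, with gradients \<open>m\<close>.\<close>

locale lifted_framework = plane_framework V E p
  for V :: "'v set" and E :: "'v set set" and p :: "'v \<Rightarrow> complex" +
  fixes h :: "complex \<Rightarrow> real" and m :: "complex set \<Rightarrow> complex"
  assumes cont_h: "continuous_on UNIV h"
    and gradient: "F \<in> faces V E p \<Longrightarrow> affine_with_gradient h F (m F)"
begin

text \<open>The winding number about \<open>q\<close> of the reciprocal polygon of \<open>v\<close>. The sum over the neighbors \<open>j\<close> takes
  the sides of the polygon in no particular order: the side dual to \<open>vj\<close> leads from the face before \<open>vj\<close> to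
  the one after it, in counterclockwise order around \<open>v\<close>.\<close>

definition index :: "'v \<Rightarrow> complex \<Rightarrow> real" where
  "index v q = (\<Sum>j | {v, j} \<in> E. Arg ((m (left v j) - q) / (m (left j v) - q))) / (2 * pi)"

text \<open>The gradient \<open>q\<close> is general as far as the vertex \<open>v\<close> is concerned.\<close>

definition off_dual_edges :: "'v \<Rightarrow> complex \<Rightarrow> bool" where
  "off_dual_edges v q \<longleftrightarrow> (\<forall>j. {v, j} \<in> E \<longrightarrow> q \<notin> closed_segment (m (left j v)) (m (left v j)))"

lemma affine_on_closure:
  assumes "F \<in> faces V E p" "x \<in> closure F" "y \<in> closure F"
  shows "h y - h x = m F \<bullet> (y - x)"
proof -
  obtain a where "\<forall>x\<in>F. h x = m F \<bullet> x + a"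
    using gradient[OF assms(1)] unfolding affine_with_gradient_def by (elim exE)
  then have a: "\<And>x. x \<in> F \<Longrightarrow> h x - m F \<bullet> x = a" by simp
  have "continuous_on (closure F) (\<lambda>z. h z - m F \<bullet> z)"
    by (intro continuous_intros continuous_on_subset[OF cont_h]) auto
  from continuous_constant_on_closure[OF this a]
  have "h z - m F \<bullet> z = a" if "z \<in> closure F" for z using that by blast
  from this[OF assms(2)] this[OF assms(3)] show ?thesis by (simp add: inner_diff_right)
qed

text \<open>Around a vertex the sectors between consecutive edges lie in faces, on which the function is affine, so it is
  linear along rays from the vertex. The cone function \<open>l\<close> extends it by homogeneity. On the circle of
  directions it has the form required by \<open>polygon_index_zeros\<close>.\<close>

lemma vertex_cone:
  assumes v: "{v, j0} \<in> E"
  obtains l \<rho> a where "cone_point h (p v) l \<rho>"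
    "\<And>q. off_dual_edges v q \<Longrightarrow> cone_point.alternating l q a"
    "\<And>q. off_dual_edges v q \<Longrightarrow> real (card (cone_point.zeros l q a)) = 2 - 2 * index v q"
proof -
  obtain d J th where d: "0 < d" and J: "bij_betw J {..<d} {j. {v, j} \<in> E}" "J d = J 0"
    and th: "\<And>t. t < d \<Longrightarrow> th t < th (Suc t)" "th d = th 0 + 2 * pi"
    and pol: "\<And>t. t \<le> d \<Longrightarrow> p (J t) - p v = of_real (norm (p (J t) - p v)) * cis (th t)"
    and rs: "\<And>t. t < d \<Longrightarrow> rot_succ E p v (J t) (J (Suc t))"
    and ccw: "\<And>t. t < d \<Longrightarrow> ccw_angle (p (J t) - p v) (p (J (Suc t)) - p v) = th (Suc t) - th t"
    by (rule neighbours_in_order[OF v], rule that)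
  have JE: "{v, J t} \<in> E" if "t \<le> d" for t
  proof (cases "t = d")
    case True then show ?thesis using J d by (auto simp: bij_betw_def)
  next
    case False then show ?thesis using J(1) that by (auto simp: bij_betw_def)
  qed
  define g where "g t = m (left v (J t))" for t
  define sector_ok where "sector_ok t \<sigma> \<longleftrightarrow> 0 < \<sigma> \<and> left v (J t) = left (J (Suc t)) v \<and>
     (\<forall>s \<theta>. 0 < s \<longrightarrow> s < \<sigma> \<longrightarrow> th t < \<theta> \<longrightarrow> \<theta> < th (Suc t) \<longrightarrow> p v + of_real s * cis \<theta> \<in> left v (J t))" for t \<sigma>
  have "\<exists>\<sigma>. sector_ok t \<sigma>" if t: "t < d" for t
  proof -
    define r where "r = norm (p (J t) - p v)"
    have r: "0 < r" using edge_ends(4)[OF JE[of t]] t by (simp add: r_def)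
    obtain \<sigma> where \<sigma>: "\<sigma> > 0" "left v (J t) = left (J (Suc t)) v"
      "\<And>s \<theta>. \<lbrakk>0 < s; s < \<sigma>; 0 < \<theta>; \<theta> < th (Suc t) - th t\<rbrakk>
        \<Longrightarrow> p v + of_real s * cis \<theta> * (p (J t) - p v) \<in> left v (J t)"
      by (rule rot_succ_sector[OF rs[OF t], unfolded ccw[OF t]], rule that)
    show ?thesis unfolding sector_ok_def
    proof (intro exI[of _ "\<sigma> * r"] conjI allI impI)
      fix s \<theta> assume a: "0 < s" "s < \<sigma> * r" "th t < \<theta>" "\<theta> < th (Suc t)"
      have "of_real (s / r) * cis (\<theta> - th t) * (p (J t) - p v) = of_real (s / r) * cis (\<theta> - th t) * (of_real r * cis (th t))"
        using pol[of t] t by (simp add: r_def)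
      also have "\<dots> = of_real s * (cis (\<theta> - th t) * cis (th t))" using r by simp
      also have "cis (\<theta> - th t) * cis (th t) = cis \<theta>" by (simp add: cis_mult)
      finally have eq: "of_real (s / r) * cis (\<theta> - th t) * (p (J t) - p v) = of_real s * cis \<theta>" .
      have "0 < s / r" "s / r < \<sigma>" "0 < \<theta> - th t" "\<theta> - th t < th (Suc t) - th t"
        using a r by (auto simp: divide_less_eq)
      from \<sigma>(3)[OF this] show "p v + of_real s * cis \<theta> \<in> left v (J t)" by (simp only: eq)
    qed (use \<sigma> r in auto)
  qed
  then have "\<forall>t. \<exists>\<sigma>. t < d \<longrightarrow> sector_ok t \<sigma>" by blast
  from choice[OF this] obtain \<sigma> where ok: "\<forall>t. t < d \<longrightarrow> sector_ok t (\<sigma> t)" by blast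
  have \<sigma>: "0 < \<sigma> t" "left v (J t) = left (J (Suc t)) v"
    "\<And>s \<theta>. \<lbrakk>0 < s; s < \<sigma> t; th t < \<theta>; \<theta> < th (Suc t)\<rbrakk> \<Longrightarrow> p v + of_real s * cis \<theta> \<in> left v (J t)"
    if t: "t < d" for t
  proof -
    have "sector_ok t (\<sigma> t)" using ok t by blast
    then show "0 < \<sigma> t" "left v (J t) = left (J (Suc t)) v"
      "\<And>s \<theta>. \<lbrakk>0 < s; s < \<sigma> t; th t < \<theta>; \<theta> < th (Suc t)\<rbrakk> \<Longrightarrow> p v + of_real s * cis \<theta> \<in> left v (J t)"
      unfolding sector_ok_def by blast+
  qed
  define \<rho> where "\<rho> = Min (\<sigma> ` {..<d})"
  have \<rho>: "0 < \<rho>" unfolding \<rho>_def using d \<sigma>(1) by (subst Min_gr_iff) auto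
  have \<rho>\<sigma>: "\<rho> \<le> \<sigma> t" if "t < d" for t unfolding \<rho>_def using that by (intro Min_le) auto
  have lin: "h (p v + of_real s * cis \<theta>) = h (p v) + s * (g t \<bullet> cis \<theta>)"
    if t: "t < d" and s: "0 \<le> s" "s \<le> \<rho>" and \<theta>: "th t \<le> \<theta>" "\<theta> \<le> th (Suc t)" for t s \<theta>
  proof -
    define A where "A = {0<..<\<rho>} \<times> {th t<..<th (Suc t)}"
    define f where "f y = p v + of_real (fst y) * cis (snd y)" for y :: "real \<times> real"
    have "closure A = {0..\<rho>} \<times> {th t..th (Suc t)}" unfolding A_def closure_Times
      using \<rho> th(1)[OF t] by simp
    moreover have "f ` closure A \<subseteq> closure (f ` A)" unfolding f_def
      by (intro closure_subset image_closure_subset continuous_intros) auto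
    moreover have "f ` A \<subseteq> left v (J t)" unfolding f_def A_def 
    proof (rule image_subsetI)
      fix y assume "y \<in> {0<..<\<rho>} \<times> {th t<..<th (Suc t)}"
      then have "0 < fst y" "fst y < \<sigma> t" "th t < snd y" "snd y < th (Suc t)"
        using \<rho>\<sigma>[OF t] by (auto simp: mem_Times_iff)
      then show "p v + of_real (fst y) * cis (snd y) \<in> left v (J t)" by (rule \<sigma>(3)[OF t])
    qed
    from closure_mono[OF this] have "closure (f ` A) \<subseteq> closure (left v (J t))" .
    ultimately have "f ` ({0..\<rho>} \<times> {th t..th (Suc t)}) \<subseteq> closure (left v (J t))"
      by simp
    moreover have "(s, \<theta>) \<in> {0..\<rho>} \<times> {th t..th (Suc t)}" "(0, \<theta>) \<in> {0..\<rho>} \<times> {th t..th (Suc t)}"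
      using s \<theta> \<rho> by auto
    ultimately have "f (s, \<theta>) \<in> closure (left v (J t))" "f (0, \<theta>) \<in> closure (left v (J t))" by blast+
    moreover have "left v (J t) \<in> faces V E p" using left_in_faces JE t by simp
    ultimately have "h (f (s, \<theta>)) - h (f (0, \<theta>)) = g t \<bullet> (f (s, \<theta>) - f (0, \<theta>))"
      using affine_on_closure unfolding g_def by blast
    then show ?thesis by (simp add: f_def scaleR_conv_of_real[symmetric])
  qed
  \<comment> \<open>at \<open>z = 0\<close> the factor \<open>norm z\<close> makes the value \<open>0\<close>\<close>
  define l where "l z = norm z / \<rho> * (h (p v + of_real \<rho> * sgn z) - h (p v))" for z
  have l_lin: "l (of_real s * cis \<theta>) = s * (g t \<bullet> cis \<theta>)"
    if "t < d" "0 \<le> s" "th t \<le> \<theta>" "\<theta> \<le> th (Suc t)" for t s \<theta>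
  proof (cases "s = 0")
    case False
    then have "sgn (of_real s * cis \<theta>) = cis \<theta>" using that by (simp add: sgn_mult sgn_of_real)
    moreover have "norm (of_real s * cis \<theta>) = s" using that by (simp add: norm_mult)
    ultimately show ?thesis using lin[of t \<rho> \<theta>] that \<rho> unfolding l_def by simp
  qed (simp add: l_def)
  have sector: "\<exists>t s \<theta>. t < d \<and> th t \<le> \<theta> \<and> \<theta> \<le> th (Suc t) \<and> 0 \<le> s \<and> z = of_real s * cis \<theta>" for z
  proof -
    obtain s \<theta> where s: "0 \<le> s" "th 0 \<le> \<theta>" "\<theta> < th 0 + 2 * pi" "z = of_real s * cis \<theta>"
      using polar_in_period[of "th 0" z] by blast
    have "\<theta> \<le> th d" using s th(2) by simp
    then obtain t where "t < d" "th t \<le> \<theta>" "\<theta> \<le> th (Suc t)" using find_interval[of d th \<theta>, OF d s(2)] by blast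
    then show ?thesis using s by blast
  qed
  have loc: "h (p v + z) = h (p v) + l z" if z: "norm z \<le> \<rho>" for z
  proof -
    obtain t s \<theta> where t: "t < d" "th t \<le> \<theta>" "\<theta> \<le> th (Suc t)" "0 \<le> s" "z = of_real s * cis \<theta>"
      using sector by blast
    have "s \<le> \<rho>" using z t(4,5) by (simp add: norm_mult)
    then show ?thesis unfolding t(5) using lin[OF t(1,4) _ t(2,3)] l_lin[OF t(1,4,2,3)] by simp
  qed
  have hom: "l (of_real s * z) = s * l z" if "0 < s" for s z
    using that by (simp add: l_def sgn_mult sgn_of_real norm_mult)
  have cont: "isCont l z" for z
  proof -
    \<comment> \<open>near \<open>z\<close> all arguments are scaled by the same \<open>1 / K\<close> into the disk where \<open>h\<close> is conical\<close>
    define K where "K = (norm z + 1) / \<rho>"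
    have K: "0 < K" using \<rho> by (simp add: K_def add_nonneg_pos)
    have "\<forall>\<^sub>F y in nhds z. norm y < norm z + 1"
    proof -
      have "open {y. norm y < norm z + 1}" by (intro open_Collect_less continuous_intros)
      from eventually_nhds_in_open[OF this, of z] show ?thesis by simp
    qed
    then have ev: "\<forall>\<^sub>F y in nhds z. l y = K * (h (p v + of_real (1 / K) * y) - h (p v))"
    proof eventually_elim
      case (elim y)
      have "norm y < \<rho> * K" using elim \<rho> by (simp add: K_def)
      moreover have "norm (of_real (1 / K) * y) = norm y / K" using K by (simp add: norm_mult norm_divide)
      ultimately have "norm (of_real (1 / K) * y) \<le> \<rho>" using K by (simp add: pos_divide_le_eq)
      then have "h (p v + of_real (1 / K) * y) - h (p v) = l (of_real (1 / K) * y)" using loc by simp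
      also have "\<dots> = 1 / K * l y" using hom[of "1/K"] K by simp
      finally show ?case using K by simp
    qed
    have "continuous_on UNIV (\<lambda>y. K * (h (p v + of_real (1 / K) * y) - h (p v)))"
      by (intro continuous_intros continuous_on_compose2[OF cont_h]) auto
    then have "isCont (\<lambda>y. K * (h (p v + of_real (1 / K) * y) - h (p v))) z"
      using continuous_on_eq_continuous_at[OF open_UNIV] by blast
    then show ?thesis using isCont_cong[OF ev] by simp
  qed
  have cone: "cone_point h (p v) l \<rho>"
  proof
    show "continuous_on UNIV l" using cont continuous_at_imp_continuous_on by blast
    show "0 < \<rho>" by (rule \<rho>)
    show "h (p v + z) = h (p v) + l z" if "norm z < \<rho>" for z by (rule loc) (use that in simp)
    show "l (of_real s * z) = s * l z" if "0 < s" for s z by (rule hom[OF that])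
  qed
  interpret cone_point h "p v" l \<rho> by (rule cone)
  have gd: "g d = g 0" using J(2) by (simp add: g_def)
  have gt: "g t = m (left (J (Suc t)) v)" if "t < d" for t using \<sigma>(2)[OF that] by (simp add: g_def)
  have f: "l (cis \<theta>) = g t \<bullet> cis \<theta>" if "t < d" "th t \<le> \<theta>" "\<theta> \<le> th (Suc t)" for t \<theta>
    using l_lin[of t 1 \<theta>] that by simp
  have per: "l (cis (th d)) = l (cis (th 0))" unfolding th(2) by (simp add: cis_add_2pi)
  have sum: "(\<Sum>t<d. Arg ((g (Suc t) - q) / (g t - q))) / (2 * pi) = index v q" for q
  proof -
    define T where "T j = Arg ((m (left v j) - q) / (m (left j v) - q))" for j
    have "(\<Sum>t<d. Arg ((g (Suc t) - q) / (g t - q))) = (\<Sum>t<d. T (J (Suc t)))"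
    proof (rule sum.cong[OF refl])
      fix t assume "t \<in> {..<d}"
      then have "t < d" by simp
      show "Arg ((g (Suc t) - q) / (g t - q)) = T (J (Suc t))"
        unfolding T_def gt[OF \<open>t < d\<close>] by (simp only: g_def)
    qed
    also have "\<dots> = (\<Sum>t<d. T (J t))"
    proof -
      have "T (J 0) + (\<Sum>t<d. T (J (Suc t))) = (\<Sum>t<d. T (J t)) + T (J d)"
        using sum.lessThan_Suc_shift[of "\<lambda>t. T (J t)" d] sum.lessThan_Suc[of "\<lambda>t. T (J t)" d] by linarith
      then show ?thesis unfolding J(2) by simp
    qed
    also have "\<dots> = (\<Sum>j | {v, j} \<in> E. T j)" by (rule sum.reindex_bij_betw[OF J(1)])
    finally show ?thesis by (simp add: index_def T_def)
  qed
  have seg: "q \<notin> closed_segment (g t) (g (Suc t))" if "off_dual_edges v q" "t < d" for q t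
  proof -
    have "{v, J (Suc t)} \<in> E" using JE[of "Suc t"] that(2) by simp
    then have "q \<notin> closed_segment (m (left (J (Suc t)) v)) (m (left v (J (Suc t))))"
      using that(1) unfolding off_dual_edges_def by blast
    then show ?thesis unfolding gt[OF that(2)] g_def[of "Suc t"] .
  qed
  show ?thesis
  proof (rule that[OF cone, of "th 0"])
    fix q assume off: "off_dual_edges v q"
    have Z: "{\<theta>. th 0 \<le> \<theta> \<and> \<theta> < th d \<and> l (cis \<theta>) = q \<bullet> cis \<theta>} = zeros q (th 0)"
      by (simp add: zeros_def th(2))
    have seg': "\<And>t. t < d \<Longrightarrow> q \<notin> closed_segment (g t) (g (Suc t))" by (rule seg[OF off])
    note poly = polygon_index_zeros[of d th g q "\<lambda>\<theta>. l (cis \<theta>)", OF d th gd seg' f per]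
    have "finite (zeros q (th 0))" "even (card (zeros q (th 0)))"
      using poly(1,2) unfolding Z by blast+
    moreover have "\<exists>m::int. \<forall>\<theta>. th 0 \<le> \<theta> \<and> \<theta> \<le> th d \<longrightarrow>
        (even (int (card (zeros q (th 0) \<inter> {..<\<theta>})) + m) \<longrightarrow> q \<bullet> cis \<theta> \<le> l (cis \<theta>)) \<and>
        (odd (int (card (zeros q (th 0) \<inter> {..<\<theta>})) + m) \<longrightarrow> l (cis \<theta>) \<le> q \<bullet> cis \<theta>)"
      using poly(4) unfolding Z .
    ultimately show "alternating q (th 0)" unfolding alternating_def th(2)[symmetric] by (intro conjI)
    show "real (card (zeros q (th 0))) = 2 - 2 * index v q" using poly(3) unfolding Z sum .
  qed
qed

end

section \<open>Vertex indices on the faces of the reciprocal\<close>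

lemma isCont_angle:
  assumes "q \<notin> closed_segment a b"
  shows "isCont (\<lambda>q. Arg ((b - q) / (a - q))) q"
proof -
  note s = Arg_off_segment[OF assms]
  have "isCont (\<lambda>q. (b - q) / (a - q)) q" using s(1) by (intro continuous_intros) auto
  moreover have "isCont Arg ((b - q) / (a - q))" using continuous_at_Arg s(4) by blast
  ultimately show ?thesis by (rule isCont_o2)
qed

text \<open>The segment from \<open>a\<close> to \<open>b\<close> is seen under an angle close to \<open>pi\<close> from points just to its left, and
  close to \<open>-pi\<close> from points just to its right.\<close>

lemma angle_jump:
  assumes "a \<noteq> b"
  shows "((\<lambda>\<epsilon>. Arg ((b - (midpoint a b + \<epsilon> *\<^sub>R (\<i> * (b - a)))) / (a - (midpoint a b + \<epsilon> *\<^sub>R (\<i> * (b - a)))))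
       - Arg ((b - (midpoint a b - \<epsilon> *\<^sub>R (\<i> * (b - a)))) / (a - (midpoint a b - \<epsilon> *\<^sub>R (\<i> * (b - a))))))
     \<longlongrightarrow> 2 * pi) (at_right 0)"
proof -
  \<comment> \<open>\<open>- w \<epsilon>\<close> is the quotient at distance \<open>\<epsilon>\<close> to the left; on the right it is conjugate\<close>
  define w where "w \<epsilon> = Complex (1/2) (- \<epsilon>) / Complex (1/2) \<epsilon>" for \<epsilon> :: real
  have nz: "Complex (1/2) \<epsilon> \<noteq> 0" "Complex (-1/2) \<epsilon> \<noteq> 0" for \<epsilon> by (auto simp: complex_eq_iff)
  have ratio: "(b - (midpoint a b + \<epsilon> *\<^sub>R (\<i> * (b - a)))) / (a - (midpoint a b + \<epsilon> *\<^sub>R (\<i> * (b - a)))) = - w \<epsilon>" for \<epsilon>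
  proof -
    have "b - (midpoint a b + \<epsilon> *\<^sub>R (\<i> * (b - a))) = Complex (1/2) (- \<epsilon>) * (b - a)"
      "a - (midpoint a b + \<epsilon> *\<^sub>R (\<i> * (b - a))) = - Complex (1/2) \<epsilon> * (b - a)"
      by (simp_all add: midpoint_def complex_eq_iff field_simps)
    then show ?thesis using assms by (simp add: w_def)
  qed
  have w_cnj: "w (- \<epsilon>) = cnj (w \<epsilon>)" for \<epsilon> by (simp add: w_def complex_eq_iff Re_divide Im_divide)
  have im: "Im (w \<epsilon>) < 0" if "\<epsilon> > 0" for \<epsilon>
  proof -
    have "0 < (1/2)\<^sup>2 + \<epsilon>\<^sup>2" by (simp add: add_pos_nonneg)
    then show ?thesis using that by (simp add: w_def Im_divide divide_neg_pos)
  qed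
  have "((\<lambda>\<epsilon>. 2 * (Arg (w \<epsilon>) + pi)) \<longlongrightarrow> 2 * (Arg 1 + pi)) (at_right 0)"
  proof (intro tendsto_intros)
    have "isCont (\<lambda>\<epsilon>. w \<epsilon>) 0" unfolding w_def Complex_eq using nz[of 0] unfolding Complex_eq
      by (intro continuous_intros) auto
    then have "(w \<longlongrightarrow> w 0) (at 0)" by (simp add: isCont_def)
    then have "(w \<longlongrightarrow> w 0) (at_right 0)" by (rule filterlim_mono) (auto simp: at_le)
    moreover have "w 0 = 1" using nz[of 0] by (simp add: w_def)
    ultimately show "(w \<longlongrightarrow> 1) (at_right 0)" by simp
  qed auto
  moreover have "\<forall>\<^sub>F \<epsilon> in at_right 0. 2 * (Arg (w \<epsilon>) + pi) =
      Arg ((b - (midpoint a b + \<epsilon> *\<^sub>R (\<i> * (b - a)))) / (a - (midpoint a b + \<epsilon> *\<^sub>R (\<i> * (b - a)))))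
       - Arg ((b - (midpoint a b - \<epsilon> *\<^sub>R (\<i> * (b - a)))) / (a - (midpoint a b - \<epsilon> *\<^sub>R (\<i> * (b - a)))))"
    using eventually_at_right_less[of "0::real"]
  proof eventually_elim
    case (elim \<epsilon>)
    have i: "Im (w \<epsilon>) < 0" using im elim by simp
    then have w0: "w \<epsilon> \<noteq> 0" by auto
    have "Arg (w \<epsilon>) < 0" using i Arg_neg_iff by simp
    then have "Arg (- w \<epsilon>) = Arg (w \<epsilon>) + pi" using Arg_minus[OF w0] by simp
    moreover have "- w \<epsilon> \<notin> \<real>" using i by (auto simp: complex_is_Real_iff)
    then have "Arg (- w (- \<epsilon>)) = - Arg (- w \<epsilon>)" using Arg_cnj[of "- w \<epsilon>"] by (simp add: w_cnj)
    ultimately show ?case using ratio[of \<epsilon>] ratio[of "- \<epsilon>"] by simp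
  qed
  ultimately show ?thesis by (simp add: filterlim_cong)
qed

text \<open>The gradients themselves form a non-crossing drawing of the dual graph, dual to the given one. Facts
  about that drawing carry the prefix \<open>dual\<close>.\<close>

locale reciprocal_lifting = lifted_framework V E p h m +
  dual: plane_framework "faces V E p" "dual_edges V E p" m
  for V :: "'v set" and E :: "'v set set" and p :: "'v \<Rightarrow> complex"
    and h :: "complex \<Rightarrow> real" and m :: "complex set \<Rightarrow> complex" +
  assumes two_conn: "two_connected V E"
    and inj_dual: "inj_on (dual_edge V E p) E"
    and embedding: "dual_embedding_same V E p m \<or> dual_embedding_reversed V E p m"
begin

abbreviation dual_faces :: "complex set set" where
  "dual_faces \<equiv> faces (faces V E p) (dual_edges V E p) m"

lemma dual_edge_eq: assumes "{i, j} \<in> E" shows "dual_edge V E p {i, j} = {left i j, left j i}"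
proof -
  have "F \<in> dual_edge V E p {i, j} \<longleftrightarrow> left_face V E p i j F \<or> left_face V E p j i F" for F
    unfolding dual_edge_def mem_Collect_eq doubleton_eq_iff by blast
  moreover have "left_face V E p i j F \<longleftrightarrow> F = left i j" for F
    using left_eq[of i j F] left_face_left[OF assms] by blast
  moreover have "left_face V E p j i F \<longleftrightarrow> F = left j i" for F
    using left_eq[of j i F] left_face_left'[OF assms] by blast
  ultimately show ?thesis by blast
qed

lemma dual_edge_in: assumes "{i, j} \<in> E" shows "{left j i, left i j} \<in> dual_edges V E p"
  using imageI[OF assms, of "dual_edge V E p"] unfolding dual_edge_eq[OF assms] by (simp only: insert_commute)

lemma general_off_dual_edges: assumes "q \<notin> dual.D" shows "off_dual_edges v q"
  unfolding off_dual_edges_def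
proof (intro allI impI notI)
  fix j assume j: "{v, j} \<in> E" "q \<in> closed_segment (m (left j v)) (m (left v j))"
  then have "q \<in> edge_segment m {left j v, left v j}" by (simp only: dual.edge_segment_eq)
  then have "q \<in> dual.D" unfolding drawing_def using dual_edge_in[OF j(1)] by (intro UnI2 UN_I)
  then show False using assms by simp
qed

lemma neighbour_exists: assumes "v \<in> V" obtains j where "{v, j} \<in> E"
proof -
  have "3 \<le> card V" "graph_connected V E" using two_conn by (auto simp: two_connected_def)
  then have "\<not> V \<subseteq> {v}" using card_mono[of "{v}" V] by auto
  then obtain w where w: "w \<in> V" "w \<noteq> v" by blast
  then have "(v, w) \<in> {(a, b). a \<in> V \<and> b \<in> V \<and> {a, b} \<in> E}\<^sup>*"
    using \<open>graph_connected V E\<close> assms by (simp add: graph_connected_def)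
  then show ?thesis
  proof (cases rule: converse_rtranclE)
    case base then show ?thesis using w by simp
  next
    case (step y) then show ?thesis using that[of y] by simp
  qed
qed

text \<open>The face of the reciprocal drawing on the distinguished side of the reciprocal edge dual to \<open>vj\<close>: to
  its left if the embedding is dual with the same orientation, and otherwise to its right. Here the edge is
  directed as in the counterclockwise reciprocal polygon of \<open>v\<close>.\<close>

definition dual_side :: "'v \<Rightarrow> 'v \<Rightarrow> complex set" where
  "dual_side v j = (if dual_embedding_same V E p m
     then dual.left (left j v) (left v j) else dual.left (left v j) (left j v))"

text \<open>The faces around a vertex form a face cycle of the reciprocal drawing, and a face cycle keeps its face on
  one side.\<close>

lemma dual_side_const:
  assumes "{v, j} \<in> E" "{v, k} \<in> E"
  shows "dual_side v j = dual_side v k"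
proof -
  obtain d J th where J: "0 < d" "bij_betw J {..<d} {j. {v, j} \<in> E}" "J d = J 0"
    "\<And>t. t < d \<Longrightarrow> th t < th (Suc t)" "th d = th 0 + 2 * pi"
    "\<And>t. t \<le> d \<Longrightarrow> p (J t) - p v = of_real (norm (p (J t) - p v)) * cis (th t)"
    "\<And>t. t < d \<Longrightarrow> rot_succ E p v (J t) (J (Suc t))"
    "\<And>t. t < d \<Longrightarrow> ccw_angle (p (J t) - p v) (p (J (Suc t)) - p v) = th (Suc t) - th t"
    by (rule neighbours_in_order[OF assms(1)], rule that)
  have step: "dual_side v (J t) = dual_side v (J (Suc t))" if t: "t < d" for t
  proof -
    have e: "{v, J t} \<in> E" "{v, J (Suc t)} \<in> E" using J(7)[OF t] by (simp_all add: rot_succ_def)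
    have B: "left v (J t) = left (J (Suc t)) v"
      by (rule rot_succ_sector[OF J(7)[OF t]])
    have f: "left_face V E p (J t) v (left (J t) v)" "left_face V E p v (J t) (left v (J t))"
      "left_face V E p v (J (Suc t)) (left v (J (Suc t)))"
      by (rule left_face_left'[OF e(1)], rule left_face_left[OF e(1)], rule left_face_left[OF e(2)])
    show ?thesis
    proof (cases "dual_embedding_same V E p m")
      case True
      note emb = True[unfolded dual_embedding_same_def, THEN conjunct2, rule_format]
      have "face_succ (dual_edges V E p) m (left (J t) v) (left v (J t)) (left v (J (Suc t)))"
        by (rule emb[of v "J t" "J (Suc t)"]) (intro conjI J(7)[OF t] f)
      from dual.face_succ_left[OF this] show ?thesis using True B by (simp add: dual_side_def)
    next
      case False
      then have "dual_embedding_reversed V E p m" using embedding by simp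
      note emb = this[unfolded dual_embedding_reversed_def, THEN conjunct2, rule_format]
      have "face_succ (dual_edges V E p) m (left v (J (Suc t))) (left v (J t)) (left (J t) v)"
        by (rule emb[of v "J t" "J (Suc t)"]) (intro conjI J(7)[OF t] f)
      from dual.face_succ_left[OF this] show ?thesis using False B by (simp add: dual_side_def)
    qed
  qed
  have all: "dual_side v (J t) = dual_side v (J 0)" if "t \<le> d" for t
    using that
  proof (induction t)
    case (Suc t)
    then show ?case using step[of t] by simp
  qed simp
  have "j \<in> J ` {..<d}" "k \<in> J ` {..<d}" using J(2) assms by (auto simp: bij_betw_def)
  then obtain s t where st: "s < d" "t < d" "j = J s" "k = J t" by blast
  show ?thesis unfolding st(3,4) using all[of s] all[of t] st(1,2) by simp
qed

definition dual_face :: "'v \<Rightarrow> complex set" where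
  "dual_face v = dual_side v (SOME j. {v, j} \<in> E)"

lemma dual_face_eq: assumes "{v, j} \<in> E" shows "dual_face v = dual_side v j"
  unfolding dual_face_def using dual_side_const[OF someI[of "\<lambda>j. {v, j} \<in> E", OF assms] assms] .

lemma dual_face_in: assumes "v \<in> V" shows "dual_face v \<in> dual_faces"
proof -
  obtain j where j: "{v, j} \<in> E" using neighbour_exists assms by blast
  have "{left j v, left v j} \<in> dual_edges V E p" "{left v j, left j v} \<in> dual_edges V E p"
    using dual_edge_in[OF j] by (simp_all add: insert_commute)
  then show ?thesis unfolding dual_face_eq[OF j] dual_side_def using dual.left_in_faces by auto
qed

lemma general_vertex_cone:
  assumes "v \<in> V"
  obtains l \<rho> a where "cone_point h (p v) l \<rho>"
    "\<And>q. q \<notin> dual.D \<Longrightarrow> cone_point.alternating l q a"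
    "\<And>q. q \<notin> dual.D \<Longrightarrow> real (card (cone_point.zeros l q a)) = 2 - 2 * index v q"
proof -
  obtain j where j: "{v, j} \<in> E" using neighbour_exists assms by blast
  show ?thesis
    by (rule vertex_cone[OF j], rule that) (blast intro: general_off_dual_edges)+
qed

text \<open>Together with continuity, this makes the index constant on each face of the reciprocal drawing.\<close>

lemma index_half_integer:
  assumes "v \<in> V" "q \<notin> dual.D" obtains n :: nat where "index v q = 1 - real n / 2"
proof -
  obtain l \<rho> a where "cone_point h (p v) l \<rho>"
    "\<And>q. q \<notin> dual.D \<Longrightarrow> cone_point.alternating l q a"
    "\<And>q. q \<notin> dual.D \<Longrightarrow> real (card (cone_point.zeros l q a)) = 2 - 2 * index v q"
    by (rule general_vertex_cone[OF assms(1)], rule that)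
  from this(3)[OF assms(2)] have "index v q = 1 - real (card (cone_point.zeros l q a)) / 2" by linarith
  then show ?thesis by (rule that)
qed

lemma index_constant:
  assumes v: "v \<in> V" and X: "X \<in> dual_faces" and q: "q \<in> X" "q' \<in> X"
  shows "index v q = index v q'"
proof -
  have gen: "y \<notin> dual.D" if "y \<in> X" for y using dual.face_disjoint[OF X] that by blast
  have "isCont (index v) y" if y: "y \<in> X" for y
    unfolding index_def[abs_def]
    by (intro continuous_intros isCont_angle)
      (use general_off_dual_edges[OF gen[OF y]] in \<open>auto simp: off_dual_edges_def\<close>)
  then have "continuous_on X (index v)" using continuous_at_imp_continuous_on by blast
  moreover have "connected X" using X unfolding faces_def by (rule in_components_connected)
  moreover have "\<exists>e>0. \<forall>z. z \<in> X \<and> index v z \<noteq> index v y \<longrightarrow> e \<le> norm (index v z - index v y)" if y: "y \<in> X" for y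
  proof (intro exI[of _ "1/2"] conjI allI impI)
    fix z assume z: "z \<in> X \<and> index v z \<noteq> index v y"
    obtain k where k: "index v y = 1 - real k / 2" by (rule index_half_integer[OF v gen[OF y]])
    obtain n where n: "index v z = 1 - real n / 2" using index_half_integer[OF v gen] z by blast
    have "k \<noteq> n" using z k n by auto
    then have "1 \<le> \<bar>real k - real n\<bar>" by linarith
    then show "1 / 2 \<le> norm (index v z - index v y)" using k n by (simp add: abs_if split: if_splits)
  qed simp
  ultimately have "index v constant_on X" by (intro continuous_discrete_range_constant)
  then show ?thesis using q unfolding constant_on_def by auto
qed

text \<open>Cross the reciprocal edge dual to \<open>vw\<close> at its midpoint. All angles are continuous there except the one
  subtended by this edge, which jumps by \<open>2 * pi\<close>. It occurs in the index of \<open>v\<close> and, with opposite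
  direction, in that of \<open>w\<close>. The case \<open>u = w\<close> is obtained by exchanging \<open>v\<close> and \<open>w\<close>.\<close>

lemma index_jump:
  assumes e: "{v, w} \<in> E" and u: "u \<in> V" "u \<noteq> w"
    and q: "q \<in> dual.left (left w v) (left v w)" "q' \<in> dual.left (left v w) (left w v)"
  shows "index u q - index u q' = (if u = v then 1 else 0)"
proof -
  define a b where "a = m (left w v)" and "b = m (left v w)"
  define M where "M = midpoint a b"
  define n where "n = \<i> * (b - a)"
  have de: "{left w v, left v w} \<in> dual_edges V E p" "{left v w, left w v} \<in> dual_edges V E p"
    using dual_edge_in[OF e] by (simp_all add: insert_commute)
  have ab: "a \<noteq> b" using dual.edge_ends[OF de(1)] by (simp add: a_def b_def)
  define T where "T j q = Arg ((m (left u j) - q) / (m (left j u) - q))" for j q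
  define N where "N = {j. {u, j} \<in> E}"
  have cont: "((\<lambda>\<epsilon>. T j (M + \<epsilon> *\<^sub>R n) - T j (M - \<epsilon> *\<^sub>R n)) \<longlongrightarrow> 0) (at_right 0)"
    if j: "{u, j} \<in> E" "{u, j} \<noteq> {v, w}" for j
  proof -
    have "dual_edge V E p {u, j} \<noteq> dual_edge V E p {v, w}"
      using inj_onD[OF inj_dual] j e by blast
    then have ne: "{left j u, left u j} \<noteq> {left w v, left v w}"
      using dual_edge_eq j(1) e by (metis insert_commute)
    have "M \<notin> closed_segment (m (left j u)) (m (left u j))"
    proof
      assume "M \<in> closed_segment (m (left j u)) (m (left u j))"
      then have 1: "M \<in> edge_segment m {left j u, left u j}" by (simp only: dual.edge_segment_eq)
      have "M \<in> closed_segment a b" unfolding M_def by (rule midpoint_in_closed_segment)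
      then have 2: "M \<in> edge_segment m {left w v, left v w}" by (simp only: dual.edge_segment_eq a_def b_def)
      from dual.edges_share_ends[OF dual_edge_in[OF j(1)] de(1) ne 1 2] have "M = a \<or> M = b"
        by (auto simp: a_def b_def)
      then show False using ab by (auto simp: M_def midpoint_eq_endpoint)
    qed
    then have c: "isCont (T j) M" unfolding T_def[abs_def] by (rule isCont_angle)
    have "((\<lambda>\<epsilon>. T j (M + \<epsilon> *\<^sub>R n)) \<longlongrightarrow> T j M) (at_right 0)"
      by (rule isCont_tendsto_compose[OF c]) (auto intro!: tendsto_eq_intros)
    moreover have "((\<lambda>\<epsilon>. T j (M - \<epsilon> *\<^sub>R n)) \<longlongrightarrow> T j M) (at_right 0)"
      by (rule isCont_tendsto_compose[OF c]) (auto intro!: tendsto_eq_intros)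
    ultimately show ?thesis using tendsto_diff by fastforce
  qed
  have lim_T: "((\<lambda>\<epsilon>. T j (M + \<epsilon> *\<^sub>R n) - T j (M - \<epsilon> *\<^sub>R n)) \<longlongrightarrow> (if u = v \<and> j = w then 2 * pi else 0)) (at_right 0)"
    if j: "j \<in> N" for j
  proof (cases "u = v \<and> j = w")
    case True
    then show ?thesis using angle_jump[OF ab] by (simp add: T_def M_def n_def a_def b_def)
  next
    case False
    then have "{u, j} \<noteq> {v, w}" using u by (auto simp: doubleton_eq_iff)
    then show ?thesis unfolding if_not_P[OF False] using cont[of j] j by (simp add: N_def)
  qed
  have fin: "finite N" unfolding N_def by (rule finite_neighbours)
  have "((\<lambda>\<epsilon>. (\<Sum>j\<in>N. T j (M + \<epsilon> *\<^sub>R n) - T j (M - \<epsilon> *\<^sub>R n)) / (2 * pi)) \<longlongrightarrow>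
      (\<Sum>j\<in>N. if u = v \<and> j = w then 2 * pi else 0) / (2 * pi)) (at_right 0)"
    by (intro tendsto_intros lim_T) auto
  moreover have "(\<Sum>j\<in>N. T j (M + \<epsilon> *\<^sub>R n) - T j (M - \<epsilon> *\<^sub>R n)) / (2 * pi) = index u (M + \<epsilon> *\<^sub>R n) - index u (M - \<epsilon> *\<^sub>R n)" for \<epsilon>
    by (simp add: index_def T_def N_def sum_subtractf diff_divide_distrib)
  moreover have "(\<Sum>j\<in>N. if u = v \<and> j = w then 2 * pi else 0) / (2 * pi) = (if u = v then 1 else 0)"
  proof (cases "u = v")
    case True
    then show ?thesis using fin e sum.delta[OF fin, of w "\<lambda>_. 2 * pi"] by (simp add: N_def)
  qed simp
  ultimately have lim: "((\<lambda>\<epsilon>. index u (M + \<epsilon> *\<^sub>R n) - index u (M - \<epsilon> *\<^sub>R n)) \<longlongrightarrow> (if u = v then 1 else 0)) (at_right 0)"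
    by simp
  have "left_face (faces V E p) (dual_edges V E p) m (left w v) (left v w) (dual.left (left w v) (left v w))"
    by (rule dual.left_face_left[OF de(1)])
  then have ev1: "\<forall>\<^sub>F \<epsilon> in at_right 0. M + \<epsilon> *\<^sub>R n \<in> dual.left (left w v) (left v w)"
    by (simp add: left_face_def M_def n_def a_def b_def)
  have "left_face (faces V E p) (dual_edges V E p) m (left v w) (left w v) (dual.left (left v w) (left w v))"
    by (rule dual.left_face_left[OF de(2)])
  then have "\<forall>\<^sub>F \<epsilon> in at_right 0. midpoint b a + \<epsilon> *\<^sub>R (\<i> * (a - b)) \<in> dual.left (left v w) (left w v)"
    by (simp add: left_face_def a_def b_def)
  moreover have "midpoint b a + \<epsilon> *\<^sub>R (\<i> * (a - b)) = M - \<epsilon> *\<^sub>R n" for \<epsilon>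
    by (simp add: M_def n_def midpoint_sym algebra_simps)
  ultimately have ev2: "\<forall>\<^sub>F \<epsilon> in at_right 0. M - \<epsilon> *\<^sub>R n \<in> dual.left (left v w) (left w v)" by simp
  have "\<forall>\<^sub>F \<epsilon> in at_right 0. index u (M + \<epsilon> *\<^sub>R n) - index u (M - \<epsilon> *\<^sub>R n) = index u q - index u q'"
    using ev1 ev2
  proof eventually_elim
    case (elim \<epsilon>)
    then show ?case
      using index_constant[OF u(1) dual.left_in_faces[OF de(1)] _ q(1)]
        index_constant[OF u(1) dual.left_in_faces[OF de(2)] _ q(2)] by simp
  qed
  then have "((\<lambda>\<epsilon>. index u (M + \<epsilon> *\<^sub>R n) - index u (M - \<epsilon> *\<^sub>R n)) \<longlongrightarrow> index u q - index u q') (at_right 0)"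
    by (rule tendsto_eventually)
  then show ?thesis using tendsto_unique[OF _ _ lim] by (simp add: trivial_limit_at_right_real)
qed

text \<open>From far away every edge is seen under a small angle.\<close>

lemma index_unbounded:
  assumes v: "v \<in> V" and X: "X \<in> dual_faces" "\<not> bounded X" "q \<in> X"
  shows "index v q = 0"
proof (rule ccontr)
  assume nz: "index v q \<noteq> 0"
  have angle: "((\<lambda>q. Arg ((b - q) / (a - q))) \<longlongrightarrow> 0) at_infinity" for a b :: complex
  proof -
    have inf: "filterlim (\<lambda>q. a - q) at_infinity at_infinity"
      unfolding filterlim_at_infinity[OF order_refl]
    proof (intro allI impI)
      fix r :: real
      have "r \<le> norm (a - q)" if "r + norm a \<le> norm q" for q
        using that norm_triangle_ineq2[of q a] by (simp add: norm_minus_commute)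
      then show "\<forall>\<^sub>F q in at_infinity. r \<le> norm (a - q)" unfolding eventually_at_infinity by blast
    qed
    then have "((\<lambda>q. (b - a) / (a - q)) \<longlongrightarrow> 0) at_infinity" by (rule tendsto_divide_0[OF tendsto_const])
    then have lim: "((\<lambda>q. 1 + (b - a) / (a - q)) \<longlongrightarrow> 1 + 0) at_infinity" by (intro tendsto_intros)
    have "((\<lambda>q. Arg (1 + (b - a) / (a - q))) \<longlongrightarrow> Arg (1 + 0)) at_infinity"
      by (rule tendsto_Arg[OF lim]) auto
    then have "((\<lambda>q. Arg (1 + (b - a) / (a - q))) \<longlongrightarrow> 0) at_infinity" by simp
    moreover have "\<forall>\<^sub>F q in at_infinity. Arg (1 + (b - a) / (a - q)) = Arg ((b - q) / (a - q))"
    proof -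
      have "\<forall>\<^sub>F q in at_infinity. norm a + 1 \<le> norm q" unfolding eventually_at_infinity by blast
      then show ?thesis
      proof eventually_elim
        case (elim q)
        then have "a - q \<noteq> 0" by auto
        then have "1 + (b - a) / (a - q) = (b - q) / (a - q)" by (simp add: field_simps)
        then show ?case by simp
      qed
    qed
    ultimately show ?thesis by (rule Lim_transform_eventually)
  qed
  have "((index v) \<longlongrightarrow> (\<Sum>j | {v, j} \<in> E. 0) / (2 * pi)) at_infinity"
    unfolding index_def[abs_def] by (intro tendsto_intros angle) auto
  then have "((index v) \<longlongrightarrow> 0) at_infinity" by simp
  then have "\<forall>\<^sub>F y in at_infinity. dist (index v y) 0 < \<bar>index v q\<bar>" using nz by (intro tendstoD) auto
  then obtain B where B: "\<And>y. B \<le> norm y \<Longrightarrow> \<bar>index v y\<bar> < \<bar>index v q\<bar>"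
    unfolding eventually_at_infinity by auto
  obtain y where "y \<in> X" "B < norm y" using X(2) unfolding bounded_iff by (meson not_le)
  then show False using B[of y] index_constant[OF v X(1) _ X(3), of y] by simp
qed

text \<open>By \<open>index_off_own_face\<close>, the amount by which the index of a vertex is larger on its dual face than
  elsewhere.\<close>

definition orientation :: real where
  "orientation = (if dual_embedding_same V E p m then 1 else -1)"

text \<open>The value on a face of the reciprocal drawing, read off at an arbitrary point.\<close>

definition index_on :: "'v \<Rightarrow> complex set \<Rightarrow> real" where
  "index_on v X = index v (SOME q. q \<in> X)"

lemma index_on_eq:
  assumes "v \<in> V" "X \<in> dual_faces" "q \<in> X"
  shows "index v q = index_on v X"
  unfolding index_on_def by (rule index_constant[OF assms]) (use assms(3) in \<open>rule someI\<close>)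

lemma index_across:
  assumes e: "{v, w} \<in> E"
  shows "index_on v (dual_face v) = index_on v (dual_face w) + orientation"
    and "\<lbrakk>u \<in> V; u \<noteq> v; u \<noteq> w\<rbrakk> \<Longrightarrow> index_on u (dual_face v) = index_on u (dual_face w)"
proof -
  have e': "{w, v} \<in> E" using e by (simp add: insert_commute)
  have vw: "v \<in> V" "w \<in> V" "v \<noteq> w" using edge_ends[OF e] by auto
  have faces: "dual.left (left w v) (left v w) \<in> dual_faces"
    "dual.left (left v w) (left w v) \<in> dual_faces"
    using dual.left_in_faces[OF dual_edge_in[OF e]] dual.left_in_faces[OF dual_edge_in[OF e']] by auto
  obtain q q' where q: "q \<in> dual.left (left w v) (left v w)" "q' \<in> dual.left (left v w) (left w v)"
    using dual.face_nonempty[OF faces(1)] dual.face_nonempty[OF faces(2)] by blast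
  have on: "index u q = index_on u (dual.left (left w v) (left v w))"
    "index u q' = index_on u (dual.left (left v w) (left w v))" if "u \<in> V" for u
    using index_on_eq[OF that faces(1) q(1)] index_on_eq[OF that faces(2) q(2)] by auto
  have "index v q - index v q' = 1" using index_jump[OF e vw(1,3) q] by simp
  then have "index_on v (dual.left (left w v) (left v w)) - index_on v (dual.left (left v w) (left w v)) = 1"
    using on[OF vw(1)] by simp
  then show "index_on v (dual_face v) = index_on v (dual_face w) + orientation"
    unfolding dual_face_eq[OF e] dual_face_eq[OF e'] dual_side_def orientation_def
    by auto
  show "index_on u (dual_face v) = index_on u (dual_face w)" if u: "u \<in> V" "u \<noteq> v" "u \<noteq> w"
  proof -
    have "index u q - index u q' = 0" using index_jump[OF e u(1,3) q] u(2) by simp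
    then have "index_on u (dual.left (left w v) (left v w)) = index_on u (dual.left (left v w) (left w v))"
      using on[OF u(1)] by simp
    then show ?thesis
      unfolding dual_face_eq[OF e] dual_face_eq[OF e'] dual_side_def by auto
  qed
qed

text \<open>A path in \<open>G - u\<close> from a neighbor of \<open>u\<close> to \<open>w\<close> passes from dual face to dual face across reciprocal edges that
  do not belong to \<open>u\<close>, so the index of \<open>u\<close> stays the same. Only the step from \<open>u\<close> to its neighbor
  contributes.\<close>

lemma index_off_own_face:
  assumes u: "u \<in> V" and w: "w \<in> V" "w \<noteq> u"
  shows "index_on u (dual_face u) = index_on u (dual_face w) + orientation"
proof -
  obtain j where j: "{u, j} \<in> E" by (rule neighbour_exists[OF u])
  have jV: "j \<in> V - {u}" using edge_ends[OF j] by auto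
  have "graph_connected (V - {u}) E" using two_conn u by (simp add: two_connected_def)
  then have "(j, w) \<in> {(a, b). a \<in> V - {u} \<and> b \<in> V - {u} \<and> {a, b} \<in> E}\<^sup>*"
    using jV w by (simp add: graph_connected_def)
  then have "index_on u (dual_face j) = index_on u (dual_face w)"
  proof (induction rule: rtrancl_induct)
    case (step y z)
    then show ?case using index_across(2)[of y z u] u by auto
  qed simp
  then show ?thesis using index_across(1)[OF j] by simp
qed

text \<open>Both faces beside a reciprocal edge are dual faces, namely those of the two ends of the primal edge.\<close>

lemma every_face_is_dual_face:
  assumes X: "X \<in> dual_faces"
  obtains v where "v \<in> V" "X = dual_face v"
proof -
  have sides: "dual.left F G \<in> dual_face ` V" if FG: "{F, G} \<in> dual_edges V E p" for F G
  proof -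
    obtain e where e: "e \<in> E" "{F, G} = dual_edge V E p e" using FG by blast
    obtain v w where vw: "e = {v, w}" by (rule edge_obtain[OF e(1)])
    then have E: "{v, w} \<in> E" "{w, v} \<in> E" using e by (auto simp: insert_commute)
    have "{F, G} = {left v w, left w v}" using e vw dual_edge_eq[OF E(1)] by simp
    then consider "F = left v w" "G = left w v" | "F = left w v" "G = left v w"
      by (auto simp: doubleton_eq_iff)
    then show ?thesis
      using dual_face_eq[OF E(1)] dual_face_eq[OF E(2)] edge_ends[OF E(1)] unfolding dual_side_def
      by cases (auto split: if_splits)
  qed
  have "V \<noteq> {}" using two_conn by (auto simp: two_connected_def)
  then obtain v where v: "v \<in> V" by blast
  have "X \<in> dual_face ` V"
  proof (rule dual.faces_crossing_induct[OF dual_face_in[OF v] _ X])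
    show "dual_face v \<in> dual_face ` V" using v by simp
    show "dual.left G F \<in> dual_face ` V" if "{F, G} \<in> dual_edges V E p" for F G
      using sides[of G F] that by (simp add: insert_commute)
  qed
  then show ?thesis using that by blast
qed

lemma outside_iff_unbounded_face:
  assumes "X \<in> dual_faces" "q \<in> X"
  shows "q \<in> outside dual.D \<longleftrightarrow> \<not> bounded X"
proof -
  have "X = connected_component_set (- dual.D) q"
    using assms unfolding faces_def
    by (metis components_iff connected_component_eq)
  then show ?thesis by (simp add: outside)
qed

text \<open>The index of \<open>v\<close> is zero on the unbounded face. Hence the constant value of the index of \<open>v\<close> off its own
  dual face is \<open>0\<close> for \<open>v \<noteq> v0\<close>, whereas for \<open>v0\<close>, whose dual face is the unbounded one, it is minus the
  orientation.\<close>

lemma index_distribution: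
  obtains v0 where "v0 \<in> V"
    "\<And>q v. \<lbrakk>q \<in> outside dual.D; v \<in> V\<rbrakk> \<Longrightarrow> index v q = 0"
    "\<And>q. \<lbrakk>q \<notin> dual.D; q \<notin> outside dual.D\<rbrakk> \<Longrightarrow> \<exists>v1\<in>V. v1 \<noteq> v0 \<and> index v1 q = orientation \<and>
       index v0 q = - orientation \<and> (\<forall>v\<in>V. v \<noteq> v0 \<longrightarrow> v \<noteq> v1 \<longrightarrow> index v q = 0)"
    "\<And>v. \<lbrakk>v \<in> V; v \<noteq> v0\<rbrakk> \<Longrightarrow> \<exists>q. q \<notin> dual.D \<and> index v q = orientation"
proof -
  have "bounded (- (- dual.D))" using dual.compact_D compact_imp_bounded by simp
  from cobounded_unbounded_components[OF this]
  obtain Out where Out: "Out \<in> dual_faces" "\<not> bounded Out"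
    unfolding faces_def by blast
  obtain v0 where v0: "v0 \<in> V" "Out = dual_face v0" by (rule every_face_is_dual_face[OF Out(1)])
  obtain qout where qout: "qout \<in> Out" using dual.face_nonempty[OF Out(1)] by blast
  have zero: "index_on v (dual_face v0) = 0" if "v \<in> V" for v
    using index_unbounded[OF that Out qout] index_on_eq[OF that Out(1) qout] v0 by simp
  have own: "index_on v (dual_face v) = orientation" if "v \<in> V" "v \<noteq> v0" for v
    using index_off_own_face[OF that(1) v0(1)] zero[OF that(1)] that(2) by simp
  have other: "index_on v (dual_face w) = 0" if "v \<in> V" "v \<noteq> v0" "w \<in> V" "w \<noteq> v" for v w
    using index_off_own_face[OF that(1,3,4)] own[OF that(1,2)] by simp
  have outer: "index_on v0 (dual_face w) = - orientation" if "w \<in> V" "w \<noteq> v0" for w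
    using index_off_own_face[OF v0(1) that] zero[OF v0(1)] by simp
  show ?thesis
  proof (rule that[OF v0(1)])
    fix q v assume q: "q \<in> outside dual.D" and v: "v \<in> V"
    have "q \<notin> dual.D" using q by (auto simp: outside_def)
    then obtain X where X: "X \<in> dual_faces" "q \<in> X" by (rule dual.point_in_face)
    show "index v q = 0" using index_unbounded[OF v X(1) _ X(2)] outside_iff_unbounded_face[OF X] q by simp
  next
    fix q assume q: "q \<notin> dual.D" "q \<notin> outside dual.D"
    obtain X where X: "X \<in> dual_faces" "q \<in> X" using q(1) by (rule dual.point_in_face)
    obtain v1 where v1: "v1 \<in> V" "X = dual_face v1" by (rule every_face_is_dual_face[OF X(1)])
    have "bounded X" using outside_iff_unbounded_face[OF X] q(2) by simp
    then have ne: "v1 \<noteq> v0" using Out(2) v0(2) v1(2) by auto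
    have on: "index v q = index_on v (dual_face v1)" if "v \<in> V" for v
      using index_on_eq[OF that X] v1(2) by simp
    show "\<exists>v1\<in>V. v1 \<noteq> v0 \<and> index v1 q = orientation \<and>
       index v0 q = - orientation \<and> (\<forall>v\<in>V. v \<noteq> v0 \<longrightarrow> v \<noteq> v1 \<longrightarrow> index v q = 0)"
      by (intro bexI[of _ v1] conjI ballI impI) (use v1 ne on own outer other v0 in auto)
  next
    fix v assume v: "v \<in> V" "v \<noteq> v0"
    obtain q where q: "q \<in> dual_face v" using dual.face_nonempty[OF dual_face_in[OF v(1)]] by blast
    have "q \<notin> dual.D" using dual.face_disjoint[OF dual_face_in[OF v(1)]] q by blast
    then show "\<exists>q. q \<notin> dual.D \<and> index v q = orientation"
      using index_on_eq[OF v(1) dual_face_in[OF v(1)] q] own[OF v] by auto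
  qed
qed

end

section \<open>Local maxima, the orientation and the peak\<close>

lemma inner_mult_complex: "(z * e) \<bullet> (w * e) = (norm e)\<^sup>2 * (z \<bullet> w)" for z w e :: complex
  unfolding cmod_power2 inner_complex_def by (simp add: algebra_simps power2_eq_square)

text \<open>A linear form that is nonpositive on the left of \<open>e\<close> is a nonpositive multiple of the left normal.\<close>

lemma nonpositive_on_halfplane:
  assumes e: "e \<noteq> 0" and le: "\<And>w. 0 < Im w \<Longrightarrow> A \<bullet> (w * e) \<le> 0"
  obtains \<kappa> where "\<kappa> \<le> 0" "A = \<kappa> *\<^sub>R (\<i> * e)"
proof -
  define z where "z = A / e"
  have A: "A = z * e" using e by (simp add: z_def)
  have zw: "z \<bullet> w \<le> 0" if "0 < Im w" for w
  proof -
    have "(norm e)\<^sup>2 * (z \<bullet> w) \<le> 0" using le[OF that] unfolding A inner_mult_complex .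
    then show ?thesis using e by (simp add: mult_le_0_iff)
  qed
  have "Re z = 0"
  proof (rule ccontr)
    assume nz: "Re z \<noteq> 0"
    have "z \<bullet> Complex ((1 - Im z) / Re z) 1 \<le> 0" by (rule zw) simp
    moreover have "z \<bullet> Complex ((1 - Im z) / Re z) 1 = 1" using nz by (simp add: inner_complex_def)
    ultimately show False by simp
  qed
  moreover have "Im z \<le> 0" using zw[of \<i>] by (simp add: inner_complex_def)
  ultimately show ?thesis
    by (intro that[of "Im z"]) (simp_all add: A complex_eq_iff)
qed

lemma between_opposite_multiples:
  fixes x y q d :: "'a::real_vector"
  assumes "x - q = \<kappa> *\<^sub>R d" "y - q = \<kappa>' *\<^sub>R d" "\<kappa> \<le> 0" "0 \<le> \<kappa>'"
  shows "q \<in> closed_segment x y"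
proof (cases "\<kappa> = \<kappa>'")
  case True
  then have "x = q" using assms by simp
  then show ?thesis by simp
next
  case False
  define u where "u = - \<kappa> / (\<kappa>' - \<kappa>)"
  have pos: "0 < \<kappa>' - \<kappa>" using False assms by simp
  have u: "0 \<le> u" "u \<le> 1" "\<kappa> + u * (\<kappa>' - \<kappa>) = 0"
    using pos assms unfolding u_def by (simp_all add: field_simps)
  have "(1 - u) *\<^sub>R x + u *\<^sub>R y = q + (1 - u) *\<^sub>R (x - q) + u *\<^sub>R (y - q)"
    by (simp add: algebra_simps)
  also have "\<dots> = q + (\<kappa> + u * (\<kappa>' - \<kappa>)) *\<^sub>R d" unfolding assms(1,2) by (simp add: algebra_simps)
  finally show ?thesis unfolding in_segment u(3) using u(1,2) by (intro exI[of _ u]) simp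
qed

context reciprocal_lifting begin

lemma gradient_in_drawing: "F \<in> faces V E p \<Longrightarrow> m F \<in> dual.D"
  by (simp add: drawing_def)

text \<open>Subtract the linear function with gradient \<open>q\<close> from \<open>h\<close>. The difference has a local maximum in the
  interior of a face only if the gradient of the face is \<open>q\<close>, and at an interior point of an edge only if \<open>q\<close> lies on the
  segment between the gradients of the two faces. Both are excluded for general \<open>q\<close>. At a vertex, a
  local maximum has no zeros around it, which is index \<open>1\<close>.\<close>

lemma local_max_at_vertex:
  assumes q: "q \<notin> dual.D" and \<delta>: "0 < \<delta>"
    and max: "\<And>y. dist x y < \<delta> \<Longrightarrow> h y - q \<bullet> y \<le> h x - q \<bullet> x"
  obtains u where "u \<in> V" "x = p u" "index u q = 1"
proof -
  have le: "h (x + z) - h x \<le> q \<bullet> z" if "norm z < \<delta>" for z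
    using max[of "x + z"] that by (simp add: dist_norm inner_add_right)
  have "x \<in> p ` V"
  proof (rule ccontr)
    assume nv: "x \<notin> p ` V"
    show False
    proof (cases "x \<in> D")
      case False
      then obtain F where F: "F \<in> faces V E p" "x \<in> F" by (rule point_in_face)
      then obtain \<delta>' where \<delta>': "0 < \<delta>'" "ball x \<delta>' \<subseteq> F" using open_face open_contains_ball by blast
      define A where "A = m F - q"
      define t where "t = min \<delta> \<delta>' / (2 * (1 + norm A))"
      have t: "0 < t" "t * norm A < min \<delta> \<delta>'"
      proof -
        have "0 < min \<delta> \<delta>'" using \<delta> \<delta>'(1) by simp
        then show "0 < t" unfolding t_def by (simp add: add_pos_nonneg)
        have pos: "0 < 1 + norm A" by (simp add: add_pos_nonneg)
        have "t * norm A = min \<delta> \<delta>' * (norm A / (2 * (1 + norm A)))" by (simp add: t_def)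
        also have "\<dots> < min \<delta> \<delta>' * 1"
          using \<open>0 < min \<delta> \<delta>'\<close> pos by (intro mult_strict_left_mono) (simp_all add: divide_less_eq)
        finally show "t * norm A < min \<delta> \<delta>'" by simp
      qed
      have n: "norm (t *\<^sub>R A) < min \<delta> \<delta>'" using t by simp
      then have "x + t *\<^sub>R A \<in> F" using \<delta>'(2) by (auto simp: dist_norm)
      then have "h (x + t *\<^sub>R A) - h x = m F \<bullet> (t *\<^sub>R A)"
        using affine_on_closure[OF F(1), of x "x + t *\<^sub>R A"] F(2) closure_subset by fastforce
      then have "m F \<bullet> (t *\<^sub>R A) \<le> q \<bullet> (t *\<^sub>R A)" using le[of "t *\<^sub>R A"] n by simp
      then have "A \<bullet> (t *\<^sub>R A) \<le> 0" by (simp add: A_def inner_diff_left right_diff_distrib)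
      then have "A \<bullet> A \<le> 0" using t(1) by (simp add: mult_le_0_iff)
      then have "A = 0" using inner_ge_zero[of A] by simp
      then have "m F = q" by (simp add: A_def)
      then show False using gradient_in_drawing[OF F(1)] q by simp
    next
      case True
      then obtain e0 where e0: "e0 \<in> E" "x \<in> edge_segment p e0" using nv unfolding drawing_def by blast
      obtain i j where ij: "e0 = {i, j}" by (rule edge_obtain[OF e0(1)])
      obtain s where s: "0 \<le> s" "s \<le> 1" "x = (1 - s) *\<^sub>R p i + s *\<^sub>R p j"
        using e0(2) unfolding ij edge_segment_eq in_segment by blast
      have E: "{i, j} \<in> E" using e0 ij by simp
      have ends: "i \<in> V" "j \<in> V" "p i \<noteq> p j" using edge_ends[OF E] by auto
      have "s \<noteq> 0" "s \<noteq> 1" using s(3) nv ends by auto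
      then have s01: "0 < s" "s < 1" using s by auto
      define e where "e = p j - p i"
      have e_nz: "e \<noteq> 0" using ends by (simp add: e_def)
      have xs: "x = p i + of_real s * e" using s(3) by (simp add: e_def algebra_simps scaleR_conv_of_real)
      obtain \<delta>' where \<delta>': "0 < \<delta>'"
        "\<And>w. \<lbrakk>norm w < \<delta>'; 0 < Im w\<rbrakk> \<Longrightarrow> p i + (of_real s + w) * (p j - p i) \<in> left i j"
        "\<And>w. \<lbrakk>norm w < \<delta>'; Im w < 0\<rbrakk> \<Longrightarrow> p i + (of_real s + w) * (p j - p i) \<in> left j i"
        by (rule edge_point_sides[OF E s01], rule that)
      have side: "(m F - q) \<bullet> (w * e) \<le> 0"
        if F: "F \<in> faces V E p" and w: "w \<noteq> 0" and on: "\<And>t. \<lbrakk>0 < t; norm (of_real t * w) < \<delta>'\<rbrakk> \<Longrightarrow> x + of_real t * w * e \<in> F" for F w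
      proof -
        define M where "M = min (\<delta> / norm e) \<delta>' / norm w"
        have M: "0 < M" using \<delta> \<delta>'(1) e_nz w by (simp add: M_def)
        have small: "norm (of_real t * w) < \<delta>'" "norm (of_real t * w * e) < \<delta>" if "0 < t" "t < M" for t
        proof -
          have "t * norm w < min (\<delta> / norm e) \<delta>'" using that w by (simp add: M_def pos_less_divide_eq)
          then have "t * norm w < \<delta>'" "t * norm w < \<delta> / norm e" by auto
          then show "norm (of_real t * w) < \<delta>'" "norm (of_real t * w * e) < \<delta>"
            using that(1) e_nz by (simp_all add: norm_mult pos_less_divide_eq)
        qed
        have "((\<lambda>t. x + of_real t * w * e) \<longlongrightarrow> x + of_real 0 * w * e) (at_right 0)"
          by (intro tendsto_intros)
        moreover have "\<forall>\<^sub>F t in at_right 0. x + of_real t * w * e \<in> F"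
          by (rule eventually_at_rightI[of 0 M]) (use M small on in auto)
        ultimately have "x \<in> closure F"
          using Lim_in_closed_set[OF closed_closure, of "\<lambda>t. x + of_real t * w * e" F "at_right 0" "x + of_real 0 * w * e"]
          by (simp add: trivial_limit_at_right_real) (metis (mono_tags, lifting) closure_subset eventually_mono subsetD)
        moreover define t where "t = M / 2"
        have t: "0 < t" "t < M" using M by (auto simp: t_def)
        have "x + of_real t * w * e \<in> F" using on[OF t(1) small(1)[OF t]] .
        ultimately have "h (x + of_real t * w * e) - h x = m F \<bullet> (of_real t * w * e)"
          using affine_on_closure[OF F, of x "x + of_real t * w * e"] closure_subset[of F] by auto
        then have "m F \<bullet> (of_real t * w * e) \<le> q \<bullet> (of_real t * w * e)" using le[OF small(2)[OF t]] by simp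
        then have "(m F - q) \<bullet> (t *\<^sub>R (w * e)) \<le> 0"
          by (simp add: inner_diff_left scaleR_conv_of_real mult.assoc)
        then show ?thesis using t(1) by (simp add: mult_le_0_iff)
      qed
      have pt: "x + of_real t * w * e = p i + (of_real s + of_real t * w) * (p j - p i)" for t w
        unfolding xs e_def by (simp add: algebra_simps)
      have "(m (left i j) - q) \<bullet> (w * e) \<le> 0" if "0 < Im w" for w
        by (rule side[OF left_in_faces[OF E]]) (use that \<delta>'(2) in \<open>auto simp: pt\<close>)
      then obtain \<kappa> where \<kappa>: "\<kappa> \<le> 0" "m (left i j) - q = \<kappa> *\<^sub>R (\<i> * e)"
        by (rule nonpositive_on_halfplane[OF e_nz])
      have "left j i \<in> faces V E p" using left_in_faces[of j i] E by (simp add: insert_commute)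
      have R: "(m (left j i) - q) \<bullet> (w * e) \<le> 0" if "Im w < 0" for w
        by (rule side[OF \<open>left j i \<in> faces V E p\<close>]) (use that \<delta>'(3) in \<open>auto simp: pt mult_pos_neg\<close>)
      have "(m (left j i) - q) \<bullet> (w * (- e)) \<le> 0" if "0 < Im w" for w using R[of "- w"] that by simp
      then obtain \<kappa>' where \<kappa>': "\<kappa>' \<le> 0" "m (left j i) - q = \<kappa>' *\<^sub>R (\<i> * (- e))"
        using nonpositive_on_halfplane[of "- e" "m (left j i) - q"] e_nz by auto
      have "q \<in> closed_segment (m (left i j)) (m (left j i))"
        by (rule between_opposite_multiples[OF \<kappa>(2), of _ "- \<kappa>'"]) (use \<kappa> \<kappa>' in auto)
      then have "q \<in> closed_segment (m (left j i)) (m (left i j))" by (subst closed_segment_commute)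
      then show False using general_off_dual_edges[OF q, of i] E unfolding off_dual_edges_def by blast
    qed
  qed
  then obtain u where u: "u \<in> V" "x = p u" by blast
  obtain l \<rho> a where cone: "cone_point h (p u) l \<rho>"
    "\<And>q. q \<notin> dual.D \<Longrightarrow> cone_point.alternating l q a"
    "\<And>q. q \<notin> dual.D \<Longrightarrow> real (card (cone_point.zeros l q a)) = 2 - 2 * index u q"
    by (rule general_vertex_cone[OF u(1)], rule that)
  interpret cone_point h "p u" l \<rho> by (rule cone(1))
  have "l (cis \<theta>) \<le> q \<bullet> cis \<theta>" for \<theta>
  proof -
    define t where "t = min \<delta> \<rho> / 2"
    have t: "0 < t" "t < \<delta>" "t < \<rho>" using \<delta> \<rho> by (auto simp: t_def)
    have "h (p u + of_real t * cis \<theta>) - h (p u) \<le> q \<bullet> (of_real t * cis \<theta>)"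
      using le[of "of_real t * cis \<theta>"] t unfolding u(2) by (simp add: norm_mult)
    then have "l (of_real t * cis \<theta>) \<le> q \<bullet> (t *\<^sub>R cis \<theta>)"
      using local_form[of "of_real t * cis \<theta>"] t by (simp add: norm_mult scaleR_conv_of_real)
    then show ?thesis using l_homog[OF t(1), of "cis \<theta>"] t(1) by simp
  qed
  then have "zeros q a = {}" by (rule alternating_touches_no_plane[OF cone(2)[OF q]])
  then have "index u q = 1" using cone(3)[OF q] by simp
  then show ?thesis by (rule that[OF u])
qed

end

text \<open>Here \<open>stress\<close> is the self-stress with the sign that makes it positive on the boundary.\<close>

locale standard_reciprocal_lifting = reciprocal_lifting V E p h m
  for V :: "'v set" and E :: "'v set set" and p :: "'v \<Rightarrow> complex"
    and h :: "complex \<Rightarrow> real" and m :: "complex set \<Rightarrow> complex" +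
  fixes stress :: "'v set \<Rightarrow> real"
  assumes outer_zero: "\<lbrakk>F \<in> faces V E p; \<not> bounded F; x \<in> F\<rbrakk> \<Longrightarrow> h x = 0"
    and gradient_jump: "{i, j} \<in> E \<Longrightarrow> m (left i j) - m (left j i) = stress {i, j} *\<^sub>R (\<i> * (p j - p i))"
    and boundary_positive: "\<lbrakk>e \<in> E; boundary_edge V E p e\<rbrakk> \<Longrightarrow> 0 < stress e"
begin

text \<open>A half-plane that contains no vertex in its interior belongs to the closure of an unbounded face.\<close>

lemma zero_on_halfplane:
  assumes a: "a \<noteq> 0" and b: "\<And>v. v \<in> V \<Longrightarrow> a \<bullet> p v \<le> b" and x: "b \<le> a \<bullet> x"
  shows "h x = 0"
proof -
  define H where "H = {z. a \<bullet> z > b}"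
  have "D \<subseteq> {z. a \<bullet> z \<le> b}"
  proof -
    have "edge_segment p e \<subseteq> {z. a \<bullet> z \<le> b}" if e: "e \<in> E" for e
    proof (rule hull_minimal)
      obtain i j where "e = {i, j}" by (rule edge_obtain[OF e])
      then show "p ` e \<subseteq> {z. a \<bullet> z \<le> b}" using edge_ends[of i j] e b by auto
    qed (rule convex_halfspace_le)
    then show ?thesis using b unfolding drawing_def by blast
  qed
  then have HD: "H \<inter> D = {}" by (force simp: H_def)
  have aa: "0 < a \<bullet> a" using a by simp
  have ray: "((b + 1 + t) / (a \<bullet> a)) *\<^sub>R a \<in> H" if "0 \<le> t" for t
    using aa that by (simp add: H_def)
  then have "((b + 1) / (a \<bullet> a)) *\<^sub>R a \<in> H" using ray[of 0] by simp
  moreover from this obtain F where F: "F \<in> faces V E p" "((b + 1) / (a \<bullet> a)) *\<^sub>R a \<in> F"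
    using point_in_face HD by blast
  moreover have "connected H" unfolding H_def by (intro convex_connected convex_halfspace_gt)
  ultimately have HF: "H \<subseteq> F" using connected_in_face[OF _ HD F(1)] by blast
  have "\<not> bounded F"
  proof
    assume "bounded F"
    then obtain B where B: "\<And>y. y \<in> F \<Longrightarrow> norm y \<le> B" unfolding bounded_iff by blast
    define t where "t = \<bar>b + 1\<bar> + (\<bar>B\<bar> + 1) * norm a"
    have "0 < norm a" using a by simp
    then have "\<bar>B\<bar> * norm a < b + 1 + t" unfolding t_def distrib_right by linarith
    moreover have "((b + 1 + t) / (a \<bullet> a)) *\<^sub>R a \<in> F" using ray[of t] HF by (auto simp: t_def)
    from B[OF this] have "\<bar>b + 1 + t\<bar> / norm a \<le> B" using a
      by (simp add: dot_square_norm power2_eq_square)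
    then have "\<bar>b + 1 + t\<bar> \<le> B * norm a" using a by (simp add: pos_divide_le_eq)
    moreover have "B * norm a \<le> \<bar>B\<bar> * norm a" by (intro mult_right_mono) auto
    ultimately show False by linarith
  qed
  then have zero: "\<And>y. y \<in> H \<Longrightarrow> h y = 0" using outer_zero[OF F(1)] HF by blast
  have "continuous_on (closure H) h" using cont_h by (rule continuous_on_subset) simp
  from continuous_constant_on_closure[OF this zero]
  have "h x = 0" if "x \<in> closure H" using that by blast
  moreover have "closure H = {z. a \<bullet> z \<ge> b}" unfolding H_def using a by (intro closure_halfspace_gt)
  ultimately show ?thesis using x by simp
qed

text \<open>The surface is flat over the half-plane bounded by the line through \<open>p u\<close> perpendicular to \<open>a\<close>. Along
  the two opposite directions of this line the height above a plane of gradient \<open>q\<close> takes opposite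
  values, so it is zero somewhere around \<open>u\<close>.\<close>

lemma extreme_vertex_index:
  assumes u: "u \<in> V" and a: "a \<noteq> 0" "\<And>v. v \<in> V \<Longrightarrow> a \<bullet> p v \<le> a \<bullet> p u" and q: "q \<notin> dual.D"
  shows "index u q \<noteq> 1"
proof
  assume one: "index u q = 1"
  obtain l \<rho> b where cone: "cone_point h (p u) l \<rho>"
    "\<And>q. q \<notin> dual.D \<Longrightarrow> cone_point.alternating l q b"
    "\<And>q. q \<notin> dual.D \<Longrightarrow> real (card (cone_point.zeros l q b)) = 2 - 2 * index u q"
    by (rule general_vertex_cone[OF u], rule that)
  interpret cone_point h "p u" l \<rho> by (rule cone(1))
  have "finite (zeros q b)" using cone(2)[OF q] by (simp add: alternating_def)
  then have empty: "zeros q b = {}" using cone(3)[OF q] one by simp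
  define \<phi> where "\<phi> = Arg (\<i> * a)"
  have "cis \<phi> = \<i> * a / of_real (norm a)" using a(1) by (simp add: \<phi>_def cis_Arg sgn_eq norm_mult)
  then have perp: "a \<bullet> cis \<phi> = 0" using a(1) by (simp add: inner_complex_def)
  have zero: "l (cis \<theta>) = 0" if "a \<bullet> cis \<theta> = 0" for \<theta>
  proof -
    have half: "0 < \<rho> / 2" "norm (of_real (\<rho> / 2) * cis \<theta>) < \<rho>" using \<rho> by (simp_all add: norm_mult)
    have "a \<bullet> ((\<rho> / 2) *\<^sub>R cis \<theta>) = 0" using that by simp
    then have "a \<bullet> (of_real (\<rho> / 2) * cis \<theta>) = 0" by (simp add: scaleR_conv_of_real)
    then have "h (p u + of_real (\<rho> / 2) * cis \<theta>) = 0" "h (p u) = 0"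
      using zero_on_halfplane[OF a] by (simp_all add: inner_add_right)
    then have "l (of_real (\<rho> / 2) * cis \<theta>) = 0" using local_form[OF half(2)] by simp
    then show ?thesis using l_homog[OF half(1), of "cis \<theta>"] \<rho> by simp
  qed
  have opp: "cis (\<phi> + pi) = - cis \<phi>" by (simp add: cis.ctr complex_eq_iff)
  have l0: "l (cis \<phi>) = 0" "l (cis (\<phi> + pi)) = 0" using zero[of \<phi>] zero[of "\<phi> + pi"] perp opp by simp_all
  have "q \<bullet> cis \<phi> \<noteq> 0" using no_zeros[OF empty, of \<phi>] l0 by simp
  then consider "0 < q \<bullet> cis \<phi>" | "0 < q \<bullet> cis (\<phi> + pi)" unfolding opp by fastforce
  then show False
  proof cases
    case 1
    then show False using sign_constant_without_zeros[OF empty, of \<phi> "\<phi> + pi"] l0 opp by simp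
  next
    case 2
    then show False using sign_constant_without_zeros[OF empty, of "\<phi> + pi" \<phi>] l0 opp by simp
  qed
qed

text \<open>Across a boundary edge the surface rises from height \<open>0\<close>, because the stress is positive there.\<close>

lemma positive_somewhere: "\<exists>x. 0 < h x"
proof -
  have "bounded (- (- D))" using compact_D compact_imp_bounded by simp
  from cobounded_unbounded_components[OF this]
  obtain F where F: "F \<in> faces V E p" "\<not> bounded F" unfolding faces_def by blast
  have "V \<noteq> {}" using two_conn by (auto simp: two_connected_def)
  then obtain v where "v \<in> V" by blast
  then obtain w where vw: "{v, w} \<in> E" by (rule neighbour_exists)
  have "F \<in> {left i j | i j. {i, j} \<in> E}"
  proof (rule faces_crossing_induct[OF left_in_faces[OF vw] _ F(1)])
    show "left v w \<in> {left i j | i j. {i, j} \<in> E}" using vw by blast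
    show "left j i \<in> {left i j | i j. {i, j} \<in> E}" if "{i, j} \<in> E" for i j
    proof -
      have "{j, i} \<in> E" using that by (simp add: insert_commute)
      then show ?thesis by blast
    qed
  qed
  then obtain i j where ij: "{i, j} \<in> E" "F = left i j" by blast
  have "boundary_edge V E p {i, j}" unfolding boundary_edge_def
    using left_face_left[OF ij(1)] F(2) ij(2) by blast
  then have pos: "0 < stress {i, j}" using boundary_positive ij(1) by blast
  define e where "e = p j - p i"
  define x where "x = midpoint (p i) (p j)"
  have e0: "e \<noteq> 0" using edge_ends[OF ij(1)] by (simp add: e_def)
  have ji: "{j, i} \<in> E" using ij(1) by (simp add: insert_commute)
  have cl: "x \<in> closure G" if ev: "\<forall>\<^sub>F \<epsilon> in at_right 0. x + \<epsilon> *\<^sub>R d \<in> G" for d G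
  proof -
    have "((\<lambda>\<epsilon>. x + \<epsilon> *\<^sub>R d) \<longlongrightarrow> x + 0 *\<^sub>R d) (at_right 0)" by (intro tendsto_intros)
    moreover have "\<forall>\<^sub>F \<epsilon> in at_right 0. x + \<epsilon> *\<^sub>R d \<in> closure G"
      using ev by eventually_elim (use closure_subset in auto)
    ultimately have "x + 0 *\<^sub>R d \<in> closure G"
      by (intro Lim_in_closed_set[OF closed_closure]) (auto simp: trivial_limit_at_right_real)
    then show ?thesis by simp
  qed
  have L: "\<forall>\<^sub>F \<epsilon> in at_right 0. x + \<epsilon> *\<^sub>R (\<i> * e) \<in> left i j"
    using left_face_left[OF ij(1)] by (simp add: left_face_def x_def e_def)
  have R: "\<forall>\<^sub>F \<epsilon> in at_right 0. x + \<epsilon> *\<^sub>R (- (\<i> * e)) \<in> left j i"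
    using left_face_left[OF ji] by (simp add: left_face_def x_def e_def midpoint_sym algebra_simps)
  have hx: "h x = 0"
  proof -
    have zero: "\<And>y. y \<in> F \<Longrightarrow> h y = 0" using outer_zero[OF F] by blast
    have "continuous_on (closure F) h" using cont_h by (rule continuous_on_subset) simp
    from continuous_constant_on_closure[OF this zero] show ?thesis using cl[OF L] ij(2) by blast
  qed
  have mL: "m F = 0"
  proof (rule ccontr)
    assume nz: "m F \<noteq> 0"
    obtain y where y: "y \<in> F" using face_nonempty[OF F(1)] by blast
    obtain r where r: "0 < r" "ball y r \<subseteq> F" using open_face[OF F(1)] y open_contains_ball by blast
    define z where "z = (r / (2 * norm (m F))) *\<^sub>R m F"
    have "norm z < r" using r nz by (simp add: z_def)
    then have "y + z \<in> F" using r(2) by (auto simp: dist_norm)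
    then have "h (y + z) - h y = m F \<bullet> z"
      using affine_on_closure[OF F(1), of y "y + z"] y closure_subset[of F] by auto
    then have "m F \<bullet> z = 0" using outer_zero[OF F y] outer_zero[OF F \<open>y + z \<in> F\<close>] by simp
    then show False using r nz by (simp add: z_def)
  qed
  have mR: "m (left j i) = - (stress {i, j} *\<^sub>R (\<i> * e))"
    using gradient_jump[OF ij(1)] mL ij(2) by (simp add: e_def algebra_simps)
  have "\<forall>\<^sub>F \<epsilon> in at_right (0::real). 0 < \<epsilon> \<and> x + \<epsilon> *\<^sub>R (- (\<i> * e)) \<in> left j i"
    using R eventually_at_right_less[of "0::real"] by eventually_elim simp
  then obtain \<epsilon> where \<epsilon>: "0 < \<epsilon>" "x + \<epsilon> *\<^sub>R (- (\<i> * e)) \<in> left j i"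
    using eventually_happens'[of "at_right (0::real)"] by (force simp: trivial_limit_at_right_real)
  have "h (x + \<epsilon> *\<^sub>R (- (\<i> * e))) - h x = m (left j i) \<bullet> (\<epsilon> *\<^sub>R (- (\<i> * e)))"
    using affine_on_closure[OF left_in_faces[OF ji] cl[OF R], of "x + \<epsilon> *\<^sub>R (- (\<i> * e))"] \<epsilon>(2)
      closure_subset[of "left j i"] by auto
  also have "\<dots> = stress {i, j} * \<epsilon> * ((\<i> * e) \<bullet> (\<i> * e))" unfolding mR by simp
  finally have "h (x + \<epsilon> *\<^sub>R (- (\<i> * e))) = stress {i, j} * \<epsilon> * ((\<i> * e) \<bullet> (\<i> * e))" using hx by simp
  moreover have "0 < stress {i, j} * \<epsilon> * ((\<i> * e) \<bullet> (\<i> * e))" using pos \<epsilon>(1) e0 by simp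
  ultimately show ?thesis by metis
qed

text \<open>With positive orientation, all vertices other than \<open>v0\<close> would have index \<open>1\<close> somewhere. But for any
  other vertex \<open>v1\<close>, a vertex that is extreme in the direction from \<open>v0\<close> to \<open>v1\<close> differs from \<open>v0\<close>.\<close>

lemma orientation_negative: "orientation = -1"
proof (rule ccontr)
  assume "orientation \<noteq> -1"
  then have one: "orientation = 1" by (simp add: orientation_def split: if_splits)
  obtain v0 where v0: "v0 \<in> V"
    and own: "\<And>v. \<lbrakk>v \<in> V; v \<noteq> v0\<rbrakk> \<Longrightarrow> \<exists>q. q \<notin> dual.D \<and> index v q = orientation"
    by (rule index_distribution) blast
  have "3 \<le> card V" using two_conn by (simp add: two_connected_def)
  then have "\<not> V \<subseteq> {v0}" using card_mono[of "{v0}" V] by auto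
  then obtain v1 where v1: "v1 \<in> V" "v1 \<noteq> v0" by blast
  define a where "a = p v1 - p v0"
  have a: "a \<noteq> 0" using inj_p[OF v1(1) v0] v1(2) by (auto simp: a_def)
  define M where "M = Max ((\<lambda>v. a \<bullet> p v) ` V)"
  have "M \<in> (\<lambda>v. a \<bullet> p v) ` V" unfolding M_def using finite_V v0 by (intro Max_in) auto
  then obtain u where u: "u \<in> V" "M = a \<bullet> p u" by blast
  have max: "a \<bullet> p v \<le> a \<bullet> p u" if "v \<in> V" for v
    unfolding u(2)[symmetric] M_def using that finite_V by (intro Max_ge) auto
  have "0 < a \<bullet> p v1 - a \<bullet> p v0" using a by (simp add: a_def inner_diff_right[symmetric])
  then have "u \<noteq> v0" using max[OF v1(1)] by auto
  then obtain q where "q \<notin> dual.D" "index u q = orientation" using own u(1) by blast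
  then show False using extreme_vertex_index[OF u(1) a max] one by simp
qed

lemma zero_far_away:
  assumes R: "D \<subseteq> ball 0 R" and x: "R \<le> norm x"
  shows "h x = 0"
proof -
  have c: "connected (- ball (0::complex) R)" by (rule connected_complement_bounded_convex) auto
  have "x \<in> - ball 0 R" using x by simp
  moreover have "(- ball 0 R) \<inter> D = {}" using R by blast
  moreover from calculation obtain F where F: "F \<in> faces V E p" "x \<in> F" using point_in_face by blast
  ultimately have sub: "- ball 0 R \<subseteq> F" using connected_in_face[OF c] by blast
  have "\<not> bounded F"
  proof
    assume "bounded F"
    then have "bounded (- ball (0::complex) R)" using sub bounded_subset by blast
    then show False using cobounded_imp_unbounded[of "- ball (0::complex) R"] by simp
  qed
  then show ?thesis using outer_zero[OF F(1) _ F(2)] by blast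
qed

text \<open>Choose a small general \<open>q\<close> with \<open>q \<bullet> (p peak - p v0) < 0\<close>. The maximum of \<open>h x - q \<bullet> x\<close> over a large disk is not
  attained near the boundary, where \<open>h\<close> is zero, so it is attained at a vertex of index \<open>1\<close>, which is \<open>v0\<close>. But
  the value at the peak would be larger.\<close>

lemma peak_unique:
  assumes v0: "v0 \<in> V" and only: "\<And>u q. \<lbrakk>u \<in> V; q \<notin> dual.D; index u q = 1\<rbrakk> \<Longrightarrow> u = v0"
    and peak: "is_peak V p h peak"
  shows "peak = v0"
proof (rule ccontr)
  assume ne: "peak \<noteq> v0"
  have pk: "peak \<in> V" "\<And>x. h x \<le> h (p peak)" using peak by (auto simp: is_peak_def)
  define d where "d = p peak - p v0"
  have d: "d \<noteq> 0" using inj_p[OF pk(1) v0] ne by (auto simp: d_def)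
  define M where "M = h (p peak)"
  have M: "0 < M" using positive_somewhere pk(2) unfolding M_def by (meson less_le_trans)
  obtain R where R: "0 < R" "D \<subseteq> ball 0 R"
    using compact_imp_bounded[OF compact_D] bounded_subset_ballD[of D 0] by blast
  \<comment> \<open>small enough for the boundary of the disk, and tilted in favour of the peak\<close>
  define Q where "Q = ball 0 (M / (2 * R)) \<inter> {q. d \<bullet> q < 0}"
  have "open Q" unfolding Q_def by (intro open_Int open_ball open_halfspace_lt)
  moreover have "- (M / (4 * R * norm d)) *\<^sub>R d \<in> Q"
  proof -
    have "norm (- (M / (4 * R * norm d)) *\<^sub>R d) = M / (4 * R)" using M R d by simp
    also have "\<dots> < M / (2 * R)" using M R by (simp add: field_simps)
    finally show ?thesis using M R d by (simp add: Q_def)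
  qed
  ultimately have "\<not> negligible Q" using open_not_negligible by blast
  then have "\<not> Q \<subseteq> dual.D" using negligible_subset[OF dual.negligible_D] by blast
  then obtain q where q: "q \<in> Q" "q \<notin> dual.D" by blast
  have qR: "2 * (norm q * R) < M" using q(1) R(1) by (simp add: Q_def field_simps)
  have qd: "q \<bullet> d < 0" using q(1) by (simp add: Q_def inner_commute)
  define f where "f y = h y - q \<bullet> y" for y
  have "continuous_on (cball 0 R) f" unfolding f_def
    by (intro continuous_intros continuous_on_subset[OF cont_h]) auto
  moreover have "cball (0::complex) R \<noteq> {}" using R by simp
  ultimately obtain x where x: "x \<in> cball 0 R" "\<And>y. y \<in> cball 0 R \<Longrightarrow> f y \<le> f x"
    using continuous_attains_sup[of "cball 0 R" f] compact_cball by blast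
  have D_in: "p v \<in> cball 0 R" if "v \<in> V" for v
    using R(2) that by (auto simp: drawing_def)
  have bound: "\<bar>q \<bullet> y\<bar> \<le> norm q * R" if "y \<in> cball 0 R" for y
  proof -
    have "\<bar>q \<bullet> y\<bar> \<le> norm q * norm y" by (rule Cauchy_Schwarz_ineq2)
    also have "\<dots> \<le> norm q * R" using that by (intro mult_left_mono) auto
    finally show ?thesis .
  qed
  have "f (p peak) \<le> f x" using x(2) D_in pk(1) by blast
  then have "0 < h x" using bound[OF D_in[OF pk(1)]] bound[OF x(1)] qR unfolding f_def M_def by linarith
  then have "norm x < R" using zero_far_away[OF R(2), of x] by force
  then have "0 < R - norm x" by simp
  moreover have "h y - q \<bullet> y \<le> h x - q \<bullet> x" if "dist x y < R - norm x" for y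
  proof -
    have "norm y \<le> norm x + norm (y - x)" by (rule norm_triangle_sub)
    then have "y \<in> cball 0 R" using that by (simp add: dist_norm norm_minus_commute)
    then show ?thesis using x(2) by (simp add: f_def)
  qed
  ultimately obtain u where u: "u \<in> V" "x = p u" "index u q = 1"
    using local_max_at_vertex[OF q(2)] by blast
  have "u = v0" by (rule only[OF u(1) q(2) u(3)])
  then have "f (p peak) \<le> f (p v0)" using \<open>f (p peak) \<le> f x\<close> u(2) by simp
  then have "0 \<le> q \<bullet> d" using pk(2)[of "p v0"] by (simp add: f_def d_def inner_diff_right)
  then show False using qd by simp
qed

text \<open>The unbounded face is connected and misses its own frontier, so a point of it lies outside the
  boundary cycle.\<close>

lemma interior_directions_bounded:
  assumes "q \<in> interior_directions dual.D" shows "q \<notin> outside dual.D"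
proof
  assume q: "q \<in> outside dual.D"
  have b: "bounded dual.D" using dual.compact_D compact_imp_bounded by blast
  have "open (outside dual.D)" by (rule open_outside[OF dual.closed_D])
  then have "outside dual.D \<inter> frontier (outside dual.D) = {}" by (simp add: frontier_def interior_open)
  then have "outside dual.D \<subseteq> connected_component_set (- frontier (outside dual.D)) q"
    using q by (intro connected_component_maximal connected_outside[OF b]) auto
  moreover have "bounded (connected_component_set (- frontier (outside dual.D)) q)"
    using assms by (simp add: interior_directions_def inside_def)
  ultimately have "bounded (outside dual.D)" using bounded_subset by blast
  then show False using unbounded_outside[OF b] by simp
qed

text \<open>The theorem for a Maxwell reciprocal whose drawing itself is known to be non-crossing and dual.\<close>

theorem cut_by_planes:
  assumes peak: "is_peak V p h peak"
  shows "(\<forall>v\<in>V. v \<noteq> peak \<longrightarrow> (\<exists>q. cuts_saddle h (p v) q)) \<and>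
    (\<forall>v\<in>V. \<forall>n. n \<noteq> 0 \<longrightarrow> (\<exists>k\<le>4. cuts_into h (p v) n k)) \<and>
    (\<forall>q\<in>interior_directions dual.D. q \<notin> dual.D \<longrightarrow>
         (\<exists>!v. v \<in> V \<and> cuts_saddle h (p v) q) \<and>
         (\<forall>v\<in>V. \<not> cuts_saddle h (p v) q \<and> v \<noteq> peak \<longrightarrow> cuts_into h (p v) (q, -1) 2) \<and>
         lies_below h (p peak) q) \<and>
    (\<forall>q\<in>outer_directions dual.D. \<forall>v\<in>V. cuts_into h (p v) (q, -1) 2)"
proof -
  obtain v0 where v0: "v0 \<in> V"
    and outer: "\<And>q v. \<lbrakk>q \<in> outside dual.D; v \<in> V\<rbrakk> \<Longrightarrow> index v q = 0"
    and inner: "\<And>q. \<lbrakk>q \<notin> dual.D; q \<notin> outside dual.D\<rbrakk> \<Longrightarrow> \<exists>v1\<in>V. v1 \<noteq> v0 \<and> index v1 q = orientation \<and>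
       index v0 q = - orientation \<and> (\<forall>v\<in>V. v \<noteq> v0 \<longrightarrow> v \<noteq> v1 \<longrightarrow> index v q = 0)"
    and own: "\<And>v. \<lbrakk>v \<in> V; v \<noteq> v0\<rbrakk> \<Longrightarrow> \<exists>q. q \<notin> dual.D \<and> index v q = orientation"
    by (rule index_distribution, rule that)
  have range: "index v q = -1 \<or> index v q = 0 \<or> index v q = 1 \<and> v = v0" if "v \<in> V" "q \<notin> dual.D" for v q
  proof (cases "q \<in> outside dual.D")
    case True then show ?thesis using outer that by simp
  next
    case False
    from inner[OF that(2) this] obtain v1 where "v1 \<noteq> v0" "index v1 q = -1" "index v0 q = 1"
      "\<forall>v\<in>V. v \<noteq> v0 \<longrightarrow> v \<noteq> v1 \<longrightarrow> index v q = 0" unfolding orientation_negative by auto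
    then show ?thesis using that(1) by (cases "v = v0"; cases "v = v1") auto
  qed
  have "peak = v0" by (rule peak_unique[OF v0 _ peak]) (use range in fastforce)
  have local: "(index v q = 0 \<longrightarrow> cuts_into h (p v) (q, -1) 2 \<and> \<not> cuts_saddle h (p v) q) \<and>
      (index v q = -1 \<longrightarrow> cuts_saddle h (p v) q) \<and>
      (index v q = 1 \<and> v = peak \<longrightarrow> lies_below h (p v) q \<and> \<not> cuts_saddle h (p v) q)"
    if v: "v \<in> V" and q: "q \<notin> dual.D" for v q
  proof -
    obtain l \<rho> b where cone: "cone_point h (p v) l \<rho>"
      "\<And>q. q \<notin> dual.D \<Longrightarrow> cone_point.alternating l q b"
      "\<And>q. q \<notin> dual.D \<Longrightarrow> real (card (cone_point.zeros l q b)) = 2 - 2 * index v q"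
      by (rule general_vertex_cone[OF v], rule that)
    interpret cone_point h "p v" l \<rho> by (rule cone(1))
    note alt = cone(2)[OF q] and card = cone(3)[OF q]
    have fin: "finite (zeros q b)" using alt by (simp add: alternating_def)
    have two: "cuts_into h (p v) (q, -1) 2 \<and> \<not> cuts_saddle h (p v) q" if "index v q = 0"
    proof -
      have "card (zeros q b) = 2" using card that by simp
      then have "cuts_into h (p v) (q, -1) 2" using cuts_into_zeros[OF fin] by simp
      then show ?thesis using saddle_not_two by blast
    qed
    have four: "cuts_saddle h (p v) q" if "index v q = -1"
      by (rule alternating_saddle[OF alt]) (use card that in simp)
    have below: "lies_below h (p v) q \<and> \<not> cuts_saddle h (p v) q" if one: "index v q = 1" "v = peak"
    proof -
      have empty: "zeros q b = {}" using card one fin by simp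
      define t where "t = \<rho> / 2"
      have t: "0 < t" "norm (of_real t * cis (Arg q)) < \<rho>" using \<rho> by (simp_all add: t_def norm_mult)
      have "h (p v + of_real t * cis (Arg q)) \<le> h (p v)" using peak one(2) by (simp add: is_peak_def)
      then have "t * l (cis (Arg q)) \<le> 0" using local_form[OF t(2)] l_homog[OF t(1)] by simp
      then have "l (cis (Arg q)) \<le> 0" using t(1) by (simp add: mult_le_0_iff)
      moreover have "0 \<le> q \<bullet> cis (Arg q)"
      proof -
        have "q = norm q *\<^sub>R cis (Arg q)" using rcis_cmod_Arg[of q] by (simp add: rcis_def scaleR_conv_of_real)
        then have "q \<bullet> cis (Arg q) = (norm q *\<^sub>R cis (Arg q)) \<bullet> cis (Arg q)" by (rule arg_cong)
        then show ?thesis by simp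
      qed
      ultimately have "l (cis (Arg q)) < q \<bullet> cis (Arg q)" using no_zeros[OF empty, of "Arg q"] by linarith
      then have "lies_below h (p v) q" using sign_constant_without_zeros[OF empty] by (intro lies_below_if)
      then show ?thesis using saddle_not_below by blast
    qed
    show ?thesis using two four below by blast
  qed
  have A: "\<exists>q. cuts_saddle h (p v) q" if v: "v \<in> V" "v \<noteq> peak" for v
  proof -
    obtain q where "q \<notin> dual.D" "index v q = -1"
      using own[of v] v \<open>peak = v0\<close> unfolding orientation_negative by blast
    then show ?thesis using local[OF v(1), of q] by blast
  qed
  have B: "\<exists>k\<le>4. cuts_into h (p v) n k" if v: "v \<in> V" and n: "n \<noteq> 0" for v n
  proof -
    obtain l \<rho> b where cone: "cone_point h (p v) l \<rho>"
      "\<And>q. q \<notin> dual.D \<Longrightarrow> cone_point.alternating l q b"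
      "\<And>q. q \<notin> dual.D \<Longrightarrow> real (card (cone_point.zeros l q b)) = 2 - 2 * index v q"
      by (rule general_vertex_cone[OF v], rule that)
    interpret cone_point h "p v" l \<rho> by (rule cone(1))
    show ?thesis
    proof (rule at_most_four_pieces[OF dual.negligible_D _ n])
      fix q a assume q: "q \<notin> dual.D"
      have fin: "finite (zeros q b)" using cone(2)[OF q] by (simp add: alternating_def)
      have "card (zeros q b) \<le> 4" using cone(3)[OF q] range[OF v q] by auto
      then show "finite (zeros q a) \<and> card (zeros q a) \<le> 4" 
        using card_zeros_shift(1)[OF fin, of a] card_zeros_shift(2)[OF fin, of a] by simp
    qed
  qed
  have C: "(\<exists>!v. v \<in> V \<and> cuts_saddle h (p v) q) \<and>
         (\<forall>v\<in>V. \<not> cuts_saddle h (p v) q \<and> v \<noteq> peak \<longrightarrow> cuts_into h (p v) (q, -1) 2) \<and>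
         lies_below h (p peak) q" if "q \<in> interior_directions dual.D" and q: "q \<notin> dual.D" for q
  proof -
    have "q \<notin> outside dual.D" by (rule interior_directions_bounded[OF that(1)])
    from inner[OF q this] obtain v1 where v1: "v1 \<in> V" "v1 \<noteq> peak" "index v1 q = -1" "index peak q = 1"
      and rest: "\<And>v. \<lbrakk>v \<in> V; v \<noteq> peak; v \<noteq> v1\<rbrakk> \<Longrightarrow> index v q = 0"
      unfolding orientation_negative \<open>peak = v0\<close>[symmetric] by auto
    have pV: "peak \<in> V" using v0 \<open>peak = v0\<close> by simp
    have s1: "cuts_saddle h (p v1) q" using local[OF v1(1) q] v1(3) by simp
    have pk: "lies_below h (p peak) q" "\<not> cuts_saddle h (p peak) q" using local[OF pV q] v1(4) by simp_all
    have other: "cuts_into h (p v) (q, -1) 2" "\<not> cuts_saddle h (p v) q" if "v \<in> V" "v \<noteq> peak" "v \<noteq> v1" for v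
      using local[OF that(1) q] rest[OF that] by simp_all
    show ?thesis
    proof (intro conjI)
      show "\<exists>!v. v \<in> V \<and> cuts_saddle h (p v) q"
      proof (rule ex1I[of _ v1])
        show "v = v1" if "v \<in> V \<and> cuts_saddle h (p v) q" for v
          using that other(2)[of v] pk(2) by (cases "v = peak") auto
      qed (use s1 v1 in blast)
      show "\<forall>v\<in>V. \<not> cuts_saddle h (p v) q \<and> v \<noteq> peak \<longrightarrow> cuts_into h (p v) (q, -1) 2"
        using other(1) s1 by blast
      show "lies_below h (p peak) q" by (rule pk(1))
    qed
  qed
  have F: "cuts_into h (p v) (q, -1) 2" if q: "q \<in> outer_directions dual.D" and v: "v \<in> V" for q v
  proof -
    have "q \<in> outside dual.D" "q \<notin> dual.D" using q by (auto simp: outer_directions_def outside_def)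
    then show ?thesis using local[OF v] outer[OF _ v] by blast
  qed
  show ?thesis
  proof (intro conjI ballI allI impI)
    show "\<exists>q. cuts_saddle h (p v) q" if "v \<in> V" "v \<noteq> peak" for v using A[OF that] .
    show "\<exists>k\<le>4. cuts_into h (p v) n k" if "v \<in> V" "n \<noteq> 0" for v n using B[OF that] .
    show "cuts_into h (p v) (q, -1) 2" if "q \<in> outer_directions dual.D" "v \<in> V" for q v using F[OF that] .
  next
    fix q assume q: "q \<in> interior_directions dual.D" "q \<notin> dual.D"
    show "\<exists>!v. v \<in> V \<and> cuts_saddle h (p v) q" using C[OF q] by (elim conjE)
    show "cuts_into h (p v) (q, -1) 2" if "v \<in> V" "\<not> cuts_saddle h (p v) q \<and> v \<noteq> peak" for v
      using C[OF q] that by blast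
    show "lies_below h (p peak) q" using C[OF q] by (elim conjE)
  qed
qed

end

section \<open>The reciprocal up to similarity, and the theorem\<close>

lemma rot_succ_similarity:
  assumes "a \<noteq> (0::complex)"
  shows "rot_succ E (\<lambda>v. a * p v + b) = rot_succ E p"
proof -
  have "ccw_angle ((a * p j + b) - (a * p v + b)) ((a * p k + b) - (a * p v + b)) = ccw_angle (p j - p v) (p k - p v)" for j k v
  proof -
    have "(a * p j + b) - (a * p v + b) = a * (p j - p v)" for j by (simp add: algebra_simps)
    then show ?thesis using assms unfolding ccw_angle_def by simp
  qed
  then show ?thesis unfolding rot_succ_def[abs_def] by presburger
qed

text \<open>Differences of positions are multiplied by \<open>a\<close>, which cancels in the quotients that define angles.\<close>

lemma noncrossing_framework_similarity:
  assumes a: "a \<noteq> (0::complex)" and nc: "noncrossing_framework V E p"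
  shows "noncrossing_framework V E (\<lambda>v. a * p v + b)"
proof -
  define S where "S z = a * z + b" for z
  have S: "inj S" using a by (auto simp: inj_def S_def)
  have seg: "edge_segment (\<lambda>v. a * p v + b) e = S ` edge_segment p e" for e
  proof -
    have "(\<lambda>v. a * p v + b) ` e = (\<lambda>x. b + x) ` ((*) a ` (p ` e))" by (simp only: image_image add.commute)
    moreover have "linear ((*) a)" by (rule bounded_linear.linear[OF bounded_linear_mult_right])
    ultimately have "edge_segment (\<lambda>v. a * p v + b) e = (\<lambda>x. b + x) ` ((*) a ` edge_segment p e)"
      using convex_hull_translation[of b "(*) a ` p ` e"] convex_hull_linear_image[of "(*) a" "p ` e"] by simp
    also have "\<dots> = S ` edge_segment p e" unfolding image_image S_def by (simp only: add.commute)
    finally show ?thesis .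
  qed
  have im: "(\<lambda>v. a * p v + b) ` A = S ` p ` A" for A by (simp only: image_image S_def)
  have ang: "two_straight_angles E (\<lambda>v. a * p v + b) v = two_straight_angles E p v" for v
  proof -
    have "(a * p j + b) - (a * p v + b) = a * (p j - p v)" for j by (simp add: algebra_simps)
    then have "ccw_angle ((a * p j + b) - (a * p v + b)) ((a * p k + b) - (a * p v + b)) = ccw_angle (p j - p v) (p k - p v)" for j k
      using a unfolding ccw_angle_def by simp
    then show ?thesis unfolding two_straight_angles_def rot_succ_similarity[OF a] by simp
  qed
  show ?thesis unfolding noncrossing_framework_def
  proof (intro conjI ballI impI)
    show "simple_graph V E" using nc by (simp add: noncrossing_framework_def)
    have "inj_on p V" using nc by (simp add: noncrossing_framework_def)
    then show "inj_on (\<lambda>v. a * p v + b) V" using a by (simp add: inj_on_def)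
    show "edge_segment (\<lambda>v. a * p v + b) e \<inter> edge_segment (\<lambda>v. a * p v + b) f \<subseteq> (\<lambda>v. a * p v + b) ` (e \<inter> f)"
      if "e \<in> E" "f \<in> E" "e \<noteq> f" for e f
    proof -
      have "edge_segment p e \<inter> edge_segment p f \<subseteq> p ` (e \<inter> f)" using nc that by (simp add: noncrossing_framework_def)
      then have "S ` (edge_segment p e \<inter> edge_segment p f) \<subseteq> S ` p ` (e \<inter> f)" by (rule image_mono)
      then show ?thesis by (simp only: seg im[symmetric] image_Int[OF S])
    qed
    show "a * p v + b \<notin> edge_segment (\<lambda>v. a * p v + b) e" if "e \<in> E" "v \<in> V" "v \<notin> e" for e v
    proof -
      have "p v \<notin> edge_segment p e" using nc that by (simp add: noncrossing_framework_def)
      then have "S (p v) \<notin> S ` edge_segment p e" using inj_image_mem_iff[OF S] by blast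
      then show ?thesis unfolding seg by (simp only: S_def not_False_eq_True)
    qed
    show "\<not> two_straight_angles E (\<lambda>v. a * p v + b) v" if "v \<in> V" for v
      using nc that unfolding ang by (simp add: noncrossing_framework_def)
  qed
qed

lemma drawing_cong:
  assumes "simple_graph V E" "\<And>v. v \<in> V \<Longrightarrow> p v = p' v"
  shows "drawing V E p = drawing V E p'"
proof -
  have "p ` e = p' ` e" if "e \<in> E" for e
    using assms that by (intro image_cong) (auto simp: simple_graph_def)
  moreover have "p ` V = p' ` V" using assms(2) by (intro image_cong) auto
  ultimately show ?thesis unfolding drawing_def by simp
qed

text \<open>The gradients and the given non-crossing reciprocal \<open>r\<close> have the same jumps across edges up to the factor
  \<open>a = c \<i>\<close>. Since all faces are connected by crossing edges, the gradients are \<open>a * r F + b\<close> for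
  a constant \<open>b\<close>. So they are positioned as in \<open>r\<close> up to similarity, and \<open>cut_by_planes\<close> applies.\<close>

theorem proposition1:
  fixes V :: "'v set" and E :: "'v set set" and p :: "'v \<Rightarrow> complex"
    and \<omega> :: "'v set \<Rightarrow> real" and h :: "complex \<Rightarrow> real"
    and m :: "complex set \<Rightarrow> complex" and peak :: 'v
  assumes "noncrossing_framework V E p"
    and "two_connected V E"
    and "good_self_stress V E p \<omega>"
    and "standard_lifting V E p \<omega> h"
    and "maxwell_reciprocal V E p h m"
    and "is_peak V p h peak"
  shows "(\<forall>v\<in>V. v \<noteq> peak \<longrightarrow> (\<exists>q. cuts_saddle h (p v) q)) \<and>
    (\<forall>v\<in>V. \<forall>n. n \<noteq> 0 \<longrightarrow> (\<exists>k\<le>4. cuts_into h (p v) n k)) \<and>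
    (let D = reciprocal_drawing V E p m in
      (\<forall>q\<in>interior_directions D. general_direction D q \<longrightarrow>
         (\<exists>!v. v \<in> V \<and> cuts_saddle h (p v) q) \<and>
         (\<forall>v\<in>V. \<not> cuts_saddle h (p v) q \<and> v \<noteq> peak \<longrightarrow> cuts_into h (p v) (q, -1) 2) \<and>
         lies_below h (p peak) q) \<and>
      (\<forall>q\<in>outer_directions D. \<forall>v\<in>V. cuts_into h (p v) (q, -1) 2))"
proof -
  interpret plane_framework V E p by unfold_locales (rule assms(1))
  obtain r where r: "noncrossing_reciprocal V E p \<omega> r" using assms(3) by (auto simp: good_self_stress_def)
  have lift: "continuous_on UNIV h" "\<And>F x. \<lbrakk>F \<in> faces V E p; \<not> bounded F; x \<in> F\<rbrakk> \<Longrightarrow> h x = 0"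
    using assms(4) by (simp_all add: standard_lifting_def)
  obtain c where c: "c \<in> {1, -1}" "\<forall>e\<in>E. boundary_edge V E p e \<longrightarrow> c * \<omega> e > 0"
    "\<forall>i j L R gL gR. left_face V E p i j L \<and> left_face V E p j i R \<and>
           affine_with_gradient h L gL \<and> affine_with_gradient h R gR \<longrightarrow>
           gL - gR = (c * \<omega> {i, j}) *\<^sub>R (\<i> * (p j - p i))"
    using assms(4) unfolding standard_lifting_def by (elim conjE bexE) (rule that)
  have grad: "affine_with_gradient h F (m F)" if "F \<in> faces V E p" for F
    using assms(5) that by (simp add: maxwell_reciprocal_def)
  have mjump: "m (left i j) - m (left j i) = (c * \<omega> {i, j}) *\<^sub>R (\<i> * (p j - p i))" if e: "{i, j} \<in> E" for i j
  proof -
    have e': "{j, i} \<in> E" using e by (simp add: insert_commute)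
    show ?thesis
      by (rule c(3)[rule_format, of i j "left i j" "left j i" "m (left i j)" "m (left j i)"]) (intro conjI left_face_left[OF e] left_face_left[OF e'] grad left_in_faces e e')
  qed
  have rjump: "r (left i j) - r (left j i) = \<omega> {i, j} *\<^sub>R (p j - p i)" if e: "{i, j} \<in> E" for i j
  proof -
    have e': "{j, i} \<in> E" using e by (simp add: insert_commute)
    have rec: "reciprocal V E p \<omega> r" using r by (simp add: noncrossing_reciprocal_def)
    show ?thesis
      by (rule rec[unfolded reciprocal_def, rule_format]) (intro conjI left_face_left[OF e] left_face_left[OF e'])
  qed
  define a where "a = of_real c * \<i>"
  have a: "a \<noteq> 0" using c(1) by (auto simp: a_def)
  have "D \<noteq> UNIV" using compact_D not_compact_UNIV by metis
  then obtain x0 where "x0 \<notin> D" by blast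
  then obtain F0 where F0: "F0 \<in> faces V E p" by (rule point_in_face)
  define b where "b = m F0 - a * r F0"
  have aff: "m F = a * r F + b" if "F \<in> faces V E p" for F
  proof -
    have "F \<in> {F. m F - a * r F = b}"
    proof (rule faces_crossing_induct[OF F0 _ that])
      fix i j assume e: "{i, j} \<in> E" and "left i j \<in> {F. m F - a * r F = b}"
      moreover have "m (left i j) - m (left j i) = a * (r (left i j) - r (left j i))"
        unfolding mjump[OF e] rjump[OF e] a_def by (simp add: scaleR_conv_of_real)
      ultimately show "left j i \<in> {F. m F - a * r F = b}" by (simp add: algebra_simps)
    qed (simp add: b_def)
    then show ?thesis by (simp add: algebra_simps)
  qed
  define m' where "m' F = a * r F + b" for F
  have m': "m F = m' F" if "F \<in> faces V E p" for F using aff[OF that] by (simp add: m'_def)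
  have nc: "noncrossing_framework (faces V E p) (dual_edges V E p) r" using r by (simp add: noncrossing_reciprocal_def)
  interpret standard_reciprocal_lifting V E p h m' "\<lambda>e. c * \<omega> e"
  proof unfold_locales
    show "continuous_on UNIV h" by (rule lift(1))
    show "affine_with_gradient h F (m' F)" if "F \<in> faces V E p" for F using grad[OF that] m'[OF that] by simp
    show "noncrossing_framework (faces V E p) (dual_edges V E p) m'"
      unfolding m'_def[abs_def] by (rule noncrossing_framework_similarity[OF a nc])
    show "two_connected V E" by (rule assms(2))
    show "inj_on (dual_edge V E p) E" using r by (simp add: noncrossing_reciprocal_def)
    have "dual_embedding_same V E p m' = dual_embedding_same V E p r"
      "dual_embedding_reversed V E p m' = dual_embedding_reversed V E p r"
      unfolding dual_embedding_same_def dual_embedding_reversed_def face_succ_def m'_def[abs_def] rot_succ_similarity[OF a]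
      by (rule refl)+
    then show "dual_embedding_same V E p m' \<or> dual_embedding_reversed V E p m'"
      using r by (simp add: noncrossing_reciprocal_def)
    show "h x = 0" if "F \<in> faces V E p" "\<not> bounded F" "x \<in> F" for F x using lift(2) that by blast
    show "m' (left i j) - m' (left j i) = (c * \<omega> {i, j}) *\<^sub>R (\<i> * (p j - p i))" if e: "{i, j} \<in> E" for i j
      using mjump[OF e] m'[OF left_in_faces[OF e]] m'[OF left_in_faces[of j i]] e by (simp add: insert_commute)
    show "0 < c * \<omega> e" if "e \<in> E" "boundary_edge V E p e" for e using c(2) that by blast
  qed
  have D: "reciprocal_drawing V E p m = dual.D"
    unfolding reciprocal_drawing_def
    by (rule drawing_cong) (use nc m' in \<open>auto simp: noncrossing_framework_def\<close>)
  show ?thesis unfolding D Let_def by (rule cut_by_planes[OF assms(6)])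
qed

end
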